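(* Let $X,X_1,X_2,\dots$ be i.i.d. random variables with $\mathbf E X=0$ and $\mathbf E X^2\in(0,\infty)$, and let $S_0=0$, $S_n=X_1+\dots+X_n$. Assume that $\mathbf E e^{\lambda|X|}<\infty$ for some $\lambda>0$ and that the distribution of $X$ is lattice with maximal span $1$. Let $V_k,U_k,\overline U_k$ ($k\ge1$) be the coefficient functions in the asymptotic expansions of $\mathbf P(\tau_x>n)$, $\mathbf P(S_n=x,\tau_0>n)$ and $\mathbf P(S_n=x,\overline\tau_0>n)$ described in the context. Then, for every $k\ge1$, there exist polynomials $P_k$, $Q_k$ and $\overline Q_k$ of degree $2k-1$ such that, for some $\varepsilon>0$, as $x\to\infty$ through the integers, $$V_k(x)=P_k(x)+O(e^{-\varepsilon x}),\qquad U_k(x)=Q_k(x)+O(e^{-\varepsilon x}),\qquad \overline U_k(x)=\overline Q_k(x)+O(e^{-\varepsilon x}).$$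
   Context: "Lattice with maximal span $1$" means that $X$ takes values in $\mathbb Z$ and there are no integers $a$ and $h\ge2$ with $\mathbf P(X\in a+h\mathbb Z)=1$. Let $\tau_x=\inf\{n\ge1:x+S_n\le0\}$ for $x\ge0$, $\overline\tau_0=\inf\{n\ge1:S_n<0\}$, and $a_n^{(j)}:=[s^n](1-s)^{j-3/2}=(-1)^n\binom{j-3/2}{n}$ for $j\ge1,n\ge0$. Definition of the coefficient functions (under the stated assumptions they exist, are uniquely determined by the expansions and do not depend on $r$): for every integer $r\ge2$, as $n\to\infty$, uniformly in integers $x\ge0$, $$\mathbf P(\tau_x>n)=\sum_{j=1}^{\lfloor r/2\rfloor+1}V_j(x)a_n^{(j)}+O\left(\frac{(1+x)^{r+2}}{n^{(r+2)/2}}\log^{\lfloor (r+1)/2\rfloor}n\right),$$ $$\mathbf P(S_n=x,\tau_0>n)=\sum_{j=1}^{\lfloor (r+1)/2\rfloor}U_j(x)a_n^{(j+1)}+O\left(\frac{(1+x)^{r+1}}{n^{(r+3)/2}}\log^{\lfloor r/2\rfloor}n\right),$$ $$\mathbf P(S_n=x,\overline\tau_0>n)=\sum_{j=1}^{\lfloor (r+1)/2\rfloor}\overline U_j(x)a_n^{(j+1)}+O\left(\frac{(1+x)^{r+1}}{n^{(r+3)/2}}\log^{\lfloor r/2\rfloor}n\right).$$ *)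

theory Defs
  imports "HOL-Probability.Probability" "HOL-Library.Landau_Symbols"
    "HOL-Computational_Algebra.Polynomial"
begin

definition lattice_max_span_1 :: "'a measure \<Rightarrow> ('a \<Rightarrow> real) \<Rightarrow> bool" where
  "lattice_max_span_1 M X \<longleftrightarrow>
     (AE \<omega> in M. X \<omega> \<in> \<int>) \<and>
     \<not> (\<exists>a h :: int. h \<ge> 2 \<and>
          measure M {\<omega> \<in> space M. \<exists>m :: int. X \<omega> = of_int (a + h * m)} = 1)"

definition walk :: "(nat \<Rightarrow> 'a \<Rightarrow> real) \<Rightarrow> nat \<Rightarrow> 'a \<Rightarrow> real" where
  "walk Xs n \<omega> = (\<Sum>i = 1..n. Xs i \<omega>)"

text \<open>The infimum is taken in \<^typ>\<open>enat\<close>, so a time is \<open>\<infinity>\<close> if the walk never enters.\<close>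

definition tau :: "(nat \<Rightarrow> 'a \<Rightarrow> real) \<Rightarrow> nat \<Rightarrow> 'a \<Rightarrow> enat" where
  "tau Xs x \<omega> = Inf (enat ` {n. n \<ge> 1 \<and> real x + walk Xs n \<omega> \<le> 0})"

definition tau_bar0 :: "(nat \<Rightarrow> 'a \<Rightarrow> real) \<Rightarrow> 'a \<Rightarrow> enat" where
  "tau_bar0 Xs \<omega> = Inf (enat ` {n. n \<ge> 1 \<and> walk Xs n \<omega> < 0})"

text \<open>The coefficient of \<open>s ^ n\<close> in \<open>(1 - s) powr (j - 3/2)\<close>, for \<open>j \<ge> 1\<close>.\<close>

definition a_coeff :: "nat \<Rightarrow> nat \<Rightarrow> real" where
  "a_coeff j n = (-1) ^ n * ((real j - 3 / 2) gchoose n)"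

text \<open>\<open>f n x = O(g n x)\<close> as \<open>n \<rightarrow> \<infinity>\<close>, uniformly in all \<open>x \<ge> 0\<close>.\<close>

definition unif_bigo :: "(nat \<Rightarrow> nat \<Rightarrow> real) \<Rightarrow> (nat \<Rightarrow> nat \<Rightarrow> real) \<Rightarrow> bool" where
  "unif_bigo f g \<longleftrightarrow> (\<exists>C N. \<forall>n\<ge>N. \<forall>x. \<bar>f n x\<bar> \<le> C * \<bar>g n x\<bar>)"

text \<open>
  The expansions below hold to every order \<open>r \<ge> 2\<close> with one and the same family of
  coefficient functions (indexed from \<open>1\<close>; the value at index \<open>0\<close> is irrelevant),
  which determines that family uniquely.
\<close>

definition tail_coeffs ::
  "'a measure \<Rightarrow> (nat \<Rightarrow> 'a \<Rightarrow> real) \<Rightarrow> (nat \<Rightarrow> nat \<Rightarrow> real) \<Rightarrow> bool" where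
  "tail_coeffs M Xs V \<longleftrightarrow> (\<forall>r::nat. r \<ge> 2 \<longrightarrow>
     unif_bigo
       (\<lambda>n x. measure M {\<omega> \<in> space M. tau Xs x \<omega> > enat n}
              - (\<Sum>j = 1..r div 2 + 1. V j x * a_coeff j n))
       (\<lambda>n x. (1 + real x) ^ (r + 2) / real n powr ((real r + 2) / 2)
              * ln (real n) ^ ((r + 1) div 2)))"

text \<open>
  The two local expansions differ only in the stopping time \<open>T\<close>, which is
  \<open>tau Xs 0\<close> for \<open>U\<close> and \<open>tau_bar0 Xs\<close> for \<open>U_bar\<close>.
\<close>

definition local_coeffs ::
  "'a measure \<Rightarrow> (nat \<Rightarrow> 'a \<Rightarrow> real) \<Rightarrow> ('a \<Rightarrow> enat) \<Rightarrow> (nat \<Rightarrow> nat \<Rightarrow> real) \<Rightarrow> bool" where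
  "local_coeffs M Xs T U \<longleftrightarrow> (\<forall>r::nat. r \<ge> 2 \<longrightarrow>
     unif_bigo
       (\<lambda>n x. measure M {\<omega> \<in> space M. walk Xs n \<omega> = real x \<and> T \<omega> > enat n}
              - (\<Sum>j = 1..(r + 1) div 2. U j x * a_coeff (j + 1) n))
       (\<lambda>n x. (1 + real x) ^ (r + 1) / real n powr ((real r + 3) / 2)
              * ln (real n) ^ (r div 2)))"

end

theory Submission
  imports Defs "HOL-Complex_Analysis.Complex_Analysis" "HOL-Real_Asymp.Real_Asymp"
begin

text \<open>
  Comparing the expansions at times \<open>n\<close> and \<open>n + 1\<close> and using
  \<open>(1 - s) (1 - s)\<^bsup>j - 3/2\<^esup> = (1 - s)\<^bsup>j - 1/2\<^esup>\<close>, the coefficient functions satisfy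
  \<open>f\<^sub>k = T f\<^sub>k - T f\<^sub>k\<^sub>-\<^sub>1\<close> with \<open>f\<^sub>0 = 0\<close>, where \<open>T\<close> is the transition operator of the walk killed when
  it leaves the half-line (of the reflected walk in the two local cases); uniformity in \<open>x\<close> makes
  them grow at most polynomially.  With \<open>F\<^sub>k(z) = \<Sum> f\<^sub>k(x) z\<^sup>x\<close> and \<open>\<Phi>(z) = E z\<^bsup>-X\<^esup>\<close> the recursion becomes
  \<open>(\<Phi> - 1) F\<^sub>k = \<Phi> F\<^sub>k\<^sub>-\<^sub>1 + N\<^sub>k\<close> on an annulus inside the unit circle, with \<open>N\<^sub>k\<close> analytic across the
  circle.  Since \<open>\<Phi> - 1\<close> has a double zero at \<open>1\<close> and, by aperiodicity, no other zero near the circle,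
  \<open>(1 - z)\<^bsup>2k\<^esup> F\<^sub>k(z)\<close> continues analytically beyond the circle, so \<open>f\<^sub>k\<close> is a polynomial of degree at most
  \<open>2k - 1\<close> up to an exponentially small error.  The degree is exact as soon as \<open>f\<^sub>1\<close> does not vanish,
  because the value of \<open>(1 - z)\<^sup>2 F\<^sub>1\<close> at \<open>1\<close> is a positive multiple of a sum of terms of one sign.  If
  \<open>f\<^sub>1\<close> vanished, the survival probability of the walk would be \<open>O(n\<^bsup>-9/8\<^esup>)\<close>, contradicting the
  lower bound of order \<open>1/n\<close> given by optional stopping.
\<close>

section \<open>Backward differences\<close>

text \<open>The transform equation has two unknowns, \<open>F_k\<close> and the boundary term
  \<open>N_k\<close>. The boundary term is never computed: it is built from power series in 1/z that
  converge for 1 < |1/z| < R, hence for all |1/z| < R, and only this analyticity and its value at 1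
  matter. That value enters for k = 1 only. From then on the value at 1 of the continued function is
  passed from k to k + 1 up to a fixed nonzero factor, so a single nonvanishing check settles all
  degrees.

  In the local cases this check compares leaving the half-line anywhere with leaving it at -1.
  Exponential moments confine the overshoot to O(log n) levels. A vanishing \<open>f_1\<close>
  leaves at most n^(-9/4) for an exit at -1, the logarithms cost n^(1/16), and summation over later
  times gives the exponent 9/8. Summing from infinity requires that survival probabilities tend to
  0. This comes from the case k = 1 itself: their limit is bounded and harmonic, whereas a nonzero
  nonnegative solution would have to grow linearly.\<close>

definition nabla :: "(nat \<Rightarrow> 'a::ab_group_add) \<Rightarrow> nat \<Rightarrow> 'a" where
  "nabla f i = (case i of 0 \<Rightarrow> f 0 | Suc j \<Rightarrow> f (Suc j) - f j)"

lemma sum_nabla: "(\<Sum>i\<le>n. nabla f i) = f n"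
  by (induction n) (auto simp: nabla_def)

text \<open>The basis adapted to \<open>nabla\<close>: summing (i + j choose j) over i \<le> n gives
  (n + j + 1 choose j + 1), so undoing one difference merely shifts coefficients.\<close>

definition rising_poly :: "nat \<Rightarrow> real poly" where
  "rising_poly j = smult (1 / fact j) (\<Prod>i=1..j. [:real i, 1:])"

lemma poly_rising_poly: "poly (rising_poly j) (real x) = real ((x + j) choose j)"
proof -
  have "(\<Prod>i=1..j. real i + real x) * fact x = fact (x + j)"
  proof (induction j)
    case (Suc j)
    have "(\<Prod>i=1..Suc j. real i + real x) * fact x =
        (real (Suc j) + real x) * ((\<Prod>i=1..j. real i + real x) * fact x)"
      by (simp add: algebra_simps)
    also have "\<dots> = fact (x + Suc j)"
      unfolding Suc.IH by simp
    finally show ?case .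
  qed auto
  hence "(\<Prod>i=1..j. real i + real x) = fact (x + j) / fact x"
    by (simp add: field_simps)
  thus ?thesis
    by (simp add: rising_poly_def poly_prod binomial_fact)
qed

lemma degree_rising_poly: "degree (rising_poly j) = j"
  by (simp add: rising_poly_def degree_prod_eq_sum_degree)

lemma exp_decay_suminf_tail:
  fixes e :: "nat \<Rightarrow> real"
  assumes "\<And>i. \<bar>e i\<bar> \<le> C * r ^ i" and "0 < r" "r < 1"
  shows "\<bar>(\<Sum>i\<le>n. e i) - suminf e\<bar> \<le> C * r / (1 - r) * r ^ n"
proof -
  have sg: "summable (\<lambda>i. C * r ^ i)"
    using assms by (intro summable_mult summable_geometric) auto
  hence se: "summable e" "summable (\<lambda>i. \<bar>e i\<bar>)"
    using assms(1) by (auto intro!: summable_comparison_test'[OF sg, of 0])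
  have "suminf e = (\<Sum>i. e (i + Suc n)) + (\<Sum>i<Suc n. e i)"
    by (rule suminf_split_initial_segment[OF se(1)])
  hence "\<bar>(\<Sum>i\<le>n. e i) - suminf e\<bar> = \<bar>\<Sum>i. e (i + Suc n)\<bar>"
    by (simp add: lessThan_Suc_atMost)
  also have "\<dots> \<le> (\<Sum>i. \<bar>e (i + Suc n)\<bar>)"
    by (rule summable_rabs) (use se(2) summable_iff_shift[of "\<lambda>i. \<bar>e i\<bar>" "Suc n"] in simp)
  also have "\<dots> \<le> (\<Sum>i. (C * r ^ Suc n) * r ^ i)"
  proof (rule suminf_le)
    show "\<bar>e (i + Suc n)\<bar> \<le> (C * r ^ Suc n) * r ^ i" for i
      using assms(1)[of "i + Suc n"] by (simp add: power_add mult_ac)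
    show "summable (\<lambda>i. \<bar>e (i + Suc n)\<bar>)"
      using se(2) summable_iff_shift[of "\<lambda>i. \<bar>e i\<bar>" "Suc n"] by simp
    show "summable (\<lambda>i. (C * r ^ Suc n) * r ^ i)"
      using assms by (intro summable_mult summable_geometric) auto
  qed
  also have "\<dots> = C * r ^ Suc n * (1 / (1 - r))"
    using assms by (subst suminf_mult) (auto simp: suminf_geometric summable_geometric)
  finally show ?thesis by (simp add: field_simps)
qed

text \<open>Each summation turns the error into its partial sums, which differ from the total sum by
  a tail of the same geometric rate. The total becomes the new constant coefficient. The top
  coefficient arises in the innermost summation and is only shifted afterwards, hence its value as a
  sum.\<close>

lemma nabla_exp_decay:
  fixes f :: "nat \<Rightarrow> real"
  assumes "\<And>i. \<bar>(nabla ^^ D) f i\<bar> \<le> C * r ^ i" and r: "0 < r" "r < 1"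
  shows "\<exists>c C'. (\<forall>i. \<bar>f i - (\<Sum>j<D. c j * real ((i + j) choose j))\<bar> \<le> C' * r ^ i) \<and>
           (D > 0 \<longrightarrow> c (D - 1) = suminf ((nabla ^^ D) f))"
  using assms(1)
proof (induction D arbitrary: f C)
  case 0
  thus ?case by auto
next
  case (Suc D)
  define g where "g = nabla f"
  have "\<And>i. \<bar>(nabla ^^ D) g i\<bar> \<le> C * r ^ i"
    using Suc.prems by (simp only: funpow_Suc_right o_def g_def)
  from Suc.IH[OF this] obtain c C' where
    c: "\<And>i. \<bar>g i - (\<Sum>j<D. c j * real ((i + j) choose j))\<bar> \<le> C' * r ^ i"
    and top: "D > 0 \<Longrightarrow> c (D - 1) = suminf ((nabla ^^ D) g)" by auto
  define e where "e i = g i - (\<Sum>j<D. c j * real ((i + j) choose j))" for i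
  \<comment> \<open>The old coefficients move up by one; the constant of summation fills index
    0.\<close>
  define c' where "c' j = (case j of 0 \<Rightarrow> suminf e | Suc j \<Rightarrow> c j)" for j
  have "f n - (\<Sum>j<Suc D. c' j * real ((n + j) choose j)) = (\<Sum>i\<le>n. e i) - suminf e" for n
  proof -
    have ch: "(\<Sum>i\<le>n. (i + j) choose j) = (n + Suc j) choose Suc j" for j
      using sum_choose_diagonal[of j] by (induction n) (auto simp: add.commute)
    have "f n = (\<Sum>i\<le>n. e i + (\<Sum>j<D. c j * real ((i + j) choose j)))"
      using sum_nabla[of f n] by (simp add: e_def g_def)
    also have "\<dots> = (\<Sum>i\<le>n. e i) + (\<Sum>j<D. c j * real (\<Sum>i\<le>n. (i + j) choose j))"
      unfolding sum.distrib of_nat_sum sum_distrib_left by (subst (2) sum.swap) simp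
    finally show ?thesis
      unfolding ch sum.lessThan_Suc_shift by (simp add: c'_def)
  qed
  moreover have "\<bar>(\<Sum>i\<le>n. e i) - suminf e\<bar> \<le> C' * r / (1 - r) * r ^ n" for n
    by (rule exp_decay_suminf_tail) (use c r in \<open>auto simp: e_def\<close>)
  ultimately have "\<forall>n. \<bar>f n - (\<Sum>j<Suc D. c' j * real ((n + j) choose j))\<bar> \<le> C' * r / (1 - r) * r ^ n"
    by simp
  moreover have "c' (Suc D - 1) = suminf ((nabla ^^ Suc D) f)"
  proof (cases D)
    case 0
    moreover from this have "e = g" by (simp add: e_def fun_eq_iff)
    ultimately show ?thesis by (simp add: c'_def g_def)
  next
    case (Suc D')
    have "suminf ((nabla ^^ Suc D) f) = suminf ((nabla ^^ D) g)"
      by (simp only: funpow_Suc_right o_def g_def)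
    thus ?thesis using top Suc by (simp add: c'_def)
  qed
  ultimately show ?case by blast
qed

lemma nabla_exp_decay_poly:
  fixes f :: "nat \<Rightarrow> real"
  assumes "\<And>i. \<bar>(nabla ^^ Suc d) f i\<bar> \<le> C * r ^ i" and r: "0 < r" "r < 1"
    and nz: "suminf ((nabla ^^ Suc d) f) \<noteq> 0"
  shows "\<exists>P C'. degree P = d \<and> (\<forall>i. \<bar>f i - poly P (real i)\<bar> \<le> C' * r ^ i)"
proof -
  from nabla_exp_decay[OF assms(1) r] obtain c C' where
    c: "\<And>i. \<bar>f i - (\<Sum>j<Suc d. c j * real ((i + j) choose j))\<bar> \<le> C' * r ^ i"
    and cd: "c d = suminf ((nabla ^^ Suc d) f)" by fastforce
  define P where "P = (\<Sum>j<Suc d. smult (c j) (rising_poly j))"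
  have "c d \<noteq> 0" using cd nz by simp
  hence "degree P = d"
  proof -
    have "degree (\<Sum>j<d. smult (c j) (rising_poly j)) < d \<or> d = 0"
    proof (cases d)
      case (Suc d')
      have "degree (\<Sum>j<d. smult (c j) (rising_poly j)) \<le> d'"
        using Suc by (intro degree_sum_le) (auto simp: degree_rising_poly intro: order.trans[OF degree_smult_le])
      thus ?thesis using Suc by simp
    qed auto
    thus ?thesis using \<open>c d \<noteq> 0\<close>
      by (cases "d = 0") (auto simp: P_def degree_rising_poly degree_add_eq_right)
  qed
  moreover have "poly P (real i) = (\<Sum>j<Suc d. c j * real ((i + j) choose j))" for i
    by (simp add: P_def poly_sum poly_rising_poly)
  ultimately show ?thesis using c by (intro exI[of _ P] exI[of _ C']) simp
qed

text \<open>The convention \<open>nabla f 0 = f 0\<close> amounts to f(-1) = 0, so multiplication by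
  1 - z leaves no boundary term.\<close>

lemma nabla_power_series:
  fixes f :: "nat \<Rightarrow> 'a :: {comm_ring_1, real_normed_algebra_1, topological_ab_group_add}"
  assumes "(\<lambda>i. f i * z ^ i) sums s"
  shows "(\<lambda>i. nabla f i * z ^ i) sums ((1 - z) * s)"
proof -
  have "(\<lambda>i. (f i * z ^ i) * z) sums (s * z)" by (rule sums_mult2[OF assms])
  hence "(\<lambda>i. f i * z ^ Suc i) sums (s * z)" by (simp add: mult_ac)
  hence "(\<lambda>i. case i of 0 \<Rightarrow> 0 | Suc j \<Rightarrow> f j * z ^ Suc j) sums (s * z)"
    using sums_Suc_iff[of "\<lambda>i. case i of 0 \<Rightarrow> 0 | Suc j \<Rightarrow> f j * z ^ Suc j" "s * z"] by simp
  note diff = sums_diff[OF assms this]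
  have eq: "f i * z ^ i - (case i of 0 \<Rightarrow> 0 | Suc j \<Rightarrow> f j * z ^ Suc j) = nabla f i * z ^ i" for i
    by (simp add: nabla_def algebra_simps split: nat.splits)
  show ?thesis
    using diff by (simp only: eq left_diff_distrib mult_1 mult.commute[of z])
qed

section \<open>Infinite sums and power series\<close>

lemma has_sum_int_split:
  fixes f :: "int \<Rightarrow> 'a::banach"
  assumes "(f has_sum s) UNIV"
  obtains a b where "(\<lambda>n. f (int n)) sums a" "(\<lambda>n. f (- 1 - int n)) sums b" "s = a + b"
proof -
  have sm: "f summable_on UNIV" using assms by (auto simp: summable_on_def)
  define a where "a = infsum f {0..}"
  define b where "b = infsum f {..<0}"
  have a: "(f has_sum a) {0..}" and b: "(f has_sum b) {..<0}"
    unfolding a_def b_def by (intro has_sum_infsum summable_on_subset_banach[OF sm]; simp)+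
  have "(f has_sum (a + b)) ({0..} \<union> {..<0})"
    by (intro has_sum_Un_disjoint a b) auto
  also have "{0..} \<union> {..<0} = (UNIV :: int set)" by auto
  finally have "s = a + b" using assms has_sum_unique by blast
  moreover have "((\<lambda>n. f (int n)) has_sum a) UNIV"
    by (subst has_sum_reindex_bij_witness[of UNIV nat int "{0..}" f _ a a]) (use a in auto)
  moreover have "((\<lambda>n. f (- 1 - int n)) has_sum b) UNIV"
    by (subst has_sum_reindex_bij_witness[of UNIV "\<lambda>x. nat (- 1 - x)" "\<lambda>n. - 1 - int n" "{..<0}" f _ b b])
       (use b in auto)
  ultimately show ?thesis using that has_sum_imp_sums by blast
qed

lemma has_sum_int_of_nat:
  fixes f :: "int \<Rightarrow> 'a::banach"
  assumes "summable (\<lambda>n. norm (f (int n)))" and "\<And>x. x < 0 \<Longrightarrow> f x = 0"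
  shows "(f has_sum (\<Sum>n. f (int n))) UNIV" "(\<lambda>x. norm (f x)) summable_on UNIV"
proof -
  have "((\<lambda>n. f (int n)) has_sum (\<Sum>n. f (int n))) UNIV"
    by (intro norm_summable_imp_has_sum assms summable_sums summable_norm_cancel)
  also have "?this \<longleftrightarrow> (f has_sum (\<Sum>n. f (int n))) {0..}"
    by (rule has_sum_reindex_bij_witness[of UNIV nat int]) auto
  also have "\<dots> \<longleftrightarrow> (f has_sum (\<Sum>n. f (int n))) UNIV"
    by (rule has_sum_cong_neutral) (use assms in auto)
  finally show "(f has_sum (\<Sum>n. f (int n))) UNIV" .
  have "((\<lambda>n. norm (f (int n))) has_sum (\<Sum>n. norm (f (int n)))) UNIV"
    using assms by (intro norm_summable_imp_has_sum summable_sums) auto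
  also have "?this \<longleftrightarrow> ((\<lambda>x. norm (f x)) has_sum (\<Sum>n. norm (f (int n)))) {0..}"
    by (rule has_sum_reindex_bij_witness[of UNIV nat int]) auto
  also have "\<dots> \<longleftrightarrow> ((\<lambda>x. norm (f x)) has_sum (\<Sum>n. norm (f (int n)))) UNIV"
    by (rule has_sum_cong_neutral) (use assms in auto)
  finally show "(\<lambda>x. norm (f x)) summable_on UNIV" by (auto simp: summable_on_def)
qed

lemma has_sum_times:
  fixes a b :: "_ \<Rightarrow> 'a :: {real_normed_field, banach}"
  assumes "(a has_sum s) A" "(b has_sum t) B"
    and "(\<lambda>x. norm (a x)) summable_on A" "(\<lambda>y. norm (b y)) summable_on B"
  shows "((\<lambda>(x,y). a x * b y) has_sum (s * t)) (A \<times> B)"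
proof (rule has_sum_SigmaI)
  show "((\<lambda>y. case (x, y) of (x, y) \<Rightarrow> a x * b y) has_sum a x * t) B" for x
    using assms(2) by (simp add: has_sum_cmult_right)
  show "((\<lambda>x. a x * t) has_sum (s * t)) A"
    by (rule has_sum_cmult_left[OF assms(1)])
  have "(\<lambda>p. norm (case p of (x, y) \<Rightarrow> a x * b y)) summable_on A \<times> B"
  proof (rule summable_on_SigmaI)
    show "((\<lambda>y. norm (case (x, y) of (x, y) \<Rightarrow> a x * b y)) has_sum norm (a x) * infsum (\<lambda>y. norm (b y)) B) B" for x
      using assms(4) by (auto simp: norm_mult intro!: has_sum_cmult_right)
    show "(\<lambda>x. norm (a x) * infsum (\<lambda>y. norm (b y)) B) summable_on A"
      using assms(3) by (rule summable_on_cmult_left)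
  qed auto
  thus "(\<lambda>(x, y). a x * b y) summable_on A \<times> B"
    by (rule abs_summable_summable)
qed

lemma pmf_has_sum:
  fixes g :: "'a \<Rightarrow> 'b::{banach, second_countable_topology}"
  assumes "integrable (measure_pmf q) g"
  shows "((\<lambda>m. pmf q m *\<^sub>R g m) has_sum measure_pmf.expectation q g) UNIV"
    and "(\<lambda>m. norm (pmf q m *\<^sub>R g m)) summable_on UNIV"
proof -
  have "integrable (count_space UNIV) (\<lambda>m. pmf q m *\<^sub>R g m)"
    using assms unfolding measure_pmf_eq_density
    by (subst (asm) integrable_density) auto
  hence s: "Infinite_Set_Sum.abs_summable_on (\<lambda>m. pmf q m *\<^sub>R g m) UNIV"
    by (simp add: Infinite_Set_Sum.abs_summable_on_def)
  thus "(\<lambda>m. norm (pmf q m *\<^sub>R g m)) summable_on UNIV"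
    by (rule abs_summable_equivalent[THEN iffD2])
  hence "(\<lambda>m. pmf q m *\<^sub>R g m) summable_on UNIV"
    by (rule abs_summable_summable)
  moreover have "measure_pmf.expectation q g = infsum (\<lambda>m. pmf q m *\<^sub>R g m) UNIV"
    unfolding infsetsum_infsum[OF s, symmetric] infsetsum_def measure_pmf_eq_density
    by (subst integral_density) simp_all
  ultimately show "((\<lambda>m. pmf q m *\<^sub>R g m) has_sum measure_pmf.expectation q g) UNIV"
    by simp
qed

text \<open>Convergence at one point of modulus t forces convergence in the whole disc of radius t,
  so the hole of the annulus fills itself.\<close>

lemma annulus_powser_holomorphic:
  fixes a :: "nat \<Rightarrow> complex"
  assumes "\<And>w. r < norm w \<Longrightarrow> norm w < R \<Longrightarrow> summable (\<lambda>n. a n * w ^ n)" "r < R" "0 < R"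
  shows "(\<lambda>w. \<Sum>n. a n * w ^ n) holomorphic_on ball 0 R"
proof (rule power_series_holomorphic)
  fix w :: complex assume w: "w \<in> ball 0 R"
  obtain t where t: "max r (norm w) < t" "t < R"
    using dense[of "max r (norm w)" R] assms w by (auto)
  hence "summable (\<lambda>n. a n * (complex_of_real t) ^ n)"
    using assms(1)[of "complex_of_real t"] order.trans[OF norm_ge_zero[of w], of t] by auto
  hence "summable (\<lambda>n. a n * w ^ n)"
    by (rule powser_inside) (use t in auto)
  thus "(\<lambda>n. a n * (w - 0) ^ n) sums (\<Sum>n. a n * w ^ n)"
    by (simp add: summable_sums)
qed

text \<open>By uniqueness the \<open>g i\<close> are the Taylor coefficients of \<open>H\<close>. At
  a real point t strictly between 1 and R the terms are bounded, which gives the rate r = 1/t; the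
  series also converges at 1, where it sums to \<open>H 1\<close>.\<close>

lemma powser_coeff_decay:
  fixes g :: "nat \<Rightarrow> real"
  assumes hol: "H holomorphic_on ball 0 R" and R: "R > 1"
    and sums: "\<And>z. norm z < 1 \<Longrightarrow> (\<lambda>i. complex_of_real (g i) * z ^ i) sums H z"
  obtains C r where "0 < r" "r < 1" "\<And>i. \<bar>g i\<bar> \<le> C * r ^ i" "complex_of_real (suminf g) = H 1"
proof -
  define c where "c n = (deriv ^^ n) H 0 / fact n" for n
  have c: "(\<lambda>n. c n * z ^ n) sums H z" if "norm z < R" for z
    using holomorphic_power_series[OF hol, of z] that by (simp add: c_def)
  have eq: "complex_of_real (g n) = c n" for n
  proof (rule ccontr)
    assume neq: "complex_of_real (g n) \<noteq> c n"
    have d: "(\<lambda>n. (g n - c n) * (z - 0) ^ n) sums 0" if "norm (z - 0) < 1" for z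
      using sums_diff[OF sums[of z] c[of z]] that R by (simp add: algebra_simps)
    have "g 0 = c 0"
      using d[of 0] sums_unique2[OF _ powser_sums_zero[of "\<lambda>n. complex_of_real (g n) - c n"], of 0] by simp
    hence "n > 0" using neq by (cases n) auto
    \<comment> \<open>A nonzero coefficient of positive index would make 0 an isolated zero of the
      sum, but the sum vanishes identically. Index 0 was settled separately by evaluating at
      0.\<close>
    show False
    proof (rule powser_0_nonzero[of 1 0 "\<lambda>n. g n - c n" "\<lambda>_. 0" n])
      show "(\<lambda>n. (complex_of_real (g n) - c n) * (x - 0) ^ n) sums 0" if "norm (x - 0) < 1" for x
        using d[OF that] .
    next
      fix s :: real assume s: "0 < s" "\<And>z::complex. z \<in> cball 0 s - {0} \<Longrightarrow> (0::complex) \<noteq> 0"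
      from s(2)[of "complex_of_real s"] s(1) show False by auto
    qed (use neq \<open>n > 0\<close> in auto)
  qed
  obtain t where t: "1 < t" "t < R" using dense[OF R] by auto
  have "summable (\<lambda>n. c n * complex_of_real t ^ n)"
    using c[of "complex_of_real t"] t by (auto simp: sums_iff)
  then obtain C where C: "\<And>n. norm (c n * complex_of_real t ^ n) \<le> C"
    using summable_imp_Bseq BseqE by metis
  have "\<bar>g i\<bar> \<le> C * (1 / t) ^ i" for i
  proof -
    have "\<bar>g i\<bar> * t ^ i \<le> C"
      using C[of i] t eq[of i, symmetric] by (simp add: norm_mult norm_power)
    thus ?thesis using t by (simp add: field_simps)
  qed
  moreover have "complex_of_real (suminf g) = H 1"
  proof -
    have *: "(\<lambda>n. complex_of_real (g n)) sums H 1"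
      using c[of 1] R by (simp add: eq)
    hence "summable g"
      using sums_Re[OF *] by (auto simp: sums_iff)
    from sums_unique2[OF sums_of_real[OF summable_sums[OF this]] *] show ?thesis .
  qed
  ultimately show ?thesis using t by (intro that[of "1/t" C]) auto
qed

lemma poly_le_power:
  fixes R :: real
  assumes "R > 1"
  shows "\<exists>B. \<forall>n::nat. (1 + real n) ^ D \<le> B * R ^ n"
proof -
  \<comment> \<open>Taking this root reduces the claim to boundedness of n / t^n, raised to the
    power D + 1.\<close>
  define t where "t = root (Suc D) R"
  have t: "t > 1" "t ^ Suc D = R" using assms by (auto simp: t_def simp del: power_Suc)
  have "(\<lambda>n. real n / t ^ n) \<longlonglongrightarrow> 0"
    using lim_n_over_pown[of t] t by simp
  hence "Bseq (\<lambda>n. real n / t ^ n)"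
    using convergentI convergent_imp_Bseq by blast
  then obtain B where B: "\<And>n. norm (real n / t ^ n) \<le> B" using BseqE by metis
  have "(1 + real n) ^ D \<le> (1 + B) ^ Suc D * R ^ n" for n
  proof -
    have "real n \<le> B * t ^ n" using B[of n] t by (simp add: field_simps)
    moreover have "1 \<le> t ^ n" using t by simp
    ultimately have "1 + real n \<le> (1 + B) * t ^ n" by (simp add: algebra_simps)
    hence "(1 + real n) ^ Suc D \<le> ((1 + B) * t ^ n) ^ Suc D" by (intro power_mono) auto
    also have "\<dots> = (1 + B) ^ Suc D * R ^ n"
      unfolding power_mult_distrib t(2)[symmetric] by (simp only: power_mult[symmetric] mult.commute)
    finally have "(1 + real n) ^ Suc D \<le> (1 + B) ^ Suc D * R ^ n" .
    moreover have "(1 + real n) ^ D \<le> (1 + real n) ^ Suc D" by (intro power_increasing) auto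
    ultimately show ?thesis by linarith
  qed
  thus ?thesis by blast
qed

section \<open>The generating function of a killed walk\<close>

definition zext :: "(nat \<Rightarrow> real) \<Rightarrow> int \<Rightarrow> real" where
  "zext f x = (if 0 \<le> x then f (nat x) else 0)"

text \<open>The argument is an arbitrary integer: at \<open>x \<ge> 0\<close> this is the killed
  transition operator, at \<open>x < 0\<close> it is the part of the full convolution that the
  killing discards.\<close>

definition zconv :: "int pmf \<Rightarrow> (nat \<Rightarrow> real) \<Rightarrow> int \<Rightarrow> real" where
  "zconv q f x = measure_pmf.expectation q (\<lambda>m. zext f (x + m))"

definition poly_bounded :: "(nat \<Rightarrow> real) \<Rightarrow> bool" where
  "poly_bounded f \<longleftrightarrow> (\<exists>C D. \<forall>i. \<bar>f i\<bar> \<le> C * (1 + real i) ^ D)"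

lemma zext_of_nat [simp]: "zext f (int i) = f i"
  by (simp add: zext_def)

lemma zext_neg [simp]: "x < 0 \<Longrightarrow> zext f x = 0"
  by (simp add: zext_def)

lemma poly_boundedE:
  assumes "poly_bounded f"
  obtains C D where "C \<ge> 0" "\<And>i. \<bar>f i\<bar> \<le> C * (1 + real i) ^ D"
proof -
  from assms obtain C D where CD: "\<And>i. \<bar>f i\<bar> \<le> C * (1 + real i) ^ D"
    by (auto simp: poly_bounded_def)
  have "C \<ge> 0" using CD[of 0] by simp
  thus ?thesis using CD that by blast
qed

lemma poly_bounded_summable:
  fixes z :: complex
  assumes "poly_bounded f" "norm z < 1"
  shows "summable (\<lambda>i. norm (complex_of_real (f i) * z ^ i))"
proof -
  obtain C D where C: "C \<ge> 0" "\<And>i. \<bar>f i\<bar> \<le> C * (1 + real i) ^ D"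
    using poly_boundedE[OF assms(1)] by blast
  obtain t where t: "norm z < t" "t < 1" using dense[OF assms(2)] by blast
  have t0: "t > 0" using t norm_ge_zero[of z] by linarith
  show ?thesis
  proof (cases "z = 0")
    case True
    thus ?thesis by (auto simp: power_0_left if_distrib cong: if_cong)
  next
    case False
    hence "1 < t / norm z" using t by simp
    from poly_le_power[OF this, of D] obtain B where
      B: "\<And>n. (1 + real n) ^ D \<le> B * (t / norm z) ^ n" by blast
    have "norm (norm (complex_of_real (f i) * z ^ i)) \<le> C * B * t ^ i" for i
    proof -
      have "norm (complex_of_real (f i) * z ^ i) = \<bar>f i\<bar> * norm z ^ i"
        by (simp add: norm_mult norm_power)
      also have "\<dots> \<le> C * (B * (t / norm z) ^ i) * norm z ^ i"
        using C B[of i] by (intro mult_right_mono order.trans[OF C(2)] mult_left_mono) auto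
      also have "\<dots> = C * B * t ^ i" using False by (simp add: power_divide)
      finally show ?thesis by simp
    qed
    moreover have "summable (\<lambda>i. C * B * t ^ i)"
      using t t0 by (intro summable_mult summable_geometric) auto
    ultimately show ?thesis
      by (rule summable_comparison_test'[rotated])
  qed
qed

lemma power_int_annulus_le:
  fixes t R :: real
  assumes "1 / R \<le> t" "t \<le> R" "R > 1"
  shows "t powi m \<le> R ^ nat \<bar>m\<bar>"
proof -
  have t: "t > 0" using assms by (smt (verit) zero_less_divide_1_iff)
  show ?thesis
  proof (cases "m \<ge> 0")
    case True
    thus ?thesis using assms t by (auto simp: power_int_def intro!: power_mono)
  next
    case False
    have "inverse t \<le> R" using assms t by (simp add: field_simps)
    thus ?thesis using False t by (auto simp: power_int_def intro!: power_mono)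
  qed
qed

text \<open>With \<open>R\<close> in the role of e^\<lambda>, the moment condition dominates z^(-X)
  throughout the annulus 1/R < |z| < R.\<close>

locale exp_moment_pmf =
  fixes q :: "int pmf" and R :: real
  assumes R_gt_1: "R > 1"
    and exp_int: "integrable (measure_pmf q) (\<lambda>m. R ^ nat \<bar>m\<bar>)"
begin

lemma integrable_bounded_by_exp:
  fixes g :: "int \<Rightarrow> 'b::{banach, second_countable_topology}"
  assumes "\<And>m. norm (g m) \<le> B * R ^ nat \<bar>m\<bar>"
  shows "integrable (measure_pmf q) g"
  by (rule Bochner_Integration.integrable_bound[of _ "\<lambda>m. B * R ^ nat \<bar>m\<bar>"])
     (use assms exp_int in \<open>auto intro: order.trans[OF _ abs_ge_self]\<close>)

lemma integrable_zext:
  assumes "poly_bounded f"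
  shows "integrable (measure_pmf q) (\<lambda>m. zext f (x + m))"
proof -
  obtain C D where C: "C \<ge> 0" "\<And>i. \<bar>f i\<bar> \<le> C * (1 + real i) ^ D"
    using poly_boundedE[OF assms(1)] by blast
  from poly_le_power[OF R_gt_1, of D] obtain B where
    B: "\<And>n. (1 + real n) ^ D \<le> B * R ^ n" by blast
  show ?thesis
  proof (rule integrable_bounded_by_exp)
    fix m
    have "norm (zext f (x + m)) \<le> C * (1 + real (nat \<bar>x + m\<bar>)) ^ D"
      using C(1) C(2)[of "nat (x + m)"] by (cases "0 \<le> x + m") (auto simp: zext_def)
    also have "\<dots> \<le> C * ((1 + real (nat \<bar>x\<bar>)) * (1 + real (nat \<bar>m\<bar>))) ^ D"
    proof (intro mult_left_mono power_mono C)
      have "nat \<bar>x + m\<bar> \<le> nat \<bar>x\<bar> + nat \<bar>m\<bar>" by linarith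
      hence "real (nat \<bar>x + m\<bar>) \<le> real (nat \<bar>x\<bar>) + real (nat \<bar>m\<bar>)" by linarith
      moreover have "0 \<le> real (nat \<bar>x\<bar>) * real (nat \<bar>m\<bar>)" by simp
      ultimately show "1 + real (nat \<bar>x + m\<bar>) \<le> (1 + real (nat \<bar>x\<bar>)) * (1 + real (nat \<bar>m\<bar>))"
        unfolding distrib_left distrib_right by linarith
    qed auto
    also have "\<dots> = C * (1 + real (nat \<bar>x\<bar>)) ^ D * (1 + real (nat \<bar>m\<bar>)) ^ D"
      by (simp add: power_mult_distrib)
    also have "\<dots> \<le> C * (1 + real (nat \<bar>x\<bar>)) ^ D * (B * R ^ nat \<bar>m\<bar>)"
      using B[of "nat \<bar>m\<bar>"] C by (intro mult_left_mono) auto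
    finally show "norm (zext f (x + m)) \<le> (C * (1 + real (nat \<bar>x\<bar>)) ^ D * B) * R ^ nat \<bar>m\<bar>"
      by (simp add: mult_ac)
  qed
qed

lemma integrable_poly: "integrable (measure_pmf q) (\<lambda>m. real_of_int m ^ k)"
proof -
  from poly_le_power[OF R_gt_1, of k] obtain B where
    B: "\<And>n. (1 + real n) ^ k \<le> B * R ^ n" by blast
  show ?thesis
  proof (rule integrable_bounded_by_exp)
    fix m
    have "norm (real_of_int m ^ k) \<le> (1 + real (nat \<bar>m\<bar>)) ^ k"
      by (simp add: power_abs power_mono)
    thus "norm (real_of_int m ^ k) \<le> B * R ^ nat \<bar>m\<bar>" using B[of "nat \<bar>m\<bar>"] by linarith
  qed
qed

text \<open>The exponent is \<open>- m\<close> because the operator reads \<open>f\<close> at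
  \<open>x + m\<close>: the coefficient of z^x in the product with the series of \<open>f\<close> is
  then the expectation of \<open>f (x + m)\<close>.\<close>

definition \<Phi> :: "complex \<Rightarrow> complex" where
  "\<Phi> z = measure_pmf.expectation q (\<lambda>m. z powi (- m))"

definition annulus :: "real \<Rightarrow> complex set" where
  "annulus r = {z. 1 / r < norm z \<and> norm z < r}"

lemma open_annulus: "open (annulus r)"
proof -
  have "annulus r = {z. 1 / r < norm z} \<inter> {z. norm z < r}" by (auto simp: annulus_def)
  thus ?thesis by (auto intro!: open_Int open_Collect_less continuous_intros)
qed

lemma annulus_nonzero: "z \<in> annulus R \<Longrightarrow> z \<noteq> 0"
  using R_gt_1 by (auto simp: annulus_def)

lemma inverse_in_annulus:
  assumes "z \<in> annulus R"
  shows "1 / z \<in> annulus R"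
proof -
  have "0 < norm z" using annulus_nonzero[OF assms] by simp
  thus ?thesis using assms R_gt_1
    by (simp add: annulus_def norm_divide frac_less2 divide_less_eq less_divide_eq mult.commute)
qed

lemma integrable_powi:
  assumes "z \<in> annulus R"
  shows "integrable (measure_pmf q) (\<lambda>m. z powi (- m))"
proof (rule integrable_bounded_by_exp)
  show "norm (z powi (- m)) \<le> 1 * R ^ nat \<bar>m\<bar>" for m
    using power_int_annulus_le[of R "norm z" "- m"] assms R_gt_1
    unfolding norm_power_int annulus_def by auto
qed

lemma \<Phi>_has_sum:
  assumes "z \<in> annulus R"
  shows "((\<lambda>m. complex_of_real (pmf q m) * z powi (- m)) has_sum \<Phi> z) UNIV"
    and "(\<lambda>m. norm (complex_of_real (pmf q m) * z powi (- m))) summable_on UNIV"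
  using pmf_has_sum[OF integrable_powi[OF assms]] unfolding \<Phi>_def scaleR_conv_of_real by auto

text \<open>The Laurent series is split into a power series in 1/z and z times a power series in z,
  each convergent in the full disc of radius \<open>R\<close>.\<close>

lemma \<Phi>_holomorphic: "\<Phi> holomorphic_on annulus R"
proof -
  define A where "A w = (\<Sum>n. complex_of_real (pmf q (int n)) * w ^ n)" for w
  define B where "B w = (\<Sum>n. complex_of_real (pmf q (- 1 - int n)) * w ^ n)" for w
  have *: "(\<lambda>n. complex_of_real (pmf q (int n)) * (1 / z) ^ n) sums A (1 / z) \<and>
        (\<lambda>n. complex_of_real (pmf q (- 1 - int n)) * z ^ n) sums B z \<and> \<Phi> z = A (1 / z) + z * B z"
    if z: "z \<in> annulus R" for z
  proof -
    have z0: "z \<noteq> 0" using z annulus_nonzero by auto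
    obtain a b where ab:
      "(\<lambda>n. complex_of_real (pmf q (int n)) * z powi (- int n)) sums a"
      "(\<lambda>n. complex_of_real (pmf q (- 1 - int n)) * z powi (- (- 1 - int n))) sums b"
      "\<Phi> z = a + b"
      using has_sum_int_split[OF \<Phi>_has_sum(1)[OF z]] by blast
    have e1: "z powi (- int n) = (1 / z) ^ n" for n
      using z0 by (simp add: power_int_minus power_int_of_nat field_simps)
    have e2: "z powi (- (- 1 - int n)) = z * z ^ n" for n
    proof -
      have "- (- 1 - int n) = int (Suc n)" by simp
      thus ?thesis by (simp only: power_int_of_nat power_Suc)
    qed
    have s1: "(\<lambda>n. complex_of_real (pmf q (int n)) * (1 / z) ^ n) sums A (1 / z)" "a = A (1 / z)"
      using ab(1) unfolding e1 A_def by (auto simp: sums_iff)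
    have "(\<lambda>n. (complex_of_real (pmf q (- 1 - int n)) * (z * z ^ n)) * (1 / z)) sums (b * (1 / z))"
      using ab(2) unfolding e2 by (rule sums_mult2)
    hence "(\<lambda>n. complex_of_real (pmf q (- 1 - int n)) * z ^ n) sums (b / z)"
      using z0 by (simp add: mult_ac)
    hence "(\<lambda>n. complex_of_real (pmf q (- 1 - int n)) * z ^ n) sums B z" "b = z * B z"
      using z0 unfolding B_def by (auto simp: sums_iff)
    thus ?thesis using s1 ab(3) by auto
  qed
  have sA: "summable (\<lambda>n. complex_of_real (pmf q (int n)) * w ^ n)" if "1 / R < norm w" "norm w < R" for w
  proof -
    have "1 / w \<in> annulus R"
      using that inverse_in_annulus by (auto simp: annulus_def)
    from *[OF this] show ?thesis by (auto simp: sums_iff)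
  qed
  have sB: "summable (\<lambda>n. complex_of_real (pmf q (- 1 - int n)) * w ^ n)" if "1 / R < norm w" "norm w < R" for w
    using *[of w] that by (auto simp: annulus_def sums_iff)
  have R': "1 / R < R" "0 < R" using R_gt_1 less_1_mult[of R R] by (auto simp: divide_less_eq)
  have A: "A holomorphic_on ball 0 R" and B: "B holomorphic_on ball 0 R"
    unfolding A_def[abs_def] B_def[abs_def]
    using annulus_powser_holomorphic[OF sA R'] annulus_powser_holomorphic[OF sB R'] by blast+
  have inv: "(\<lambda>z. 1 / z) ` annulus R \<subseteq> ball 0 R"
    using inverse_in_annulus by (auto simp: annulus_def)
  have "(A \<circ> (\<lambda>z. 1 / z)) holomorphic_on annulus R"
    by (rule holomorphic_on_compose_gen[OF _ A inv])
       (use annulus_nonzero in \<open>auto intro!: holomorphic_intros\<close>)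
  moreover have "B holomorphic_on annulus R"
    by (rule holomorphic_on_subset[OF B]) (auto simp: annulus_def)
  ultimately have "(\<lambda>z. (A \<circ> (\<lambda>z. 1 / z)) z + z * B z) holomorphic_on annulus R"
    by (intro holomorphic_intros)
  thus ?thesis
    by (rule holomorphic_transform) (use * in auto)
qed

definition gf :: "(nat \<Rightarrow> real) \<Rightarrow> complex \<Rightarrow> complex" where
  "gf f z = (\<Sum>i. complex_of_real (f i) * z ^ i)"

text \<open>The part of the convolution that falls outside the half-line, in powers of \<open>w = 1 / z\<close>.\<close>

definition out_gf :: "(nat \<Rightarrow> real) \<Rightarrow> complex \<Rightarrow> complex" where
  "out_gf f w = w * (\<Sum>n. complex_of_real (zconv q f (- 1 - int n)) * w ^ n)"

lemma gf_sums:
  assumes "poly_bounded f" "norm z < 1"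
  shows "(\<lambda>i. complex_of_real (f i) * z ^ i) sums gf f z"
  unfolding gf_def by (rule summable_sums[OF summable_norm_cancel[OF poly_bounded_summable[OF assms]]])

lemma gf_holomorphic:
  assumes "poly_bounded f"
  shows "gf f holomorphic_on ball 0 1"
  by (rule power_series_holomorphic[of _ _ "\<lambda>i. complex_of_real (f i)"]) (use gf_sums[OF assms] in auto)

text \<open>The product is an absolutely convergent double sum over the step m and the position y.
  Regrouping by x = y - m produces \<open>zconv q f x\<close>; the negative x are collected in
  \<open>out_gf\<close>.\<close>

lemma zconv_gf:
  assumes f: "poly_bounded f" and z: "z \<in> annulus R" "norm z < 1"
  shows "(\<lambda>i. complex_of_real (zconv q f (int i)) * z ^ i) sums (\<Phi> z * gf f z - out_gf f (1 / z))"
    and "summable (\<lambda>n. complex_of_real (zconv q f (- 1 - int n)) * (1 / z) ^ n)"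
proof -
  have z0: "z \<noteq> 0" using z annulus_nonzero by auto
  define b where "b y = complex_of_real (zext f y) * z powi y" for y
  have b: "(b has_sum gf f z) UNIV" "(\<lambda>y. norm (b y)) summable_on UNIV"
    using has_sum_int_of_nat[of b] poly_bounded_summable[OF f z(2)]
    by (auto simp: b_def gf_def power_int_of_nat)
  have prod: "((\<lambda>(m, y). complex_of_real (pmf q m) * z powi (- m) * b y) has_sum (\<Phi> z * gf f z)) (UNIV \<times> UNIV)"
    by (rule has_sum_times[OF \<Phi>_has_sum(1)[OF z(1)] b(1) \<Phi>_has_sum(2)[OF z(1)] b(2)])
  also have "?this \<longleftrightarrow> ((\<lambda>(x, m). complex_of_real (pmf q m * zext f (x + m)) * z powi x) has_sum (\<Phi> z * gf f z)) (UNIV \<times> UNIV)"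
    by (rule has_sum_reindex_bij_witness[of _ "\<lambda>(x, m). (m, x + m)" "\<lambda>(m, y). (y - m, m)"])
       (use z0 in \<open>auto simp: b_def power_int_add power_int_diff power_int_minus divide_simps\<close>)
  finally have sum2: "((\<lambda>(x, m). complex_of_real (pmf q m * zext f (x + m)) * z powi x) has_sum (\<Phi> z * gf f z)) (UNIV \<times> UNIV)" .
  have inner: "((\<lambda>m. complex_of_real (pmf q m * zext f (x + m)) * z powi x) has_sum complex_of_real (zconv q f x) * z powi x) UNIV" for x
  proof -
    have "((\<lambda>m. pmf q m * zext f (x + m)) has_sum zconv q f x) UNIV"
      using pmf_has_sum(1)[OF integrable_zext[OF f, of x]] by (simp add: zconv_def)
    hence "((\<lambda>m. complex_of_real (pmf q m * zext f (x + m))) has_sum complex_of_real (zconv q f x)) UNIV"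
      by (rule has_sum_of_real)
    thus ?thesis by (rule has_sum_cmult_left)
  qed
  have "((\<lambda>x. complex_of_real (zconv q f x) * z powi x) has_sum (\<Phi> z * gf f z)) UNIV"
    by (rule has_sum_SigmaD[OF sum2]) (use inner in simp)
  then obtain s t where st:
    "(\<lambda>n. complex_of_real (zconv q f (int n)) * z powi int n) sums s"
    "(\<lambda>n. complex_of_real (zconv q f (- 1 - int n)) * z powi (- 1 - int n)) sums t"
    "\<Phi> z * gf f z = s + t"
    by (rule has_sum_int_split)
  have e: "z powi (- 1 - int n) = 1 / z * (1 / z) ^ n" for n
    using z0 by (simp add: power_int_diff power_int_minus power_int_of_nat field_simps)
  have "(\<lambda>n. (complex_of_real (zconv q f (- 1 - int n)) * (1 / z * (1 / z) ^ n)) * z) sums (t * z)"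
    using st(2) unfolding e by (rule sums_mult2)
  hence t: "(\<lambda>n. complex_of_real (zconv q f (- 1 - int n)) * (1 / z) ^ n) sums (t * z)"
    using z0 by (simp add: mult_ac)
  thus "summable (\<lambda>n. complex_of_real (zconv q f (- 1 - int n)) * (1 / z) ^ n)"
    by (simp add: sums_iff)
  have "t = out_gf f (1 / z)"
    using t z0 by (simp add: out_gf_def sums_iff)
  thus "(\<lambda>i. complex_of_real (zconv q f (int i)) * z ^ i) sums (\<Phi> z * gf f z - out_gf f (1 / z))"
    using st by (simp add: power_int_of_nat)
qed

lemma out_gf_summable:
  assumes f: "poly_bounded f" and "1 < norm w" "norm w < R"
  shows "summable (\<lambda>n. complex_of_real (zconv q f (- 1 - int n)) * w ^ n)"
proof -
  have "w \<in> annulus R" using assms R_gt_1 by (auto simp: annulus_def intro: less_trans[of _ 1])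
  thus ?thesis
    using zconv_gf(2)[OF f inverse_in_annulus, of w] assms by (simp add: norm_divide divide_less_eq)
qed

text \<open>This is what crosses the unit circle. Inside it, the variable w = 1/z runs through 1 <
  |w| < R; since \<open>out_gf f\<close> is a power series in w, it converges for every |w| < R,
  including |w| \<le> 1.\<close>

lemma out_gf_holomorphic:
  assumes f: "poly_bounded f"
  shows "out_gf f holomorphic_on ball 0 R"
  unfolding out_gf_def[abs_def]
  by (intro holomorphic_intros annulus_powser_holomorphic[OF out_gf_summable[OF f]])
     (use R_gt_1 in auto)

end

section \<open>Zeros of the characteristic function\<close>

locale centered_pmf = exp_moment_pmf +
  assumes mean_zero: "measure_pmf.expectation q real_of_int = 0"
    and aperiodic: "\<And>h::int. h \<ge> 2 \<Longrightarrow> \<exists>m\<in>set_pmf q. \<not> h dvd m"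
begin

lemma integrable_of_int: "integrable (measure_pmf q) real_of_int"
  using integrable_poly[of 1] by simp

lemma exists_neg_pos:
  shows "\<exists>m\<in>set_pmf q. m < 0" "\<exists>m\<in>set_pmf q. m > 0"
proof -
  \<comment> \<open>A step not divisible by 2 is in particular nonzero; mean zero then forces steps
    of both signs.\<close>
  obtain m where m: "m \<in> set_pmf q" "m \<noteq> 0"
    using aperiodic[of 2] by fastforce
  have False if "\<And>m. m \<in> set_pmf q \<Longrightarrow> m \<ge> 0"
  proof -
    have "AE m in q. real_of_int m = 0"
      using mean_zero integrable_of_int that
      by (subst integral_nonneg_eq_0_iff_AE[symmetric]) (auto simp: AE_measure_pmf_iff)
    thus False using m by (auto simp: AE_measure_pmf_iff)
  qed
  thus "\<exists>m\<in>set_pmf q. m < 0" by force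
  have False if "\<And>m. m \<in> set_pmf q \<Longrightarrow> m \<le> 0"
  proof -
    have "AE m in q. - real_of_int m = 0"
      using mean_zero integrable_of_int that
      by (subst integral_nonneg_eq_0_iff_AE[symmetric]) (auto simp: AE_measure_pmf_iff)
    thus False using m by (auto simp: AE_measure_pmf_iff)
  qed
  thus "\<exists>m\<in>set_pmf q. m > 0" by force
qed

lemma \<Phi>_1 [simp]: "\<Phi> 1 = 1"
  by (simp add: \<Phi>_def)

lemma one_in_annulus [simp]: "r > 1 \<Longrightarrow> 1 \<in> annulus r"
  by (simp add: annulus_def)

text \<open>The equality case of Re \<le> 1: mean 1 forces z^m = 1 for every step m of the support,
  so the order of z divides all steps, against aperiodicity.\<close>

lemma \<Phi>_unit_circle:
  assumes z: "norm z = 1" "z \<noteq> 1"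
  shows "\<Phi> z \<noteq> 1"
proof
  assume eq: "\<Phi> z = 1"
  have zA: "z \<in> annulus R" using z R_gt_1 by (simp add: annulus_def)
  have z0: "z \<noteq> 0" using z by auto
  have int: "integrable q (\<lambda>m. Re (z powi (- m)))"
    using integrable_powi[OF zA] by (rule integrable_Re)
  have n1: "norm (z powi m) = 1" for m by (simp add: norm_power_int z)
  have "measure_pmf.expectation q (\<lambda>m. Re (z powi (- m))) = 1"
    using integral_Re[OF integrable_powi[OF zA]] eq by (simp add: \<Phi>_def)
  hence "measure_pmf.expectation q (\<lambda>m. 1 - Re (z powi (- m))) = 0"
    using int by simp
  moreover have "1 - Re (z powi (- m)) \<ge> 0" for m
    using complex_Re_le_cmod[of "z powi (-m)"] n1 by simp
  ultimately have "AE m in q. 1 - Re (z powi (- m)) = 0"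
    using int by (subst integral_nonneg_eq_0_iff_AE[symmetric]) auto
  hence re1: "Re (z powi (- m)) = 1" if "m \<in> set_pmf q" for m
    using that by (auto simp: AE_measure_pmf_iff)
  have per: "z powi m = 1" if "m \<in> set_pmf q" for m
  proof -
    have "Re (z powi (- m)) = 1" by (rule re1[OF that])
    moreover have "(Re (z powi (- m)))\<^sup>2 + (Im (z powi (- m)))\<^sup>2 = 1"
      using n1[of "-m"] by (simp only: cmod_power2[symmetric]) simp
    ultimately have "z powi (- m) = 1" by (simp add: complex_eq_iff)
    thus ?thesis by (simp add: power_int_minus)
  qed
  \<comment> \<open>The order of \<open>z\<close>, which exceeds 1 because
    \<open>z \<noteq> 1\<close>. For infinite order only the exponent 0 gives 1, and the default 2
    divides it.\<close>
  define h :: nat where "h = (if \<exists>n>0. z ^ n = 1 then LEAST n. n > 0 \<and> z ^ n = 1 else 2)"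
  have "int h \<ge> 2 \<and> (\<forall>m. z powi m = 1 \<longrightarrow> int h dvd m)"
  proof (cases "\<exists>n>0. z ^ n = 1")
    case True
    have h: "h > 0" "z ^ h = 1"
      using LeastI_ex[of "\<lambda>n. n > 0 \<and> z ^ n = 1"] True by (auto simp: h_def)
    have min: "h \<le> n" if "n > 0" "z ^ n = 1" for n
      using True that by (auto simp: h_def intro: Least_le)
    have "h \<noteq> 1" using h z by auto
    moreover have "int h dvd m" if "z powi m = 1" for m
    proof (rule ccontr)
      assume "\<not> int h dvd m"
      hence pos: "m mod int h > 0" using h by (simp add: dvd_eq_mod_eq_0 order_le_neq_trans)
      have "z powi m = z powi (int h * (m div int h)) * z powi (m mod int h)"
        using z0 by (subst power_int_add[symmetric]) auto
      also have "z powi (int h * (m div int h)) = 1"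
        using h by (simp add: power_int_mult power_int_of_nat)
      finally have "z powi (m mod int h) = 1" using that by simp
      hence "z ^ nat (m mod int h) = 1" using pos by (simp add: power_int_def)
      hence "h \<le> nat (m mod int h)" using pos by (intro min) auto
      hence "int h \<le> m mod int h" using pos by (simp add: le_nat_iff)
      moreover have "m mod int h < int h" using h by simp
      ultimately show False by linarith
    qed
    ultimately show ?thesis using h by auto
  next
    case False
    have "m = 0" if "z powi m = 1" for m
    proof (rule ccontr)
      assume "m \<noteq> 0"
      have "z ^ nat \<bar>m\<bar> = 1"
        using that by (auto simp: power_int_def power_inverse split: if_splits)
      moreover have "nat \<bar>m\<bar> > 0" using \<open>m \<noteq> 0\<close> by simp
      ultimately show False using False by blast
    qed
    moreover have "h = 2" unfolding h_def using False by (rule if_not_P)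
    ultimately show ?thesis by auto
  qed
  thus False using aperiodic[of "int h"] per by blast
qed

section \<open>The Laplace transform on the real axis and the double zero at 1\<close>

definition \<psi> :: "real \<Rightarrow> real" where
  "\<psi> t = measure_pmf.expectation q (\<lambda>m. exp (- t * real_of_int m))"

lemma
  assumes "\<bar>t\<bar> < ln R"
  shows \<Phi>_exp: "\<Phi> (complex_of_real (exp t)) = complex_of_real (\<psi> t)"
    and \<psi>_integrable: "integrable q (\<lambda>m. exp (- t * real_of_int m))"
proof -
  have "exp t < exp (ln R)" "exp (- t) < exp (ln R)" using assms unfolding exp_less_cancel_iff by auto
  hence A: "complex_of_real (exp t) \<in> annulus R"
    using R_gt_1 by (simp add: annulus_def exp_minus field_simps)
  have e: "complex_of_real (exp t) powi (- m) = complex_of_real (exp (- t * real_of_int m))" for m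
    by (simp add: powr_real_of_int'[symmetric] powr_def flip: of_real_power_int)
  show int: "integrable q (\<lambda>m. exp (- t * real_of_int m))"
    using integrable_Re[OF integrable_powi[OF A]] unfolding e by simp
  show "\<Phi> (complex_of_real (exp t)) = complex_of_real (\<psi> t)"
    unfolding \<Phi>_def \<psi>_def e by simp
qed

lemma \<psi>_ge_1:
  assumes "\<bar>t\<bar> < ln R"
  shows "\<psi> t \<ge> 1"
proof -
  have "measure_pmf.expectation q (\<lambda>m. 1 - t * real_of_int m) \<le> \<psi> t"
    unfolding \<psi>_def using exp_ge_add_one_self[of "- t * real_of_int _"] 
    by (intro integral_mono \<psi>_integrable assms) (auto simp: integrable_of_int)
  thus ?thesis using mean_zero integrable_of_int by simp
qed

text \<open>After subtraction of the linear part, which has mean zero, every atom contributes a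
  nonnegative amount, so one atom suffices. It is chosen negative so that the exponent
  \<open>- t * m0\<close> is nonnegative, where the quadratic Taylor polynomial bounds exp from
  below.\<close>

lemma \<psi>_quadratic:
  "\<exists>c>0. \<forall>t. 0 \<le> t \<longrightarrow> t < ln R \<longrightarrow> \<psi> t - 1 \<ge> c * t\<^sup>2"
proof -
  obtain m0 where m0: "m0 \<in> set_pmf q" "m0 < 0" using exists_neg_pos by auto
  define c where "c = pmf q m0 * (real_of_int m0)\<^sup>2 / 2"
  have "c > 0" using m0 by (simp add: c_def pmf_positive)
  moreover have "\<psi> t - 1 \<ge> c * t\<^sup>2" if t: "0 \<le> t" "t < ln R" for t
  proof -
    define g where "g m = exp (- t * real_of_int m) - 1 + t * real_of_int m" for m
    have int: "integrable q (\<lambda>m. exp (- t * real_of_int m))"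
      using t by (intro \<psi>_integrable) auto
    have gnn: "g m \<ge> 0" for m
      using exp_ge_add_one_self[of "- t * real_of_int m"] by (simp add: g_def)
    have "c * t\<^sup>2 \<le> pmf q m0 * g m0"
    proof -
      have "1 + (- t * real_of_int m0) + (- t * real_of_int m0)\<^sup>2 / 2 \<le> exp (- t * real_of_int m0)"
        using t m0 by (intro exp_lower_Taylor_quadratic) (simp add: mult_nonneg_nonpos)
      hence "(t * real_of_int m0)\<^sup>2 / 2 \<le> g m0" by (simp add: g_def power2_eq_square)
      hence "pmf q m0 * ((t * real_of_int m0)\<^sup>2 / 2) \<le> pmf q m0 * g m0"
        by (intro mult_left_mono) auto
      thus ?thesis by (simp add: c_def power_mult_distrib mult_ac)
    qed
    also have "pmf q m0 * g m0 = measure_pmf.expectation q (\<lambda>m. g m0 * indicator {m0} m)"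
      by (simp add: measure_pmf_single)
    also have "\<dots> \<le> measure_pmf.expectation q g"
    proof (rule integral_mono)
      show "integrable q g"
        unfolding g_def[abs_def] using int integrable_of_int by auto
      show "g m0 * indicator {m0} m \<le> g m" for m
        using gnn[of m] by (auto simp: indicator_def)
      show "integrable q (\<lambda>m. g m0 * indicator {m0} m)"
        by (rule measure_pmf.integrable_const_bound[where B = "\<bar>g m0\<bar>"])
           (auto simp: indicator_def intro!: AE_I2)
    qed
    also have "\<dots> = \<psi> t - 1"
      unfolding g_def[abs_def] \<psi>_def using int integrable_of_int mean_zero by simp
    finally show ?thesis .
  qed
  ultimately show ?thesis by blast
qed

text \<open>Two difference quotients at 1 are taken, without differentiating under the expectation.
  Along z = e^t the first quotient is nonnegative for t > 0 and nonpositive for t < 0, because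
  \<open>\<psi> \<ge> 1\<close>, so it vanishes at 1. The quadratic lower bound for
  \<open>\<psi>\<close> keeps the real part of the second quotient away from 0.\<close>

lemma \<Phi>_factor:
  obtains K where "K holomorphic_on annulus R" "K 1 \<noteq> 0"
    "\<And>z. z \<in> annulus R \<Longrightarrow> \<Phi> z - 1 = (1 - z)\<^sup>2 * K z"
proof -
  define f where "f z = \<Phi> z - 1" for z
  define g where "g z = (if z = 1 then deriv f 1 else (f z - f 1) / (z - 1))" for z
  define K where "K z = (if z = 1 then deriv g 1 else (g z - g 1) / (z - 1))" for z
  have f: "f holomorphic_on annulus R" unfolding f_def[abs_def]
    by (intro holomorphic_intros \<Phi>_holomorphic)
  have f1: "f 1 = 0" by (simp add: f_def)
  have g: "g holomorphic_on annulus R"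
    unfolding g_def[abs_def] by (rule pole_lemma_open[OF f open_annulus])
  have K: "K holomorphic_on annulus R"
    unfolding K_def[abs_def] by (rule pole_lemma_open[OF g open_annulus])
  have lnR: "ln R > 0" using R_gt_1 by simp
  have cont: "((\<lambda>t. h (complex_of_real (exp t))) \<longlongrightarrow> h 1) (at 0 within A)"
    if h: "h holomorphic_on annulus R" for h A
  proof -
    have "isCont h 1"
      using holomorphic_on_imp_continuous_on[OF h] open_annulus R_gt_1
      by (simp add: continuous_on_eq_continuous_at)
    moreover have "((\<lambda>t. complex_of_real (exp t)) \<longlongrightarrow> complex_of_real (exp 0)) (at 0 within A)"
      by (intro tendsto_intros)
    ultimately show ?thesis
      using isCont_tendsto_compose[of 1 h] by simp
  qed
  have ev: "eventually (\<lambda>t. \<bar>t\<bar> < ln R \<and> t > 0) (at_right 0)"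
           "eventually (\<lambda>t. \<bar>t\<bar> < ln R \<and> t < 0) (at_left 0)"
    unfolding eventually_at_right_field eventually_at_left_field using lnR
    by (intro exI[of _ "ln R"] exI[of _ "- ln R"]; auto)+
  have gexp: "g (complex_of_real (exp t)) = complex_of_real ((\<psi> t - 1) / (exp t - 1))"
    if "\<bar>t\<bar> < ln R" "t \<noteq> 0" for t
  proof -
    have "complex_of_real (exp t) \<noteq> 1" using that
      by (metis exp_eq_one_iff of_real_eq_1_iff)
    thus ?thesis using that by (simp add: g_def f_def \<Phi>_exp)
  qed
  have g1: "g 1 = 0"
  proof -
    have lr: "((\<lambda>t. g (complex_of_real (exp t))) \<longlongrightarrow> g 1) (at_right 0)"
      and ll: "((\<lambda>t. g (complex_of_real (exp t))) \<longlongrightarrow> g 1) (at_left 0)"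
      by (rule cont[OF g])+
    have "0 \<le> Re (g 1)"
    proof (rule tendsto_lowerbound[OF tendsto_Re[OF lr]])
      show "\<forall>\<^sub>F t in at_right 0. 0 \<le> Re (g (complex_of_real (exp t)))"
        using ev(1) by eventually_elim (use \<psi>_ge_1 in \<open>auto simp: gexp\<close>)
    qed auto
    moreover have "Re (g 1) \<le> 0"
    proof (rule tendsto_upperbound[OF tendsto_Re[OF ll]])
      show "\<forall>\<^sub>F t in at_left 0. Re (g (complex_of_real (exp t))) \<le> 0"
        using ev(2) by eventually_elim (use \<psi>_ge_1 in \<open>auto simp: gexp divide_nonneg_neg\<close>)
    qed auto
    moreover have "Im (g 1) = 0"
    proof -
      have "\<forall>\<^sub>F t in at_right 0. Im (g (complex_of_real (exp t))) = 0"
        using ev(1) by eventually_elim (auto simp: gexp)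
      hence "((\<lambda>t. Im (g (complex_of_real (exp t)))) \<longlongrightarrow> 0) (at_right 0)"
        by (rule tendsto_eventually)
      thus ?thesis using tendsto_Im[OF lr] tendsto_unique by (metis trivial_limit_at_right_real)
    qed
    ultimately show ?thesis by (simp add: complex_eq_iff)
  qed
  obtain c where c: "c > 0" "\<And>t. 0 \<le> t \<Longrightarrow> t < ln R \<Longrightarrow> \<psi> t - 1 \<ge> c * t\<^sup>2"
    using \<psi>_quadratic by blast
  have "Re (K 1) \<ge> c"
  proof (rule tendsto_le[OF _ tendsto_Re[OF cont[OF K, of "{0<..}"]]])
    show "((\<lambda>t. c * (t\<^sup>2 / (exp t - 1)\<^sup>2)) \<longlongrightarrow> c) (at_right 0)"
    proof -
      have "((\<lambda>t::real. t\<^sup>2 / (exp t - 1)\<^sup>2) \<longlongrightarrow> 1) (at_right 0)" by real_asymp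
      from tendsto_mult_left[OF this, of c] show ?thesis by simp
    qed
    show "\<forall>\<^sub>F t in at_right 0. c * (t\<^sup>2 / (exp t - 1)\<^sup>2) \<le> Re (K (complex_of_real (exp t)))"
      using ev(1)
    proof eventually_elim
      case (elim t)
      have "complex_of_real (exp t) \<noteq> 1" using elim
        by (metis exp_eq_one_iff of_real_eq_1_iff less_irrefl)
      hence "K (complex_of_real (exp t)) = complex_of_real ((\<psi> t - 1) / (exp t - 1)\<^sup>2)"
        using gexp[of t, OF conjunct1[OF elim]] elim by (simp add: K_def g1 power2_eq_square)
      moreover have "c * t\<^sup>2 \<le> \<psi> t - 1" using elim by (intro c(2)) linarith+
      ultimately show ?case by (simp add: divide_right_mono)
    qed
  qed auto
  hence "K 1 \<noteq> 0" using c(1) by auto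
  moreover have "\<Phi> z - 1 = (1 - z)\<^sup>2 * K z" if "z \<in> annulus R" for z
  proof (cases "z = 1")
    case False
    hence "K z = f z / ((z - 1) * (z - 1))"
      using f1 g1 by (simp add: K_def g_def)
    moreover have "(1 - z)\<^sup>2 = (z - 1) * (z - 1)"
      by (simp add: power2_eq_square algebra_simps)
    ultimately show ?thesis
      using False by (simp add: f_def)
  qed simp
  ultimately show ?thesis using K that by blast
qed

text \<open>Zeros of \<open>K\<close> in a closed annulus form a compact set that misses the unit
  circle, so they keep a positive distance from it.\<close>

lemma \<Phi>_factor_nonzero:
  obtains S K where "1 < S" "S \<le> R" "K holomorphic_on annulus S"
    "\<And>z. z \<in> annulus S \<Longrightarrow> K z \<noteq> 0"
    "\<And>z. z \<in> annulus S \<Longrightarrow> \<Phi> z - 1 = (1 - z)\<^sup>2 * K z"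
proof -
  obtain K where K: "K holomorphic_on annulus R" "K 1 \<noteq> 0"
    "\<And>z. z \<in> annulus R \<Longrightarrow> \<Phi> z - 1 = (1 - z)\<^sup>2 * K z"
    using \<Phi>_factor by blast
  define T where "T = (1 + R) / 2"
  have T: "1 < T" "T < R" using R_gt_1 by (auto simp: T_def)
  define A where "A = {z::complex. 1 / T \<le> norm z \<and> norm z \<le> T}"
  define Z where "Z = {z\<in>A. K z = 0}"
  have AR: "A \<subseteq> annulus R"
  proof
    fix z assume z: "z \<in> A"
    have "1 / R < 1 / T" using T by (intro divide_strict_left_mono) auto
    thus "z \<in> annulus R" using z T by (auto simp: A_def annulus_def)
  qed
  have "A = cball 0 T \<inter> {z. 1 / T \<le> norm z}" by (auto simp: A_def)
  hence "compact A" by (auto intro!: compact_Int_closed closed_Collect_le continuous_intros)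
  moreover have "closedin (top_of_set A) Z"
    unfolding Z_def by (rule continuous_closedin_preimage_constant)
      (use holomorphic_on_imp_continuous_on[OF K(1)] AR continuous_on_subset in blast)
  ultimately have Z: "compact Z" using closedin_compact by blast
  \<comment> \<open>A gauge for annuli: \<open>z \<in> annulus S\<close> means
    \<open>m z < S\<close>, and the unit circle is where \<open>m\<close> equals 1.\<close>
  define m where "m z = max (norm z) (1 / norm z)" for z :: complex
  have mZ: "m z > 1" if "z \<in> Z" for z
  proof -
    have z: "z \<in> annulus R" "K z = 0" using that AR by (auto simp: Z_def)
    have "norm z > 0" using annulus_nonzero[OF z(1)] by simp
    moreover have "norm z \<noteq> 1"
    proof
      assume "norm z = 1"
      moreover have "z \<noteq> 1" using z K(2) by auto
      ultimately have "\<Phi> z \<noteq> 1" by (rule \<Phi>_unit_circle)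
      thus False using K(3)[OF z(1)] z(2) by simp
    qed
    ultimately show ?thesis by (cases "norm z < 1") (simp_all add: m_def less_max_iff_disj less_divide_eq)
  qed
  obtain S0 where S0: "1 < S0" "\<And>z. z \<in> Z \<Longrightarrow> S0 \<le> m z"
  proof (cases "Z = {}")
    case True
    thus ?thesis by (intro that[of 2]) auto
  next
    case False
    have "continuous_on Z m"
      unfolding m_def[abs_def] using annulus_nonzero AR
      by (auto intro!: continuous_intros simp: Z_def)
    then obtain z0 where "z0 \<in> Z" "\<And>z. z \<in> Z \<Longrightarrow> m z0 \<le> m z"
      using continuous_attains_inf[OF Z False] by blast
    thus ?thesis using mZ by (intro that[of "m z0"]) auto
  qed
  define S where "S = min S0 T"
  have S: "1 < S" "S \<le> R" "S \<le> T" using S0 T by (auto simp: S_def)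
  have sub: "annulus S \<subseteq> annulus R"
  proof
    fix z assume "z \<in> annulus S"
    moreover have "1 / R \<le> 1 / S" using S by (intro divide_left_mono) auto
    ultimately show "z \<in> annulus R" using S by (auto simp: annulus_def)
  qed
  have "K z \<noteq> 0" if z: "z \<in> annulus S" for z
  proof
    assume "K z = 0"
    moreover have "1 / T \<le> 1 / S" using S by (intro divide_left_mono) auto
    ultimately have "z \<in> Z" using z S by (auto simp: Z_def A_def annulus_def)
    hence "S0 \<le> m z" using S0 by blast
    moreover have "m z < S"
    proof -
      have "norm z > 0" using z sub annulus_nonzero by auto
      thus ?thesis using z S by (auto simp: m_def annulus_def field_simps)
    qed
    ultimately show False by (simp add: S_def)
  qed
  thus ?thesis using S K sub holomorphic_on_subset by (intro that[of S K]) auto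
qed

end

section \<open>Polynomial asymptotics of recursive families\<close>

lemma nabla_simps [simp]:
  "nabla f 0 = f 0" "nabla f (Suc j) = f (Suc j) - f j"
  by (simp_all add: nabla_def)

lemma nabla_funpow_of_real:
  "(nabla ^^ D) (\<lambda>i. of_real (f i)) i = (of_real ((nabla ^^ D) f i) :: 'a::real_algebra_1)"
proof (induction D arbitrary: i)
  case (Suc D)
  have "(nabla ^^ D) (\<lambda>i. of_real (f i)) = (\<lambda>i. of_real ((nabla ^^ D) f i) :: 'a)"
    using Suc by auto
  thus ?case by (cases i) simp_all
qed auto

lemma nabla_funpow_power_series:
  fixes f :: "nat \<Rightarrow> 'a :: {comm_ring_1, real_normed_algebra_1, topological_ab_group_add}"
  assumes "(\<lambda>i. f i * z ^ i) sums s"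
  shows "(\<lambda>i. (nabla ^^ D) f i * z ^ i) sums ((1 - z) ^ D * s)"
proof (induction D)
  case (Suc D)
  from nabla_power_series[OF this] show ?case by (simp add: mult.assoc)
qed (use assms in simp)

lemma zconv_zero [simp]: "zconv q (\<lambda>_. 0) x = 0"
  by (simp add: zconv_def zext_def)

context centered_pmf
begin

text \<open>Two further factors 1 - z cancel the double zero of \<open>\<Phi> - 1\<close>. The
  equation solved for the series of \<open>f\<close> then has a right-hand side \<open>J\<close>
  analytic on the annulus, and \<open>F\<close> glues it to the disc. At 1 the boundary terms carry
  the factor \<open>0 ^ D\<close>, so they survive only for \<open>D = 0\<close>.\<close>

lemma gf_extension_step:
  assumes f: "poly_bounded f" and g: "poly_bounded g"
    and rec: "\<And>i. f i = zconv q f (int i) - zconv q g (int i)"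
    and S: "1 < S" "S \<le> R" and K: "K holomorphic_on annulus S"
    and K0: "\<And>z. z \<in> annulus S \<Longrightarrow> K z \<noteq> 0"
    and KF: "\<And>z. z \<in> annulus S \<Longrightarrow> \<Phi> z - 1 = (1 - z)\<^sup>2 * K z"
    and G: "G holomorphic_on ball 0 S" "\<And>z. norm z < 1 \<Longrightarrow> G z = (1 - z) ^ D * gf g z"
  obtains F where "F holomorphic_on ball 0 S" "\<And>z. norm z < 1 \<Longrightarrow> F z = (1 - z) ^ (D + 2) * gf f z"
    "F 1 * K 1 = G 1 + 0 ^ D * (out_gf f 1 - out_gf g 1)"
proof -
  define J where "J z = (\<Phi> z * G z + (1 - z) ^ D * (out_gf f (1 / z) - out_gf g (1 / z))) / K z" for z
  define F where "F z = (if z \<in> ball 0 1 then (1 - z) ^ (D + 2) * gf f z else J z)" for z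
  have sub: "annulus S \<subseteq> annulus R"
  proof
    fix z assume "z \<in> annulus S"
    moreover have "1 / R \<le> 1 / S" using S by (intro divide_left_mono) auto
    ultimately show "z \<in> annulus R" using S by (auto simp: annulus_def)
  qed
  have out: "(\<lambda>z. out_gf h (1 / z)) holomorphic_on annulus S" if "poly_bounded h" for h
  proof -
    have "(out_gf h \<circ> (\<lambda>z. 1 / z)) holomorphic_on annulus S"
      by (rule holomorphic_on_compose_gen[OF _ out_gf_holomorphic[OF that]])
         (use annulus_nonzero sub inverse_in_annulus in \<open>auto intro!: holomorphic_intros simp: annulus_def subset_iff\<close>)
    thus ?thesis by (simp add: o_def)
  qed
  have J: "J holomorphic_on annulus S"
    unfolding J_def[abs_def] using K0 G(1) \<Phi>_holomorphic sub
    by (intro holomorphic_intros K out f g) 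
       (auto simp: annulus_def intro: holomorphic_on_subset)
  have eq: "(1 - z) ^ (D + 2) * gf f z = J z" if z: "z \<in> annulus S" "norm z < 1" for z
  proof -
    have zR: "z \<in> annulus R" using sub z by auto
    have "(\<lambda>i. complex_of_real (zconv q f (int i)) * z ^ i - complex_of_real (zconv q g (int i)) * z ^ i) sums
            ((\<Phi> z * gf f z - out_gf f (1 / z)) - (\<Phi> z * gf g z - out_gf g (1 / z)))"
      by (intro sums_diff zconv_gf f g zR z)
    also have "(\<lambda>i. complex_of_real (zconv q f (int i)) * z ^ i - complex_of_real (zconv q g (int i)) * z ^ i) =
               (\<lambda>i. complex_of_real (f i) * z ^ i)"
      by (rule ext) (metis rec left_diff_distrib of_real_diff)
    finally have "gf f z = (\<Phi> z * gf f z - out_gf f (1 / z)) - (\<Phi> z * gf g z - out_gf g (1 / z))"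
      using gf_sums[OF f z(2)] sums_unique2 by blast
    hence "(\<Phi> z - 1) * gf f z = \<Phi> z * gf g z + out_gf f (1 / z) - out_gf g (1 / z)"
      by (simp add: algebra_simps)
    hence "(1 - z) ^ D * ((1 - z)\<^sup>2 * K z * gf f z) =
             (1 - z) ^ D * (\<Phi> z * gf g z + out_gf f (1 / z) - out_gf g (1 / z))"
      using KF[OF z(1)] by simp
    moreover have "a * b * x * k = p * (a * y) + a * (u - v)"
      if "a * (b * k * x) = a * (p * y + u - v)" for a b x k p y u v :: complex
      using that by (simp add: algebra_simps)
    ultimately have "(1 - z) ^ (D + 2) * gf f z * K z =
        \<Phi> z * G z + (1 - z) ^ D * (out_gf f (1 / z) - out_gf g (1 / z))"
      unfolding power_add G(2)[OF z(2)] by blast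
    thus ?thesis
      using K0[OF z(1)] by (simp add: J_def nonzero_eq_divide_eq)
  qed
  have "F holomorphic_on (ball 0 1 \<union> annulus S)"
    unfolding F_def[abs_def]
    by (intro holomorphic_on_If_Un J open_annulus holomorphic_intros gf_holomorphic f)
       (use eq in auto)
  moreover have "ball 0 1 \<union> annulus S = ball 0 S"
    using S by (auto simp: annulus_def) (smt (verit) S(1) less_divide_eq_1_pos divide_less_eq_1)
  ultimately have "F holomorphic_on ball 0 S" by simp
  moreover have "F z = (1 - z) ^ (D + 2) * gf f z" if "norm z < 1" for z
    using that by (simp add: F_def)
  moreover have "F 1 * K 1 = G 1 + 0 ^ D * (out_gf f 1 - out_gf g 1)"
    using K0[of 1] S by (simp add: F_def J_def)
  ultimately show ?thesis using that by blast
qed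

text \<open>If the sum of these nonnegative terms is 0, each discarded value vanishes. With a
  positive step \<open>a\<close> of positive probability, \<open>f i\<close> is reached from
  \<open>i - a\<close>, which is either outside the half-line or a smaller index, where
  \<open>f\<close> is harmonic and already 0. Induction then kills \<open>f\<close>
  everywhere.\<close>

lemma out_gf_1_nonzero:
  assumes f: "poly_bounded f" and harm: "\<And>i. f i = zconv q f (int i)"
    and nn: "\<And>i. f i \<ge> 0" and nz: "f j \<noteq> 0"
  shows "out_gf f 1 \<noteq> 0"
proof
  assume eq: "out_gf f 1 = 0"
  have zn: "zext f x \<ge> 0" for x using nn by (simp add: zext_def)
  have cn: "zconv q f x \<ge> 0" for x unfolding zconv_def by (intro Bochner_Integration.integral_nonneg) (use zn in auto)
  obtain w where w: "1 < w" "w < R" using dense[OF R_gt_1] by auto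
  have "summable (\<lambda>n. complex_of_real (zconv q f (- 1 - int n)) * complex_of_real w ^ n)"
    using w by (intro out_gf_summable[OF f]) auto
  hence "summable (\<lambda>n. complex_of_real (zconv q f (- 1 - int n)) * 1 ^ n)"
    by (rule powser_inside) (use w in auto)
  hence s: "summable (\<lambda>n. zconv q f (- 1 - int n))"
    by (simp add: summable_of_real_iff)
  have "suminf (\<lambda>n. zconv q f (- 1 - int n)) = 0"
    using eq s by (simp add: out_gf_def suminf_of_real[symmetric])
  hence z: "zconv q f (- 1 - int n) = 0" for n
    using suminf_eq_zero_iff[OF s cn] by blast
  have vanish: "f (nat (x + m)) = 0" if "zconv q f x = 0" "m \<in> set_pmf q" "x + m \<ge> 0" for x m
  proof -
    have "AE m in q. zext f (x + m) = 0"
      using that(1) integrable_zext[OF f] zn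
      by (subst integral_nonneg_eq_0_iff_AE[symmetric]) (auto simp: zconv_def)
    thus ?thesis using that by (auto simp: AE_measure_pmf_iff zext_def)
  qed
  obtain a where a: "a \<in> set_pmf q" "a > 0" using exists_neg_pos by auto
  have "f i = 0" for i
  proof (induction i rule: less_induct)
    case (less i)
    have "zconv q f (int i - a) = 0"
    proof (cases "int i - a \<ge> 0")
      case True
      thus ?thesis using less[of "nat (int i - a)"] harm[of "nat (int i - a)"] a by auto
    next
      case False
      thus ?thesis using z[of "nat (- 1 - (int i - a))"] by simp
    qed
    thus ?case using vanish[of "int i - a" a] a by simp
  qed
  thus False using nz by simp
qed

text \<open>The invariant \<open>F 1 = 0 \<longleftrightarrow> k = 0\<close> carries the exact
  degree, since \<open>F 1\<close> is the sum of the differences of order 2k and thus the top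
  coefficient in the binomial basis. The recursion is required only below \<open>k\<close>, so that
  a single harmonic function can be fed in as the case \<open>k = 1\<close>.\<close>

theorem recursive_family_asymptotics:
  fixes f :: "nat \<Rightarrow> nat \<Rightarrow> real"
  assumes pb: "\<And>k. poly_bounded (f k)"
    and f0: "\<And>i. f 0 i = 0"
    and rec: "\<And>j i. j < k \<Longrightarrow> f (Suc j) i = zconv q (f (Suc j)) (int i) - zconv q (f j) (int i)"
    and nn: "\<And>i. f 1 i \<ge> 0" and nz: "f 1 j \<noteq> 0"
    and k: "k \<ge> 1"
  shows "\<exists>P C r. degree P = 2 * k - 1 \<and> 0 < r \<and> r < 1 \<and> (\<forall>i. \<bar>f k i - poly P (real i)\<bar> \<le> C * r ^ i)"
proof -
  obtain S K where S: "1 < S" "S \<le> R" and K: "K holomorphic_on annulus S"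
    "\<And>z. z \<in> annulus S \<Longrightarrow> K z \<noteq> 0"
    "\<And>z. z \<in> annulus S \<Longrightarrow> \<Phi> z - 1 = (1 - z)\<^sup>2 * K z"
    by (rule \<Phi>_factor_nonzero) (assumption | rule that)+
  have f0': "f 0 = (\<lambda>_. 0)" using f0 by auto
  have "\<exists>F. F holomorphic_on ball 0 S \<and> (\<forall>z. norm z < 1 \<longrightarrow> F z = (1 - z) ^ (2 * k) * gf (f k) z)
          \<and> (F 1 = 0 \<longleftrightarrow> k = 0)" if "\<And>j i. j < k \<Longrightarrow> f (Suc j) i = zconv q (f (Suc j)) (int i) - zconv q (f j) (int i)" for k
    using that
  proof (induction k)
    case 0
    show ?case by (rule exI[of _ "\<lambda>_. 0"]) (auto simp: gf_def f0)
  next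
    case (Suc k)
    have rec: "f (Suc j) i = zconv q (f (Suc j)) (int i) - zconv q (f j) (int i)" if "j \<le> k" for i j
      by (rule Suc.prems) (use that in simp)
    from Suc.IH Suc.prems obtain G where G: "G holomorphic_on ball 0 S" "\<And>z. norm z < 1 \<Longrightarrow> G z = (1 - z) ^ (2 * k) * gf (f k) z"
      "G 1 = 0 \<longleftrightarrow> k = 0" by (metis less_SucI)
    obtain F where F: "F holomorphic_on ball 0 S"
      "\<And>z. norm z < 1 \<Longrightarrow> F z = (1 - z) ^ (2 * k + 2) * gf (f (Suc k)) z"
      "F 1 * K 1 = G 1 + 0 ^ (2 * k) * (out_gf (f (Suc k)) 1 - out_gf (f k) 1)"
      by (rule gf_extension_step[OF pb pb rec[OF order.refl] S K G(1,2)]) (assumption | rule that)+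
    \<comment> \<open>Only the first step sees the boundary term; every later one inherits the
      nonzero value \<open>G 1\<close>.\<close>
    have "F 1 * K 1 \<noteq> 0"
    proof (cases "k = 0")
      case True
      have "G 1 = 0" using G(3) True by simp
      moreover have "out_gf (f 1) 1 \<noteq> 0"
      proof (rule out_gf_1_nonzero[OF pb _ nn nz])
        show "f 1 i = zconv q (f 1) (int i)" for i
          using rec[of 0 i] unfolding f0' One_nat_def by simp
      qed
      moreover have "out_gf (f 0) 1 = 0" by (simp add: out_gf_def f0')
      ultimately show ?thesis using F(3) True by simp
    next
      case False
      thus ?thesis using F(3) G(3) by (simp add: power_0_left)
    qed
    hence "F 1 \<noteq> 0" by auto
    thus ?case using F(1,2) by (intro exI[of _ F]) simp
  qed
  from this[of k, OF rec] k obtain F where F: "F holomorphic_on ball 0 S"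
    "\<And>z. norm z < 1 \<Longrightarrow> F z = (1 - z) ^ (2 * k) * gf (f k) z" "F 1 \<noteq> 0" by auto
  have sums: "(\<lambda>i. complex_of_real ((nabla ^^ (2 * k)) (f k) i) * z ^ i) sums F z" if "norm z < 1" for z
    using nabla_funpow_power_series[OF gf_sums[OF pb that], of "2 * k" k] that
    by (simp add: nabla_funpow_of_real F(2))
  obtain C r where Cr: "0 < r" "r < 1" "\<And>i. \<bar>(nabla ^^ (2 * k)) (f k) i\<bar> \<le> C * r ^ i"
    "complex_of_real (suminf ((nabla ^^ (2 * k)) (f k))) = F 1"
    using powser_coeff_decay[OF F(1) S(1) sums] by blast
  have k2: "2 * k = Suc (2 * k - 1)" using k by simp
  have "suminf ((nabla ^^ (2 * k)) (f k)) \<noteq> 0" using Cr(4) F(3) by auto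
  from nabla_exp_decay_poly[of "2 * k - 1" "f k", folded k2, OF Cr(3,1,2) this]
  show ?thesis using Cr(1,2) by blast
qed

end

section \<open>Survival probabilities\<close>

text \<open>For the walk with step law \<open>q\<close> started at \<open>i\<close>: \<open>surv q n i\<close> is the probability of staying in
  \<open>{0..}\<close> up to time \<open>n\<close>, and \<open>hit q n i\<close> that of first leaving it at time \<open>n + 1\<close>, exactly at \<open>- 1\<close>.\<close>

primrec surv :: "int pmf \<Rightarrow> nat \<Rightarrow> nat \<Rightarrow> real" where
  "surv q 0 = (\<lambda>_. 1)"
| "surv q (Suc n) = (\<lambda>i. zconv q (surv q n) (int i))"

primrec hit :: "int pmf \<Rightarrow> nat \<Rightarrow> nat \<Rightarrow> real" where
  "hit q 0 = (\<lambda>i. pmf q (- 1 - int i))"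
| "hit q (Suc n) = (\<lambda>i. zconv q (hit q n) (int i))"

lemma poly_bounded_bounded: "(\<And>i. \<bar>f i\<bar> \<le> B) \<Longrightarrow> poly_bounded f"
  unfolding poly_bounded_def by (intro exI[of _ B] exI[of _ 0]) auto

lemma zconv_bounds:
  assumes "\<And>i. 0 \<le> f i" "\<And>i. f i \<le> 1"
  shows "0 \<le> zconv q f x" "zconv q f x \<le> 1"
proof -
  have z: "0 \<le> zext f y \<and> zext f y \<le> 1" for y using assms by (simp add: zext_def)
  show "0 \<le> zconv q f x"
    unfolding zconv_def by (intro Bochner_Integration.integral_nonneg) (use z in auto)
  have "zconv q f x \<le> measure_pmf.expectation q (\<lambda>_. 1)"
    unfolding zconv_def
    by (intro integral_mono measure_pmf.integrable_const_bound[where B = 1]) (use z in auto)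
  thus "zconv q f x \<le> 1" by simp
qed

lemma surv_bounds: "0 \<le> surv q n i" "surv q n i \<le> 1"
proof -
  have "\<forall>i. 0 \<le> surv q n i \<and> surv q n i \<le> 1"
    by (induction n) (auto intro: zconv_bounds)
  thus "0 \<le> surv q n i" "surv q n i \<le> 1" by auto
qed

lemma hit_bounds: "0 \<le> hit q n i" "hit q n i \<le> 1"
proof -
  have "\<forall>i. 0 \<le> hit q n i \<and> hit q n i \<le> 1"
    by (induction n) (auto intro: zconv_bounds pmf_le_1)
  thus "0 \<le> hit q n i" "hit q n i \<le> 1" by auto
qed

lemma surv_poly_bounded [simp]: "poly_bounded (surv q n)"
  by (rule poly_bounded_bounded[of _ 1]) (use surv_bounds[of q n] in auto)

lemma hit_poly_bounded [simp]: "poly_bounded (hit q n)"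
  by (rule poly_bounded_bounded[of _ 1]) (use hit_bounds[of q n] in auto)

lemma ln_power_eventually_le:
  fixes a \<delta> :: real
  assumes "a > 0" "\<delta> > 0"
  shows "eventually (\<lambda>n. (a * ln (real n) + 1) ^ k \<le> real n powr \<delta>) sequentially"
proof -
  define d where "d = \<delta> / real (Suc k)"
  have d: "d > 0" using assms by (simp add: d_def)
  have "eventually (\<lambda>n::nat. a * ln (real n) + 1 \<le> real n powr d) sequentially"
    using d assms(1) by real_asymp
  thus ?thesis using eventually_ge_at_top[of 1]
  proof eventually_elim
    case (elim n)
    have "(a * ln (real n) + 1) ^ k \<le> (a * ln (real n) + 1) ^ Suc k"
      using elim assms by (intro power_increasing) auto
    also have "\<dots> \<le> (real n powr d) ^ Suc k"
      using elim assms by (intro power_mono) auto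
    also have "\<dots> = real n powr \<delta>"
      using elim by (simp add: powr_powr powr_realpow[symmetric] d_def del: power_Suc of_nat_Suc)
    finally show ?case .
  qed
qed

lemma integrable_indicator_pmf [simp]:
  "integrable (measure_pmf q) (\<lambda>m. indicator A m :: real)"
  by (rule measure_pmf.integrable_const_bound[where B = 1]) (auto simp: indicator_def intro!: AE_I2)

context exp_moment_pmf
begin

lemma zconv_mono:
  assumes "poly_bounded f" "poly_bounded g" "\<And>i. f i \<le> g i"
  shows "zconv q f x \<le> zconv q g x"
  unfolding zconv_def
  by (intro integral_mono integrable_zext assms) (use assms in \<open>auto simp: zext_def\<close>)

lemma surv_Suc_le: "surv q (Suc n) i \<le> surv q n i"
proof (induction n arbitrary: i)
  case 0
  show ?case using surv_bounds(2)[of q "Suc 0" i] by simp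
next
  case (Suc n)
  have "zconv q (surv q (Suc n)) (int i) \<le> zconv q (surv q n) (int i)"
    by (intro zconv_mono Suc surv_poly_bounded)
  thus ?case by simp
qed

text \<open>The exit decomposition: leaving the half-line at the point \<open>- 1 - l\<close> when started from \<open>i\<close> is
  not likelier than leaving it at \<open>- 1\<close> when started from \<open>i + l\<close>.\<close>

lemma surv_diff_le_hit:
  "surv q n i - surv q (Suc n) i \<le>
     (\<Sum>l<L. hit q n (i + l)) + measure_pmf.expectation q (\<lambda>m. R ^ nat \<bar>m\<bar>) / R ^ L"
proof (induction n arbitrary: i)
  case 0
  have R0: "R > 0" using R_gt_1 by simp
  have "zext (\<lambda>_. 1) (int i + m) = indicator {- int i..} m" for m
    by (auto simp: zext_def indicator_def)
  hence "surv q 0 i - surv q (Suc 0) i = measure_pmf.expectation q (\<lambda>m. 1 - indicator {- int i..} m)"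
    by (simp add: zconv_def)
  also have "\<dots> \<le> measure_pmf.expectation q (\<lambda>m. (\<Sum>l<L. indicator {- 1 - int (i + l)} m) + R ^ nat \<bar>m\<bar> / R ^ L)"
  proof (rule integral_mono)
    fix m
    show "1 - indicator {- int i..} m \<le> (\<Sum>l<L. indicator {- 1 - int (i + l)} m) + R ^ nat \<bar>m\<bar> / R ^ L"
    proof (cases "m < - int i")
      case True
      define l where "l = nat (- 1 - int i - m)"
      have ml: "m = - 1 - int (i + l)" using True by (simp add: l_def)
      have nn: "0 \<le> R ^ nat \<bar>m\<bar> / R ^ L" using R0 by simp
      have nn': "0 \<le> (\<Sum>l<L. indicator {- 1 - int (i + l)} m :: real)" by (intro sum_nonneg) auto
      show ?thesis
      proof (cases "l < L")
        case True
        have "(1::real) = indicator {- 1 - int (i + l)} m" by (simp add: ml)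
        also have "\<dots> \<le> (\<Sum>l<L. indicator {- 1 - int (i + l)} m)"
          using True by (intro member_le_sum) auto
        finally have "(1::real) \<le> (\<Sum>l<L. indicator {- 1 - int (i + l)} m)" .
        moreover have "1 - indicator {- int i..} m \<le> (1::real)" by simp
        ultimately show ?thesis using nn by linarith
      next
        case False
        \<comment> \<open>An exit below the first \<open>L\<close> levels needs a step with |m| > L,
          so the Markov-type term alone is at least 1.\<close>
        hence "R ^ L \<le> R ^ nat \<bar>m\<bar>" using R_gt_1 ml by (intro power_increasing) auto
        hence "1 \<le> R ^ nat \<bar>m\<bar> / R ^ L" using R0 by simp
        moreover have "1 - indicator {- int i..} m \<le> (1::real)" by simp
        ultimately show ?thesis using nn' by linarith
      qed
    next
      case False
      thus ?thesis using R0 by (auto simp: indicator_def intro!: add_nonneg_nonneg sum_nonneg)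
    qed
  next
    show "integrable q (\<lambda>m. 1 - indicator {- int i..} m :: real)"
      by simp
    show "integrable q (\<lambda>m. (\<Sum>l<L. indicator {- 1 - int (i + l)} m) + R ^ nat \<bar>m\<bar> / R ^ L)"
      by (intro Bochner_Integration.integrable_add Bochner_Integration.integrable_sum integrable_divide exp_int
           integrable_indicator_pmf)
  qed
  also have "\<dots> = (\<Sum>l<L. hit q 0 (i + l)) + measure_pmf.expectation q (\<lambda>m. R ^ nat \<bar>m\<bar>) / R ^ L"
    using exp_int by (subst Bochner_Integration.integral_add) (auto simp: measure_pmf_single)
  finally show ?case .
next
  case (Suc n)
  define \<epsilon> where "\<epsilon> = measure_pmf.expectation q (\<lambda>m. R ^ nat \<bar>m\<bar>) / R ^ L"
  have \<epsilon>: "\<epsilon> \<ge> 0" using R_gt_1 by (auto simp: \<epsilon>_def intro!: divide_nonneg_pos Bochner_Integration.integral_nonneg)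
  have "surv q (Suc n) i - surv q (Suc (Suc n)) i =
      zconv q (surv q n) (int i) - zconv q (surv q (Suc n)) (int i)"
    by simp
  also have "\<dots> =
      measure_pmf.expectation q (\<lambda>m. zext (surv q n) (int i + m) - zext (surv q (Suc n)) (int i + m))"
    unfolding zconv_def
    by (intro Bochner_Integration.integral_diff[symmetric] integrable_zext surv_poly_bounded)
  also have "\<dots> \<le> measure_pmf.expectation q (\<lambda>m. (\<Sum>l<L. zext (hit q n) (int (i + l) + m)) + \<epsilon>)"
  proof (rule integral_mono)
    fix m
    show "zext (surv q n) (int i + m) - zext (surv q (Suc n)) (int i + m) \<le> (\<Sum>l<L. zext (hit q n) (int (i + l) + m)) + \<epsilon>"
    proof (cases "int i + m \<ge> 0")
      case True
      have "zext (hit q n) (int (i + l) + m) = hit q n (nat (int i + m) + l)" for l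
        using True by (auto simp: zext_def nat_add_distrib algebra_simps intro!: arg_cong[of _ _ "hit q n"])
      thus ?thesis using True Suc[of "nat (int i + m)"] by (simp add: zext_def[of "surv _ _"] zext_def[of "\<lambda>i. zconv q _ (int i)"] \<epsilon>_def)
    next
      case False
      thus ?thesis using \<epsilon> hit_bounds(1)[of q n] by (auto simp: zext_def intro!: add_nonneg_nonneg sum_nonneg)
    qed
  qed (auto intro!: integrable_zext Bochner_Integration.integrable_diff Bochner_Integration.integrable_add Bochner_Integration.integrable_sum simp del: surv.simps)
  also have "\<dots> = (\<Sum>l<L. hit q (Suc n) (i + l)) + \<epsilon>"
    using integrable_zext[of "hit q n"] by (simp add: zconv_def)
  finally show ?case by (simp add: \<epsilon>_def)
qed

end

section \<open>Lower bounds for survival and the consequences of a too small exit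
  probability\<close>

context centered_pmf
begin

definition \<sigma>2 :: real where "\<sigma>2 = measure_pmf.expectation q (\<lambda>m. real_of_int m ^ 2)"

lemma \<sigma>2_nonneg: "\<sigma>2 \<ge> 0"
  unfolding \<sigma>2_def by (intro Bochner_Integration.integral_nonneg) auto

text \<open>Optional stopping for \<open>S\<^sub>n\<close> and \<open>S\<^sub>n\<^sup>2 - n \<sigma>\<^sup>2\<close>, combined through \<open>y \<le> A + y\<^sup>2 / (4 A)\<close>.\<close>

lemma surv_lower_aux:
  assumes A: "A > 0"
  shows "A * surv q n i + ((1 + real i)\<^sup>2 + \<sigma>2 * real n) / (4 * A) \<ge> 1 + real i"
proof (induction n arbitrary: i)
  case 0
  have "0 \<le> ((1 + real i) - 2 * A)\<^sup>2 / (4 * A)" using A by simp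
  also have "\<dots> = A + (1 + real i)\<^sup>2 / (4 * A) - (1 + real i)"
    using A by (simp add: field_simps power2_eq_square)
  finally show ?case by simp
next
  case (Suc n)
  \<comment> \<open>The shift by 1 makes \<open>y + m \<le> 0\<close> as soon as the walk is
    outside, so the integrand comparison also holds where the survival term is 0.\<close>
  define y where "y = 1 + real i"
  define c where "c = \<sigma>2 * real n / (4 * A)"
  have int: "integrable q (\<lambda>m. real_of_int m)" "integrable q (\<lambda>m. (real_of_int m)\<^sup>2)"
    using integrable_poly[of 1] integrable_poly[of 2] by simp_all
  have ex: "y + real_of_int m - ((y + real_of_int m)\<^sup>2 + \<sigma>2 * real n) / (4 * A) =
      (y - y\<^sup>2 / (4 * A) - c) + ((1 - 2 * y / (4 * A)) * real_of_int m - (1 / (4 * A)) * (real_of_int m)\<^sup>2)" for m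
    using A by (simp add: field_simps power2_eq_square c_def)
  have "y - (y\<^sup>2 + \<sigma>2 * real (Suc n)) / (4 * A) =
      measure_pmf.expectation q (\<lambda>m. y + real_of_int m - ((y + real_of_int m)\<^sup>2 + \<sigma>2 * real n) / (4 * A))"
    unfolding ex using int mean_zero by (simp add: \<sigma>2_def c_def add_divide_distrib algebra_simps)
  also have "\<dots> \<le> measure_pmf.expectation q (\<lambda>m. A * zext (surv q n) (int i + m))"
  proof (rule integral_mono)
    show "integrable q (\<lambda>m. y + real_of_int m - ((y + real_of_int m)\<^sup>2 + \<sigma>2 * real n) / (4 * A))"
      unfolding ex using int by simp
    show "integrable q (\<lambda>m. A * zext (surv q n) (int i + m))"
      by (intro integrable_mult_right integrable_zext) auto
    fix m
    show "y + real_of_int m - ((y + real_of_int m)\<^sup>2 + \<sigma>2 * real n) / (4 * A) \<le> A * zext (surv q n) (int i + m)"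
    proof (cases "int i + m \<ge> 0")
      case True
      hence e: "1 + real (nat (int i + m)) = y + real_of_int m" by (simp add: y_def)
      have "zext (surv q n) (int i + m) = surv q n (nat (int i + m))"
        using True by (simp add: zext_def)
      thus ?thesis using Suc[of "nat (int i + m)"] unfolding e by simp
    next
      case False
      have "y + real_of_int m \<le> 0" using False by (simp add: y_def)
      moreover have "0 \<le> ((y + real_of_int m)\<^sup>2 + \<sigma>2 * real n) / (4 * A)" using A \<sigma>2_nonneg by simp
      ultimately show ?thesis using False by simp
    qed
  qed
  also have "\<dots> = A * surv q (Suc n) i" by (simp add: zconv_def)
  finally show ?case by (simp add: y_def)
qed

lemma surv_lower: "surv q n 0 \<ge> 1 / (1 + \<sigma>2 * real n)"
proof -
  define s where "s = 1 + \<sigma>2 * real n"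
  have s: "s > 0" using \<sigma>2_nonneg by (auto simp: s_def intro: add_pos_nonneg)
  \<comment> \<open>The level \<open>A = s / 2\<close> makes the quadratic term equal to 1/2,
    leaving 1/2 for the survival term.\<close>
  have "1 \<le> s / 2 * surv q n 0 + s / (4 * (s / 2))"
    using surv_lower_aux[where A = "s / 2" and n = n and i = 0] s by (simp add: s_def)
  also have "s / (4 * (s / 2)) = 1 / 2" using s by simp
  finally have "1 \<le> s * surv q n 0" by simp
  hence "1 / s \<le> surv q n 0" using s by (simp add: divide_le_eq mult.commute)
  thus ?thesis by (simp add: s_def)
qed

text \<open>A nonzero solution, extended by 0 at index 0 into a family, falls under the asymptotic
  theorem with \<open>k = 1\<close> and would be a polynomial of degree exactly 1 up to a bounded
  error.\<close>

lemma bounded_harmonic_eq_0: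
  assumes "\<And>i. f i = zconv q f (int i)" "\<And>i. 0 \<le> f i" "\<And>i. f i \<le> B"
  shows "f i = 0"
proof (rule ccontr)
  assume nz: "f i \<noteq> 0"
  define F where "F k = (if k = 0 then (\<lambda>_. 0) else f)" for k :: nat
  have pb: "poly_bounded f" by (rule poly_bounded_bounded[of _ B]) (use assms in auto)
  have "\<exists>P C r. degree P = 2 * 1 - 1 \<and> 0 < r \<and> r < 1 \<and> (\<forall>i. \<bar>F 1 i - poly P (real i)\<bar> \<le> C * r ^ i)"
  proof (rule recursive_family_asymptotics)
    show "poly_bounded (F k)" for k
      using pb by (auto simp: F_def intro: poly_bounded_bounded[of _ 0])
    show "F (Suc j) i = zconv q (F (Suc j)) (int i) - zconv q (F j) (int i)" if "j < 1" for j i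
      using assms(1)[of i] that by (simp add: F_def)
  qed (use assms nz in \<open>auto simp: F_def\<close>)
  then obtain P C r where P: "degree P = 1" "0 < r" "r < 1" "\<And>i. \<bar>f i - poly P (real i)\<bar> \<le> C * r ^ i"
    by (auto simp: F_def)
  have "C \<ge> 0" using P(4)[of 0] by simp
  hence bnd: "\<bar>poly P (real i)\<bar> \<le> B + C" for i
    using P(4)[of i] P(2,3) assms(2,3)[of i] mult_left_mono[of "r ^ i" 1 C] power_le_one[of r i] by auto
  define b where "b = coeff P 1"
  have "b \<noteq> 0" using P(1) leading_coeff_0_iff[of P] by (auto simp: b_def)
  have "P = [:coeff P 0, b:]"
    using P(1) by (intro poly_eqI) (auto simp: b_def coeff_pCons coeff_eq_0 split: nat.splits)
  hence "poly P (real i) = coeff P 0 + b * real i" for i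
    by (metis poly_pCons poly_0 mult_zero_right add_0_right mult.commute)
  hence lin: "\<bar>b\<bar> * real i \<le> B + C + \<bar>coeff P 0\<bar>" for i
    using bnd[of i] by (simp add: abs_mult[symmetric])
  obtain n where "(B + C + \<bar>coeff P 0\<bar>) / \<bar>b\<bar> < real n" using reals_Archimedean2 by blast
  thus False using lin[of n] \<open>b \<noteq> 0\<close> by (simp add: field_simps)
qed

text \<open>The monotone limit is harmonic by dominated convergence and bounded by 1, hence
  0.\<close>

lemma surv_tendsto_0: "(\<lambda>n. surv q n i) \<longlonglongrightarrow> 0"
proof -
  have "\<exists>h. (\<lambda>n. surv q n i) \<longlonglongrightarrow> h" for i
    using decseq_convergent[of "\<lambda>n. surv q n i" 0] surv_bounds(1) surv_Suc_le
    by (metis decseq_SucI)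
  then obtain h where h: "\<And>i. (\<lambda>n. surv q n i) \<longlonglongrightarrow> h i" by metis
  have b: "0 \<le> h i" "h i \<le> 1" for i
    using surv_bounds by (auto intro: LIMSEQ_le_const[OF h] LIMSEQ_le_const2[OF h])
  have "(\<lambda>n. surv q (Suc n) i) \<longlonglongrightarrow> zconv q h (int i)" for i
    unfolding surv.simps(2) zconv_def
  proof (rule integral_dominated_convergence[where w = "\<lambda>_. 1"])
    show "AE m in q. (\<lambda>n. zext (surv q n) (int i + m)) \<longlonglongrightarrow> zext h (int i + m)"
      using h by (auto simp: zext_def)
    show "AE m in q. norm (zext (surv q n) (int i + m)) \<le> 1" for n
      using surv_bounds by (auto simp: zext_def)
  qed auto
  hence "h i = zconv q h (int i)" for i
    using LIMSEQ_unique[OF LIMSEQ_Suc[OF h[of i]]] by auto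
  hence "h i = 0" for i using b bounded_harmonic_eq_0[of h 1 i] by blast
  thus ?thesis using h[of i] by simp
qed

text \<open>The exit decomposition with about log n levels bounds one decrement of the survival
  probability. The decrements are then summed from infinity, using that survival tends to 0, and the
  result n^(-9/8) undercuts the lower bound of order 1/n.\<close>

lemma hit_not_small:
  assumes hit: "\<And>n i. n \<ge> N \<Longrightarrow> hit q n i \<le> C * (1 + real i) ^ D * real n powr (- 9/4)"
  shows False
proof -
  have C: "C \<ge> 0"
  proof -
    have "0 \<le> C * real (Suc N) powr (- 9/4)"
      using hit[of "Suc N" 0] hit_bounds(1)[of q "Suc N" 0] by (simp del: of_nat_Suc)
    thus ?thesis by (simp add: zero_le_mult_iff powr_ge_zero del: of_nat_Suc) 
  qed
  define B where "B = measure_pmf.expectation q (\<lambda>m. R ^ nat \<bar>m\<bar>)"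
  have B: "B \<ge> 0" unfolding B_def using R_gt_1 by (intro Bochner_Integration.integral_nonneg) auto
  \<comment> \<open>Chosen so that \<open>L\<close> of size a log n gives R^L \<ge> n^3, which makes
    the overshoot term O(n^(-3)).\<close>
  define a where "a = 3 / ln R"
  have lnR: "ln R > 0" using R_gt_1 by simp
  have a: "a > 0" using lnR by (simp add: a_def)
  \<comment> \<open>There are \<open>L\<close> summands, each with a factor of at most L^D. The loss
    1/16 is admissible because -9/4 + 1/16 < -17/8, the order of the differences of
    n^(-9/8).\<close>
  have "eventually (\<lambda>n. (a * ln (real n) + 1) ^ Suc D \<le> real n powr (1/16)) sequentially"
    by (rule ln_power_eventually_le) (use a in auto)
  moreover have "eventually (\<lambda>n::nat. C * real n powr (1/16) * real n powr (- 9/4) + B * real n powr (-3)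
      \<le> real n powr (- 9/8) - (real n + 1) powr (- 9/8)) sequentially"
    by real_asymp
  ultimately have "eventually (\<lambda>n. surv q n 0 - surv q (Suc n) 0 \<le> real n powr (- 9/8) - (real n + 1) powr (- 9/8)) sequentially"
    using eventually_ge_at_top[of "max N 1"]
  proof eventually_elim
    case (elim n)
    define L where "L = nat \<lceil>a * ln (real n)\<rceil>"
    have lnn: "ln (real n) \<ge> 0" using elim by simp
    have L1: "real L \<le> a * ln (real n) + 1" using a lnn by (simp add: L_def)
    have L2: "a * ln (real n) \<le> real L" unfolding L_def by (rule real_nat_ceiling_ge)
    have "R powr (a * ln (real n)) \<le> R powr real L"
      using L2 R_gt_1 by (intro powr_mono) auto
    also have "R powr (a * ln (real n)) = real n powr 3"
      using lnR R_gt_1 elim by (simp add: powr_def a_def)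
    also have "R powr real L = R ^ L" using R_gt_1 by (simp add: powr_realpow)
    finally have RL: "real n powr 3 \<le> R ^ L" .
    have "surv q n 0 - surv q (Suc n) 0 \<le> (\<Sum>l<L. hit q n l) + B / R ^ L"
      using surv_diff_le_hit[of n 0 L] by (simp add: B_def)
    also have "B / R ^ L \<le> B / real n powr 3"
      using RL B elim R_gt_1 by (intro divide_left_mono mult_pos_pos) auto
    also have "\<dots> = B * real n powr (-3)" by (simp add: powr_minus divide_inverse)
    also have "(\<Sum>l<L. hit q n l) \<le> (\<Sum>l<L. C * real L ^ D * real n powr (- 9/4))"
    proof (intro sum_mono)
      fix l assume l: "l \<in> {..<L}"
      have "hit q n l \<le> C * (1 + real l) ^ D * real n powr (- 9/4)" using elim by (intro hit) auto
      also have "\<dots> \<le> C * real L ^ D * real n powr (- 9/4)"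
        using l C by (intro mult_right_mono mult_left_mono power_mono) auto
      finally show "hit q n l \<le> C * real L ^ D * real n powr (- 9/4)" .
    qed
    also have "\<dots> = C * real L ^ Suc D * real n powr (- 9/4)" by simp
    also have "\<dots> \<le> C * real n powr (1/16) * real n powr (- 9/4)"
      using C order.trans[OF power_mono[OF L1, of "Suc D"] elim(1)]
      by (intro mult_right_mono mult_left_mono) (auto simp del: power_Suc)
    finally show ?case using elim(2) by linarith
  qed
  then obtain M where M: "\<And>n. n \<ge> M \<Longrightarrow>
      surv q n 0 - surv q (Suc n) 0 \<le> real n powr (- 9/8) - (real n + 1) powr (- 9/8)"
    by (auto simp: eventually_sequentially)
  have upper: "surv q n 0 \<le> real n powr (- 9/8)" if n: "n \<ge> M" for n
  proof -
    \<comment> \<open>Increasing with limit 0, hence nonpositive from its first term on.\<close>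
    define g where "g k = surv q (n + k) 0 - real (n + k) powr (- 9/8)" for k
    have "incseq g"
    proof (rule incseq_SucI)
      show "g k \<le> g (Suc k)" for k using M[of "n + k"] n by (simp add: g_def add_ac)
    qed
    moreover have "g \<longlonglongrightarrow> 0 - 0"
      unfolding g_def
    proof (intro tendsto_diff)
      show "(\<lambda>k. surv q (n + k) 0) \<longlonglongrightarrow> 0"
        using LIMSEQ_ignore_initial_segment[OF surv_tendsto_0[of 0], of n] by (simp add: add.commute)
      have "(\<lambda>k. real k powr (- 9/8)) \<longlonglongrightarrow> 0" by real_asymp
      from LIMSEQ_ignore_initial_segment[OF this, of n]
      show "(\<lambda>k. real (n + k) powr (- 9/8)) \<longlonglongrightarrow> 0" by (simp add: add.commute)
    qed
    ultimately have "g 0 \<le> 0" using incseq_le by fastforce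
    thus ?thesis by (simp add: g_def)
  qed
  \<comment> \<open>A strictly positive substitute for \<open>\<sigma>2\<close>, so that the
    comparison with 1/n has a definite rate.\<close>
  define s where "s = \<sigma>2 + 1"
  have s: "s > 0" using \<sigma>2_nonneg by (simp add: s_def)
  have "eventually (\<lambda>n::nat. real n powr (- 9/8) < 1 / (1 + s * real n)) sequentially"
    using s by real_asymp
  from eventually_happens'[OF sequentially_bot eventually_conj[OF this eventually_ge_at_top[of M]]]
  obtain n where n: "n \<ge> M" "real n powr (- 9/8) < 1 / (1 + s * real n)"
    by blast
  have "1 / (1 + s * real n) \<le> 1 / (1 + \<sigma>2 * real n)"
  proof (rule frac_le)
    show "0 < 1 + \<sigma>2 * real n" using \<sigma>2_nonneg by (intro add_pos_nonneg) auto
    show "1 + \<sigma>2 * real n \<le> 1 + s * real n" by (simp add: s_def mult_right_mono)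
  qed auto
  thus False using n upper[of n] surv_lower[of n] by linarith
qed

lemma surv_not_small:
  assumes small: "\<And>n. n \<ge> N \<Longrightarrow> surv q n 0 \<le> C * real n powr (- 5/4)"
  shows False
proof -
  define s where "s = \<sigma>2 + 1"
  have s: "s > 0" using \<sigma>2_nonneg by (simp add: s_def)
  have "eventually (\<lambda>n::nat. C * real n powr (- 5/4) < 1 / (1 + s * real n)) sequentially"
    using s by real_asymp
  from eventually_happens'[OF sequentially_bot eventually_conj[OF this eventually_ge_at_top[of N]]]
  obtain n where n: "n \<ge> N" "C * real n powr (- 5/4) < 1 / (1 + s * real n)"
    by blast
  have "1 / (1 + s * real n) \<le> 1 / (1 + \<sigma>2 * real n)"
  proof (rule frac_le)
    show "0 < 1 + \<sigma>2 * real n" using \<sigma>2_nonneg by (intro add_pos_nonneg) auto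
    show "1 + \<sigma>2 * real n \<le> 1 + s * real n" by (simp add: s_def mult_right_mono)
  qed auto
  thus False using n small[of n] surv_lower[of n] by linarith
qed

end

text \<open>The probability of staying in \<open>{0..}\<close> up to time \<open>n\<close> and being at \<open>0\<close> then.\<close>

primrec stay :: "int pmf \<Rightarrow> nat \<Rightarrow> nat \<Rightarrow> real" where
  "stay q 0 = (\<lambda>i. if i = 0 then 1 else 0)"
| "stay q (Suc n) = (\<lambda>i. zconv q (stay q n) (int i))"

lemma stay_bounds: "0 \<le> stay q n i" "stay q n i \<le> 1"
proof -
  have "\<forall>i. 0 \<le> stay q n i \<and> stay q n i \<le> 1"
    by (induction n) (auto intro: zconv_bounds)
  thus "0 \<le> stay q n i" "stay q n i \<le> 1" by auto
qed

text \<open>Raised by one level, a path that first leaves the half-line by stepping onto -1 stays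
  nonnegative and ends at 0. This lets the weak half-line case borrow the lower bound for
  \<open>hit\<close>.\<close>

lemma hit_le_stay: "hit q n i \<le> stay q (Suc n) (Suc i)"
proof (induction n arbitrary: i)
  case 0
  have "zext (\<lambda>i. if i = 0 then 1 else 0) (int (Suc i) + m) = indicator {- 1 - int i} m" for m
    by (auto simp: zext_def indicator_def)
  thus ?case by (simp add: zconv_def measure_pmf_single)
next
  case (Suc n)
  have "zconv q (hit q n) (int i) \<le> zconv q (stay q (Suc n)) (int (Suc i))"
    unfolding zconv_def
  proof (rule integral_mono)
    fix m
    show "zext (hit q n) (int i + m) \<le> zext (stay q (Suc n)) (int (Suc i) + m)"
    proof (cases "int i + m \<ge> 0")
      case True
      hence "nat (int (Suc i) + m) = Suc (nat (int i + m))" by linarith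
      thus ?thesis using True Suc[of "nat (int i + m)"] by (simp add: zext_def del: stay.simps)
    next
      case False
      thus ?thesis using stay_bounds(1)[of q "Suc n"] by (simp add: zext_def del: stay.simps)
    qed
  qed (intro measure_pmf.integrable_const_bound[where B = 1]; use hit_bounds[of q n] stay_bounds[of q "Suc n"] in \<open>auto simp: zext_def simp del: stay.simps\<close>)+
  thus ?case by simp
qed

section \<open>Coefficients of asymptotic expansions\<close>

lemma poly_bounded_add:
  assumes "poly_bounded f" "poly_bounded g"
  shows "poly_bounded (\<lambda>i. f i + g i)"
proof -
  obtain C D where f: "C \<ge> 0" "\<And>i. \<bar>f i\<bar> \<le> C * (1 + real i) ^ D"
    using poly_boundedE[OF assms(1)] by blast
  obtain C' D' where g: "C' \<ge> 0" "\<And>i. \<bar>g i\<bar> \<le> C' * (1 + real i) ^ D'"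
    using poly_boundedE[OF assms(2)] by blast
  have "\<bar>f i + g i\<bar> \<le> (C + C') * (1 + real i) ^ max D D'" for i
  proof -
    have "\<bar>f i + g i\<bar> \<le> C * (1 + real i) ^ D + C' * (1 + real i) ^ D'"
      using f(2)[of i] g(2)[of i] by linarith
    also have "\<dots> \<le> C * (1 + real i) ^ max D D' + C' * (1 + real i) ^ max D D'"
      using f(1) g(1) by (intro add_mono mult_left_mono power_increasing) auto
    finally show ?thesis by (simp add: distrib_right)
  qed
  thus ?thesis unfolding poly_bounded_def by blast
qed

lemma poly_bounded_cmult:
  assumes "poly_bounded f"
  shows "poly_bounded (\<lambda>i. c * f i)"
proof -
  obtain C D where f: "C \<ge> 0" "\<And>i. \<bar>f i\<bar> \<le> C * (1 + real i) ^ D"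
    using poly_boundedE[OF assms(1)] by blast
  have "\<bar>c * f i\<bar> \<le> (\<bar>c\<bar> * C) * (1 + real i) ^ D" for i
    using mult_left_mono[OF f(2)[of i], of "\<bar>c\<bar>"] by (simp add: abs_mult mult_ac)
  thus ?thesis unfolding poly_bounded_def by blast
qed

lemma poly_bounded_diff:
  assumes "poly_bounded f" "poly_bounded g"
  shows "poly_bounded (\<lambda>i. f i - g i)"
  using poly_bounded_add[OF assms(1) poly_bounded_cmult[OF assms(2), of "-1"]] by simp

lemma poly_bounded_sum:
  assumes "\<And>j. j \<in> A \<Longrightarrow> poly_bounded (f j)"
  shows "poly_bounded (\<lambda>i. \<Sum>j\<in>A. f j i)"
  using assms
  by (induction A rule: infinite_finite_induct)
     (auto intro: poly_bounded_add poly_bounded_bounded[of _ 0])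

section \<open>The scale of coefficients \<open>a_coeff j n\<close>: recursion, asymptotics,
  independence\<close>

lemma a_coeff_Suc: "a_coeff j n = a_coeff j (Suc n) - a_coeff (Suc j) (Suc n)"
proof -
  have "(real (Suc j) - 3/2) gchoose Suc n = ((real j - 3/2) gchoose Suc n) + ((real j - 3/2) gchoose n)"
    using gbinomial_Suc_Suc[of "real j - 3/2" n] by (simp add: algebra_simps)
  thus ?thesis by (simp add: a_coeff_def algebra_simps)
qed

lemma a_coeff_ratio: "(real j - 1/2 - real n) * a_coeff (Suc j) n = (real j - 1/2) * a_coeff j n"
proof -
  define b where "b = real j - 1/2"
  have b: "real (Suc j) - 3/2 = b" "real j - 3/2 = b - 1" by (auto simp: b_def)
  have "(b - real n) * ((-1) ^ n * (b gchoose n)) = (-1) ^ n * ((b - real n) * (b gchoose n))"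
    by (rule mult.left_commute)
  also have "\<dots> = b * ((-1) ^ n * ((b - 1) gchoose n))"
    unfolding gbinomial_absorb_comp by (rule mult.left_commute)
  finally show ?thesis unfolding a_coeff_def b b_def[symmetric] .
qed

text \<open>Its sign depends on \<open>j\<close>: positive for j = 1, negative for j = 2. Signs of
  coefficient functions are therefore compared only after multiplication by it.\<close>

definition a_const :: "nat \<Rightarrow> real" where "a_const j = inverse (Gamma (3/2 - real j))"

lemma a_const_nonzero: "a_const j \<noteq> 0"
proof -
  have "3/2 - real j \<notin> \<int>"
  proof
    assume "3/2 - real j \<in> \<int>"
    then obtain k :: int where "3/2 - real j = real_of_int k" by (auto elim: Ints_cases)
    hence "real_of_int 3 = real_of_int (2 * (k + int j))" by simp
    hence "3 = 2 * (k + int j)" by (simp only: of_int_eq_iff)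
    thus False by presburger
  qed
  hence "3/2 - real j \<notin> \<int>\<^sub>\<le>\<^sub>0" using nonpos_Ints_subset_Ints by blast
  thus ?thesis by (simp add: a_const_def Gamma_eq_zero_iff)
qed

lemma a_coeff_asymp: "(\<lambda>n. a_coeff j n * real n powr (real j - 1/2)) \<longlonglongrightarrow> a_const j"
proof -
  have "(\<lambda>n. ((real j - 3/2) gchoose n) / ((-1)^n / exp ((real j - 3/2 + 1) * ln (real n)))) \<longlonglongrightarrow> a_const j"
    using gbinomial_asymptotic[of "real j - 3/2"] by (simp add: a_const_def)
  moreover have "eventually (\<lambda>n. ((real j - 3/2) gchoose n) / ((-1)^n / exp ((real j - 3/2 + 1) * ln (real n)))
       = a_coeff j n * real n powr (real j - 1/2)) sequentially"
    using eventually_gt_at_top[of 0]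
  proof eventually_elim
    case (elim n)
    have "x / ((-1) ^ n / y) = (-1) ^ n * x * y" for x y :: real
      by (cases "even n") auto
    moreover have "exp ((real j - 3/2 + 1) * ln (real n)) = real n powr (real j - 1/2)"
      using elim by (simp add: powr_def)
    ultimately show ?case by (simp only: a_coeff_def)
  qed
  ultimately show ?thesis by (rule Lim_transform_eventually)
qed

text \<open>Scaling by n^(j + s - 1/2) keeps the j-th term; the later terms tend to 0 and the
  earlier ones are already known to vanish.\<close>

lemma a_coeff_unique:
  assumes lim: "(\<lambda>n. (\<Sum>j=1..J. c j * a_coeff (j + s) n) * real n powr (real (J + s) - 1/2)) \<longlonglongrightarrow> 0"
    and j: "j \<in> {1..J}"
  shows "c j = 0"
  using j
proof (induction j rule: less_induct)
  case (less j)
  have prev: "c k = 0" if "k \<in> {1..J}" "k < j" for k using less.IH[of k] that by auto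
  have "(\<lambda>n. \<Sum>k=1..J. c k * a_coeff (k + s) n * real n powr (real (j + s) - 1/2)) \<longlonglongrightarrow>
          (\<Sum>k=1..J. if k = j then c k * a_const (k + s) else 0)"
  proof (rule tendsto_sum)
    fix k assume k: "k \<in> {1..J}"
    have "(\<lambda>n. c k * (a_coeff (k + s) n * real n powr (real (k + s) - 1/2)) * real n powr (real j - real k))
            \<longlonglongrightarrow> (if k = j then c k * a_const (k + s) else 0)"
    proof (cases "k < j")
      case True
      thus ?thesis using prev k by simp
    next
      case False
      have "(\<lambda>n. real n powr (real j - real k)) \<longlonglongrightarrow> (if k = j then 1 else 0)"
      proof (cases "k = j")
        case True
        have "eventually (\<lambda>n. real n powr (real j - real k) = 1) sequentially"
          using eventually_gt_at_top[of 0] by eventually_elim (simp add: True)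
        hence "(\<lambda>n. real n powr (real j - real k)) \<longlonglongrightarrow> 1"
          by (rule tendsto_eventually)
        thus ?thesis by (simp only: True if_True refl)
      next
        case neq: False
        hence "real j - real k < 0" using False by simp
        thus ?thesis using neq tendsto_neg_powr[OF _ filterlim_real_sequentially] by simp
      qed
      from tendsto_mult[OF tendsto_mult_left[OF a_coeff_asymp[of "k + s"], of "c k"] this]
      show ?thesis by (simp only: if_distrib mult_1_right mult_zero_right)
    qed
    moreover have "eventually (\<lambda>n. c k * (a_coeff (k + s) n * real n powr (real (k + s) - 1/2)) * real n powr (real j - real k)
        = c k * a_coeff (k + s) n * real n powr (real (j + s) - 1/2)) sequentially"
      using eventually_gt_at_top[of 0]
      by eventually_elim (simp add: powr_add[symmetric] mult.assoc algebra_simps)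
    ultimately show "(\<lambda>n. c k * a_coeff (k + s) n * real n powr (real (j + s) - 1/2)) \<longlonglongrightarrow>
        (if k = j then c k * a_const (k + s) else 0)"
      by (rule Lim_transform_eventually)
  qed
  also have "(\<Sum>k=1..J. if k = j then c k * a_const (k + s) else 0) = c j * a_const (j + s)"
    using less.prems by simp
  finally have l1: "(\<lambda>n. (\<Sum>k=1..J. c k * a_coeff (k + s) n) * real n powr (real (j + s) - 1/2)) \<longlonglongrightarrow> c j * a_const (j + s)"
    by (simp add: sum_distrib_right)
  have l2: "(\<lambda>n. (\<Sum>k=1..J. c k * a_coeff (k + s) n) * real n powr (real (j + s) - 1/2)) \<longlonglongrightarrow> 0"
  proof (rule Lim_null_comparison[OF _ tendsto_rabs_zero[OF lim]])
    show "eventually (\<lambda>n. norm ((\<Sum>k=1..J. c k * a_coeff (k + s) n) * real n powr (real (j + s) - 1/2)) \<le>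
       \<bar>(\<Sum>j=1..J. c j * a_coeff (j + s) n) * real n powr (real (J + s) - 1/2)\<bar>) sequentially"
      using eventually_ge_at_top[of 1]
    proof eventually_elim
      case (elim n)
      have "real n powr (real (j + s) - 1/2) \<le> real n powr (real (J + s) - 1/2)"
        using elim less.prems by (intro powr_mono) auto
      thus ?case by (simp add: abs_mult mult_left_mono)
    qed
  qed
  from LIMSEQ_unique[OF l1 l2] show ?case using a_const_nonzero by simp
qed

text \<open>A common form for the tail expansion (\<open>s = 0\<close>) and the local ones
  (\<open>s = 1\<close>). The last kept term has order n^(1/2 - J - s) and the true error is n^(-J -
  s) times logarithms; the extra 1/4 absorbs the logarithms and still lies below 1/2.\<close>

definition expansion :: "nat \<Rightarrow> (nat \<Rightarrow> nat \<Rightarrow> real) \<Rightarrow> (nat \<Rightarrow> nat \<Rightarrow> real) \<Rightarrow> bool" where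
  "expansion s u c \<longleftrightarrow> (\<forall>J\<ge>2. \<exists>C D N. \<forall>n\<ge>N. \<forall>i.
     \<bar>u n i - (\<Sum>j=1..J. c j i * a_coeff (j + s) n)\<bar> \<le> C * (1 + real i) ^ D * real n powr (1/4 - real (J + s)))"

lemma expansionE:
  assumes "expansion s u c" "J \<ge> 2"
  obtains C D N where "C \<ge> 0" "\<And>n i. n \<ge> N \<Longrightarrow>
     \<bar>u n i - (\<Sum>j=1..J. c j i * a_coeff (j + s) n)\<bar> \<le> C * (1 + real i) ^ D * real n powr (1/4 - real (J + s))"
proof -
  from assms obtain C D N where *: "\<And>n i. n \<ge> N \<Longrightarrow>
     \<bar>u n i - (\<Sum>j=1..J. c j i * a_coeff (j + s) n)\<bar> \<le> C * (1 + real i) ^ D * real n powr (1/4 - real (J + s))"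
    unfolding expansion_def by blast
  have "\<bar>u n i - (\<Sum>j=1..J. c j i * a_coeff (j + s) n)\<bar> \<le> \<bar>C\<bar> * (1 + real i) ^ D * real n powr (1/4 - real (J + s))"
    if "n \<ge> N" for n i
    by (rule order.trans[OF *[OF that]]) (intro mult_right_mono; simp)
  thus ?thesis by (intro that[of "\<bar>C\<bar>" N D]) auto
qed

lemma expansion_residual_poly_bounded:
  assumes "expansion s u c" "J \<ge> 2"
  obtains N where "\<And>n. n \<ge> N \<Longrightarrow> poly_bounded (\<lambda>i. u n i - (\<Sum>j=1..J. c j i * a_coeff (j + s) n))"
proof -
  obtain C D N where *: "C \<ge> 0" "\<And>n i. n \<ge> N \<Longrightarrow>
     \<bar>u n i - (\<Sum>j=1..J. c j i * a_coeff (j + s) n)\<bar> \<le> C * (1 + real i) ^ D * real n powr (1/4 - real (J + s))"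
    by (rule expansionE[OF assms]) (rule that; assumption)
  have "poly_bounded (\<lambda>i. u n i - (\<Sum>j=1..J. c j i * a_coeff (j + s) n))" if "n \<ge> N" for n
    unfolding poly_bounded_def
    by (rule exI[of _ "C * real n powr (1/4 - real (J + s))"], rule exI[of _ D]) (use *(2)[OF that] in \<open>simp add: mult_ac\<close>)
  thus ?thesis using that by blast
qed

lemma a_coeff_eventually_nonzero: "eventually (\<lambda>n. a_coeff j n \<noteq> 0) sequentially"
  using tendsto_imp_eventually_ne[OF a_coeff_asymp a_const_nonzero[of j]]
  by (rule eventually_mono) auto

text \<open>Uniformity in the space variable is exploited at a fixed time. For
  \<open>j \<ge> 3\<close> the residuals of two consecutive orders differ by the j-th term alone.
  Since orders start at 2, the first two coefficients appear only in combination and are separated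
  by using two times.\<close>

lemma expansion_coeff_poly_bounded:
  assumes e: "expansion s u c" and u: "\<And>n. poly_bounded (u n)" and j: "j \<ge> 1"
  shows "poly_bounded (c j)"
proof (cases "j \<ge> 3")
  case True
  define J where "J = j - 1"
  have J: "J \<ge> 2" "j = Suc J" using True by (auto simp: J_def)
  obtain N where N: "\<And>n. n \<ge> N \<Longrightarrow> poly_bounded (\<lambda>i. u n i - (\<Sum>j=1..J. c j i * a_coeff (j + s) n))"
    by (rule expansion_residual_poly_bounded[OF e J(1)]) (rule that; assumption)
  obtain N' where N': "\<And>n. n \<ge> N' \<Longrightarrow> poly_bounded (\<lambda>i. u n i - (\<Sum>j=1..Suc J. c j i * a_coeff (j + s) n))"
    by (rule expansion_residual_poly_bounded[OF e le_SucI[OF J(1)]]) (rule that; assumption)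
  from eventually_happens'[OF sequentially_bot eventually_conj[OF a_coeff_eventually_nonzero[of "j + s"] eventually_ge_at_top[of "max N N'"]]]
  obtain n where n: "a_coeff (j + s) n \<noteq> 0" "n \<ge> N" "n \<ge> N'" by auto
  from poly_bounded_cmult[OF poly_bounded_diff[OF N[OF n(2)] N'[OF n(3)]], of "1 / a_coeff (j + s) n"] n(1)
  show ?thesis by (simp add: J(2))
next
  case False
  obtain N where N: "\<And>n. n \<ge> N \<Longrightarrow> poly_bounded (\<lambda>i. u n i - (\<Sum>j=1..2. c j i * a_coeff (j + s) n))"
    by (rule expansion_residual_poly_bounded[OF e order.refl]) (rule that; assumption)
  \<comment> \<open>The numerator of the ratio of the first two scale coefficients. After rescaling,
    the combination is affine in \<open>n\<close>, so consecutive times differ by exactly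
    \<open>c 1\<close>.\<close>
  define b where "b = real s + 1/2"
  have lin: "poly_bounded (\<lambda>i. c 1 i * (b - real n) + c 2 i * b)"
    if n: "n \<ge> N" "a_coeff (1 + s) n \<noteq> 0" for n
  proof -
    have ratio: "(b - real n) * a_coeff (2 + s) n = b * a_coeff (1 + s) n"
      using a_coeff_ratio[of "1 + s" n] by (simp add: b_def add.commute)
    have "poly_bounded (\<lambda>i. c 1 i * a_coeff (1 + s) n + c 2 i * a_coeff (2 + s) n)"
      using poly_bounded_diff[OF u[of n] N[OF n(1)]] by (simp add: numeral_2_eq_2)
    from poly_bounded_cmult[OF this, of "(b - real n) / a_coeff (1 + s) n"]
    have "poly_bounded (\<lambda>i. (b - real n) / a_coeff (1 + s) n * (c 1 i * a_coeff (1 + s) n + c 2 i * a_coeff (2 + s) n))" .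
    also have "(\<lambda>i. (b - real n) / a_coeff (1 + s) n * (c 1 i * a_coeff (1 + s) n + c 2 i * a_coeff (2 + s) n)) =
        (\<lambda>i. c 1 i * (b - real n) + c 2 i * ((b - real n) * a_coeff (2 + s) n) / a_coeff (1 + s) n)"
      using n(2) by (auto simp: field_simps)
    also have "\<dots> = (\<lambda>i. c 1 i * (b - real n) + c 2 i * b)"
      unfolding ratio using n(2) by auto
    finally show ?thesis .
  qed
  obtain M where M: "\<And>n. n \<ge> M \<Longrightarrow> a_coeff (1 + s) n \<noteq> 0"
    using a_coeff_eventually_nonzero[of "1 + s"] by (auto simp: eventually_sequentially)
  define n where "n = max M N"
  have l1: "poly_bounded (\<lambda>i. c 1 i * (b - real n) + c 2 i * b)"
    and l2: "poly_bounded (\<lambda>i. c 1 i * (b - real (Suc n)) + c 2 i * b)"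
    by (intro lin M; simp add: n_def)+
  have c1: "poly_bounded (c 1)"
    using poly_bounded_diff[OF l1 l2] by (simp add: algebra_simps)
  have "b > 0" by (simp add: b_def)
  hence c2: "poly_bounded (c 2)"
    using poly_bounded_cmult[OF poly_bounded_diff[OF l1 poly_bounded_cmult[OF c1, of "b - real n"]], of "1 / b"]
    by (simp add: algebra_simps)
  have "j = 1 \<or> j = 2" using False j by auto
  thus ?thesis using c1 c2 by auto
qed

text \<open>The source of the sign of the first coefficient: when the \<open>u n i\<close> are
  probabilities, the limit is nonnegative.\<close>

lemma expansion_first_coeff:
  assumes e: "expansion s u c"
  shows "(\<lambda>n. u n i * real n powr (real s + 1/2)) \<longlonglongrightarrow> c 1 i * a_const (1 + s)"
proof -
  obtain C D N where C: "C \<ge> 0" "\<And>n i. n \<ge> N \<Longrightarrow>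
     \<bar>u n i - (\<Sum>j=1..2. c j i * a_coeff (j + s) n)\<bar> \<le> C * (1 + real i) ^ D * real n powr (1/4 - real (2 + s))"
    by (rule expansionE[OF e order.refl]) (rule that; assumption)
  define K where "K = C * (1 + real i) ^ D"
  define r where "r n = u n i - (c 1 i * a_coeff (1 + s) n + c 2 i * a_coeff (2 + s) n)" for n
  have "(\<lambda>n. r n * real n powr (real s + 1/2)) \<longlonglongrightarrow> 0"
  proof (rule Lim_null_comparison)
    show "eventually (\<lambda>n. norm (r n * real n powr (real s + 1/2)) \<le> K * real n powr (-5/4)) sequentially"
      using eventually_ge_at_top[of "max N 1"]
    proof eventually_elim
      case (elim n)
      have "\<bar>r n\<bar> \<le> K * real n powr (1/4 - real (2 + s))"
        using C(2)[of n i] elim by (simp add: r_def K_def numeral_2_eq_2)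
      hence "\<bar>r n\<bar> * real n powr (real s + 1/2) \<le> K * real n powr (1/4 - real (2 + s)) * real n powr (real s + 1/2)"
        by (intro mult_right_mono) auto
      also have "\<dots> = K * (real n powr (1/4 - real (2 + s)) * real n powr (real s + 1/2))"
        by simp
      also have "real n powr (1/4 - real (2 + s)) * real n powr (real s + 1/2) = real n powr (-5/4)"
        by (subst powr_add[symmetric]) simp
      finally show ?case by (simp add: abs_mult)
    qed
    show "(\<lambda>n. K * real n powr (-5/4)) \<longlonglongrightarrow> 0" by real_asymp
  qed
  moreover have "(\<lambda>n. c 2 i * (a_coeff (2 + s) n * real n powr (real (2 + s) - 1/2)) * real n powr (-1)) \<longlonglongrightarrow> c 2 i * a_const (2 + s) * 0"
  proof (intro tendsto_mult tendsto_const a_coeff_asymp)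
    show "(\<lambda>n. real n powr (-1)) \<longlonglongrightarrow> 0" by real_asymp
  qed
  moreover have "(\<lambda>n. c 1 i * (a_coeff (1 + s) n * real n powr (real (1 + s) - 1/2))) \<longlonglongrightarrow> c 1 i * a_const (1 + s)"
    by (intro tendsto_mult tendsto_const a_coeff_asymp)
  ultimately have "(\<lambda>n. r n * real n powr (real s + 1/2) +
      c 2 i * (a_coeff (2 + s) n * real n powr (real (2 + s) - 1/2)) * real n powr (-1) +
      c 1 i * (a_coeff (1 + s) n * real n powr (real (1 + s) - 1/2))) \<longlonglongrightarrow> 0 + c 2 i * a_const (2 + s) * 0 + c 1 i * a_const (1 + s)"
    by (intro tendsto_add)
  moreover have "real n powr (real (2 + s) - 1/2) * real n powr (-1) = real n powr (real s + 1/2)" for n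
    by (subst powr_add[symmetric]) (simp add: add.commute)
  hence "c 2 i * (a_coeff (2 + s) n * real n powr (real (2 + s) - 1/2)) * real n powr (-1) =
      c 2 i * a_coeff (2 + s) n * real n powr (real s + 1/2)" for n
    by (simp only: mult.assoc)
  moreover have "real (1 + s) - 1/2 = real s + 1/2" by simp
  ultimately show ?thesis
    by (simp add: r_def algebra_simps)
qed

text \<open>Without its first term the expansion consists of a term of order n^(-s - 3/2) and an
  error of order n^(-s - 7/4); both fit below the exponent used here.\<close>

lemma expansion_small:
  assumes e: "expansion s u c" and pb: "poly_bounded (c 2)" and z: "\<And>i. c 1 i = 0"
  obtains C D N where "\<And>n i. n \<ge> N \<Longrightarrow> \<bar>u n i\<bar> \<le> C * (1 + real i) ^ D * real n powr (- real s - 5/4)"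
proof -
  obtain C D N where C: "C \<ge> 0" "\<And>n i. n \<ge> N \<Longrightarrow>
     \<bar>u n i - (\<Sum>j=1..2. c j i * a_coeff (j + s) n)\<bar> \<le> C * (1 + real i) ^ D * real n powr (1/4 - real (2 + s))"
    by (rule expansionE[OF e order.refl]) (rule that; assumption)
  obtain C2 D2 where C2: "C2 \<ge> 0" "\<And>i. \<bar>c 2 i\<bar> \<le> C2 * (1 + real i) ^ D2"
    using poly_boundedE[OF pb] by blast
  obtain A where A: "\<And>n. \<bar>a_coeff (2 + s) n * real n powr (real (2 + s) - 1/2)\<bar> \<le> A"
    using convergent_imp_Bseq[OF convergentI[OF a_coeff_asymp[of "2 + s"]]] by (auto simp: Bseq_def)
  have A0: "A \<ge> 0" using A[of 0] by linarith
  have "\<bar>u n i\<bar> \<le> (C + C2 * A) * (1 + real i) ^ max D D2 * real n powr (- real s - 5/4)" if n: "n \<ge> max N 1" for n i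
  proof -
    define m where "m = (1 + real i) ^ max D D2"
    have m: "(1 + real i) ^ D \<le> m" "(1 + real i) ^ D2 \<le> m" "m \<ge> 0" unfolding m_def
      by (intro power_increasing; simp)+ simp
    have "\<bar>u n i - c 2 i * a_coeff (2 + s) n\<bar> \<le> C * (1 + real i) ^ D * real n powr (1/4 - real (2 + s))"
      using C(2)[of n i] n by (simp add: z[unfolded One_nat_def] numeral_2_eq_2)
    also have "\<dots> \<le> C * m * real n powr (- real s - 5/4)"
      using n m C by (intro mult_mono powr_mono) auto
    finally have 1: "\<bar>u n i - c 2 i * a_coeff (2 + s) n\<bar> \<le> C * m * real n powr (- real s - 5/4)" .
    have "\<bar>a_coeff (2 + s) n\<bar> \<le> A * real n powr (- real s - 5/4)"
    proof -
      have "\<bar>a_coeff (2 + s) n\<bar> = \<bar>a_coeff (2 + s) n * real n powr (real (2 + s) - 1/2)\<bar> * real n powr - (real (2 + s) - 1/2)"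
      proof -
        have "real n powr (real (2 + s) - 1/2) * real n powr - (real (2 + s) - 1/2) = 1"
          using n by (subst powr_add[symmetric]) simp
        thus ?thesis
          by (simp only: abs_mult abs_of_nonneg[OF powr_ge_zero] mult.assoc mult_1_right)
      qed
      also have "\<dots> \<le> A * real n powr (- real s - 5/4)"
        using A n A0 by (intro mult_mono powr_mono) auto
      finally show ?thesis .
    qed
    hence "\<bar>c 2 i\<bar> * \<bar>a_coeff (2 + s) n\<bar> \<le> (C2 * m) * (A * real n powr (- real s - 5/4))"
      using C2 m A0 by (intro mult_mono order.trans[OF C2(2)] mult_left_mono) auto
    hence 2: "\<bar>c 2 i * a_coeff (2 + s) n\<bar> \<le> C2 * A * m * real n powr (- real s - 5/4)"
      by (simp add: abs_mult mult_ac)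
    have "\<bar>u n i\<bar> \<le> C * m * real n powr (- real s - 5/4) + C2 * A * m * real n powr (- real s - 5/4)"
      using 1 2 by linarith
    thus ?thesis by (simp add: m_def algebra_simps)
  qed
  thus ?thesis using that by blast
qed

section \<open>Linearity of the killed operator and the recursion for the coefficients\<close>

lemma zext_diff: "zext (\<lambda>i. f i - g i) x = zext f x - zext g x"
  by (simp add: zext_def)

lemma zext_cmult: "zext (\<lambda>i. a * f i) x = a * zext f x"
  by (simp add: zext_def)

lemma zext_sum: "zext (\<lambda>i. \<Sum>j\<in>A. f j i) x = (\<Sum>j\<in>A. zext (f j) x)"
  by (simp add: zext_def)

lemma zconv_cmult: "zconv q (\<lambda>i. a * f i) x = a * zconv q f x"
  by (simp add: zconv_def zext_cmult)

context exp_moment_pmf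
begin

lemma zconv_diff:
  assumes "poly_bounded f" "poly_bounded g"
  shows "zconv q (\<lambda>i. f i - g i) x = zconv q f x - zconv q g x"
  unfolding zconv_def zext_diff using assms
  by (intro Bochner_Integration.integral_diff integrable_zext)

lemma zconv_sum:
  assumes "\<And>j. j \<in> A \<Longrightarrow> poly_bounded (f j)"
  shows "zconv q (\<lambda>i. \<Sum>j\<in>A. f j i) x = (\<Sum>j\<in>A. zconv q (f j) x)"
  unfolding zconv_def zext_sum using assms
  by (intro Bochner_Integration.integral_sum integrable_zext)

lemma zconv_abs_le:
  assumes "poly_bounded g" "poly_bounded f" "\<And>i. \<bar>f i\<bar> \<le> g i"
  shows "\<bar>zconv q f x\<bar> \<le> zconv q g x"
proof -
  have "zconv q f x \<le> zconv q g x"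
    by (rule zconv_mono) (use assms(3) in \<open>auto simp: abs_le_iff intro: assms\<close>)
  moreover have "zconv q (\<lambda>i. - 1 * f i) x \<le> zconv q g x"
    by (rule zconv_mono[OF poly_bounded_cmult]) (use assms(3) in \<open>auto simp: abs_le_iff intro: assms\<close>)
  ultimately show ?thesis unfolding zconv_cmult by linarith
qed

text \<open>The operator is applied to the expansion at time n and the result is compared with the
  expansion at time n + 1. The residual survives the operator because its bound is a power of n
  times a polynomial weight with finite image. Independence of the scale then allows comparison of
  coefficients.\<close>

lemma expansion_recursion:
  assumes e: "expansion s u c" and u: "\<And>n. poly_bounded (u n)"
    and rec: "\<And>n i. n \<ge> N0 \<Longrightarrow> u (Suc n) i = zconv q (u n) (int i)"
    and c0: "c 0 = (\<lambda>_. 0)" and k: "k \<ge> 1"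
  shows "c k i = zconv q (c k) (int i) - zconv q (c (k - 1)) (int i)"
proof -
  define J where "J = max 2 k"
  have J: "J \<ge> 2" "k \<in> {1..J}" using k by (auto simp: J_def)
  obtain C D N where C: "C \<ge> 0" "\<And>n i. n \<ge> N \<Longrightarrow>
     \<bar>u n i - (\<Sum>j=1..J. c j i * a_coeff (j + s) n)\<bar> \<le> C * (1 + real i) ^ D * real n powr (1/4 - real (J + s))"
    by (rule expansionE[OF e J(1)]) (rule that; assumption)
  have cpb: "poly_bounded (c j)" if "j \<ge> 1" for j
    by (rule expansion_coeff_poly_bounded[OF e u that])
  have cpb': "poly_bounded (\<lambda>i. c j i * a)" if "j \<ge> 1" for j a
    using poly_bounded_cmult[OF cpb[OF that], of a] by (simp only: mult.commute[of a])
  define t where "t j = zconv q (c j) (int i)" for j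
  have t0: "t 0 = 0" by (simp add: t_def c0)
  \<comment> \<open>The defect of the claimed recursion at index \<open>j\<close>; all defects are
    shown to vanish at once.\<close>
  define d where "d j = t j - t (j - 1) - c j i" for j
  define \<rho> where "\<rho> n y = u n y - (\<Sum>j=1..J. c j y * a_coeff (j + s) n)" for n y
  have \<rho>pb: "poly_bounded (\<rho> n)" for n
    unfolding \<rho>_def[abs_def]
    by (intro poly_bounded_diff u poly_bounded_sum cpb') simp
  define w where "w y = (1 + real y) ^ D" for y
  have wpb: "poly_bounded w" unfolding poly_bounded_def w_def by (intro exI[of _ 1] exI[of _ D]) auto
  define E where "E = zconv q w (int i)"
  define e where "e = real (J + s)"
  have conv\<rho>: "\<bar>zconv q (\<rho> n) (int i)\<bar> \<le> (C * E) * real n powr (1/4 - e)" if "n \<ge> N" for n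
  proof -
    have "\<bar>zconv q (\<rho> n) (int i)\<bar> \<le> zconv q (\<lambda>y. (C * real n powr (1/4 - e)) * w y) (int i)"
      by (intro zconv_abs_le poly_bounded_cmult wpb \<rho>pb)
         (use C(2)[OF that] in \<open>simp add: \<rho>_def w_def e_def mult_ac\<close>)
    thus ?thesis unfolding zconv_cmult E_def by (simp only: mult_ac)
  qed
  have key: "(\<Sum>j=1..J. d j * a_coeff (j + s) (Suc n)) =
      \<rho> (Suc n) i - zconv q (\<rho> n) (int i) + t J * a_coeff (Suc J + s) (Suc n)" if n: "n \<ge> N0" for n
  proof -
    have "zconv q (\<rho> n) (int i) = zconv q (u n) (int i) - zconv q (\<lambda>y. \<Sum>j=1..J. a_coeff (j + s) n * c j y) (int i)"
      unfolding \<rho>_def[abs_def]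
      by (subst zconv_diff[symmetric]) (auto intro!: u poly_bounded_sum poly_bounded_cmult cpb cpb' simp: mult.commute)
    also have "zconv q (\<lambda>y. \<Sum>j=1..J. a_coeff (j + s) n * c j y) (int i) = (\<Sum>j=1..J. a_coeff (j + s) n * t j)"
      by (subst zconv_sum) (auto intro!: poly_bounded_cmult cpb simp: zconv_cmult t_def)
    \<comment> \<open>Summation by parts moves the scale from time n to n + 1. The boundary term at
      index \<open>J + 1\<close> is one order smaller than the last kept term.\<close>
    also have "(\<Sum>j=1..J. a_coeff (j + s) n * t j) =
        (\<Sum>j=1..J. (t j - t (j - 1)) * a_coeff (j + s) (Suc n)) - t J * a_coeff (Suc J + s) (Suc n)"
    proof (induction J)
      case 0
      show ?case by (simp add: t0)
    next
      case (Suc J)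
      have "a_coeff (Suc J + s) n = a_coeff (Suc J + s) (Suc n) - a_coeff (Suc (Suc J) + s) (Suc n)"
        using a_coeff_Suc[of "Suc J + s" n] by simp
      moreover have "(\<Sum>j=1..Suc J. f j) = (\<Sum>j=1..J. f j) + f (Suc J)" for f :: "nat \<Rightarrow> real" by simp
      ultimately show ?case using Suc.IH by (simp only:) (simp add: algebra_simps)
    qed
    finally have z: "zconv q (\<rho> n) (int i) = zconv q (u n) (int i) -
        ((\<Sum>j=1..J. (t j - t (j - 1)) * a_coeff (j + s) (Suc n)) - t J * a_coeff (Suc J + s) (Suc n))" .
    have "(\<Sum>j=1..J. d j * a_coeff (j + s) (Suc n)) =
        (\<Sum>j=1..J. (t j - t (j - 1)) * a_coeff (j + s) (Suc n)) - (\<Sum>j=1..J. c j i * a_coeff (j + s) (Suc n))"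
      by (simp add: d_def left_diff_distrib sum_subtractf)
    thus ?thesis using z rec[OF n, of i] by (simp add: \<rho>_def)
  qed
  have "(\<lambda>n. (\<Sum>j=1..J. d j * a_coeff (j + s) (Suc n)) * real (Suc n) powr (real (J + s) - 1/2)) \<longlonglongrightarrow> 0"
  proof -
    have l1: "(\<lambda>n. \<rho> (Suc n) i * real (Suc n) powr (e - 1/2)) \<longlonglongrightarrow> 0"
    proof (rule Lim_null_comparison)
      show "eventually (\<lambda>n. norm (\<rho> (Suc n) i * real (Suc n) powr (e - 1/2)) \<le> (C * w i) * real (Suc n) powr (- 1/4)) sequentially"
        using eventually_ge_at_top[of N]
      proof eventually_elim
        case (elim n)
        have "\<bar>\<rho> (Suc n) i\<bar> * real (Suc n) powr (e - 1/2) \<le> (C * w i * real (Suc n) powr (1/4 - e)) * real (Suc n) powr (e - 1/2)"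
          using C(2)[of "Suc n" i] elim by (intro mult_right_mono) (auto simp: \<rho>_def w_def e_def)
        also have "\<dots> = C * w i * (real (Suc n) powr (1/4 - e) * real (Suc n) powr (e - 1/2))"
          by (simp only: mult.assoc)
        also have "real (Suc n) powr (1/4 - e) * real (Suc n) powr (e - 1/2) = real (Suc n) powr (- 1/4)"
          by (subst powr_add[symmetric]) simp
        finally show ?case by (simp add: abs_mult)
      qed
      show "(\<lambda>n. (C * w i) * real (Suc n) powr (- 1/4)) \<longlonglongrightarrow> 0" by real_asymp
    qed
    have l2: "(\<lambda>n. zconv q (\<rho> n) (int i) * real (Suc n) powr (e - 1/2)) \<longlonglongrightarrow> 0"
    proof (rule Lim_null_comparison)
      \<comment> \<open>This makes the exponent e - 1/2 positive, so n + 1 \<le> 2n transfers the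
        scaling from time n + 1 to time n.\<close>
      have e2: "e \<ge> 2" using J by (simp add: e_def)
      show "eventually (\<lambda>n. norm (zconv q (\<rho> n) (int i) * real (Suc n) powr (e - 1/2)) \<le> (C * E * 2 powr (e - 1/2)) * real n powr (- 1/4)) sequentially"
        using eventually_ge_at_top[of "max N 1"]
      proof eventually_elim
        case (elim n)
        have "real (Suc n) powr (e - 1/2) \<le> (2 * real n) powr (e - 1/2)"
          using elim e2 by (intro powr_mono2) auto
        also have "\<dots> = 2 powr (e - 1/2) * real n powr (e - 1/2)" by (simp add: powr_mult)
        finally have S: "real (Suc n) powr (e - 1/2) \<le> 2 powr (e - 1/2) * real n powr (e - 1/2)" .
        have c\<rho>: "\<bar>zconv q (\<rho> n) (int i)\<bar> \<le> (C * E) * real n powr (1/4 - e)" using elim by (intro conv\<rho>) auto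
        have "\<bar>zconv q (\<rho> n) (int i)\<bar> * real (Suc n) powr (e - 1/2) \<le>
            ((C * E) * real n powr (1/4 - e)) * (2 powr (e - 1/2) * real n powr (e - 1/2))"
          by (rule mult_mono[OF c\<rho> S]) (use order.trans[OF abs_ge_zero c\<rho>] in auto)
        also have "\<dots> = C * E * 2 powr (e - 1/2) * (real n powr (1/4 - e) * real n powr (e - 1/2))"
          by (simp only: mult_ac)
        also have "real n powr (1/4 - e) * real n powr (e - 1/2) = real n powr (- 1/4)"
          by (subst powr_add[symmetric]) simp
        finally show ?case by (simp add: abs_mult)
      qed
      show "(\<lambda>n. (C * E * 2 powr (e - 1/2)) * real n powr (- 1/4)) \<longlonglongrightarrow> 0" by real_asymp
    qed
    have l3: "(\<lambda>n. t J * (a_coeff (Suc J + s) (Suc n) * real (Suc n) powr (real (Suc J + s) - 1/2)) * real (Suc n) powr (-1)) \<longlonglongrightarrow> t J * a_const (Suc J + s) * 0"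
    proof (intro tendsto_mult tendsto_const)
      show "(\<lambda>n. a_coeff (Suc J + s) (Suc n) * real (Suc n) powr (real (Suc J + s) - 1/2)) \<longlonglongrightarrow> a_const (Suc J + s)"
        by (rule LIMSEQ_Suc[OF a_coeff_asymp])
      show "(\<lambda>n. real (Suc n) powr (-1)) \<longlonglongrightarrow> 0" by real_asymp
    qed
    have e3: "t J * (a_coeff (Suc J + s) (Suc n) * real (Suc n) powr (real (Suc J + s) - 1/2)) * real (Suc n) powr (-1)
        = t J * a_coeff (Suc J + s) (Suc n) * real (Suc n) powr (e - 1/2)" for n
    proof -
      have "real (Suc n) powr (real (Suc J + s) - 1/2) * real (Suc n) powr (-1) = real (Suc n) powr (e - 1/2)"
        by (subst powr_add[symmetric]) (simp add: e_def)
      thus ?thesis by (simp only: mult.assoc)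
    qed
    have "(\<lambda>n. \<rho> (Suc n) i * real (Suc n) powr (e - 1/2) - zconv q (\<rho> n) (int i) * real (Suc n) powr (e - 1/2)
             + t J * a_coeff (Suc J + s) (Suc n) * real (Suc n) powr (e - 1/2)) \<longlonglongrightarrow> 0 - 0 + t J * a_const (Suc J + s) * 0"
      using l3 unfolding e3 by (intro tendsto_add tendsto_diff l1 l2)
    hence lim: "(\<lambda>n. (\<rho> (Suc n) i - zconv q (\<rho> n) (int i) + t J * a_coeff (Suc J + s) (Suc n)) * real (Suc n) powr (e - 1/2)) \<longlonglongrightarrow> 0"
      by (simp only: left_diff_distrib distrib_right diff_self mult_zero_right add_0_left)
    have "eventually (\<lambda>n. (\<rho> (Suc n) i - zconv q (\<rho> n) (int i) + t J * a_coeff (Suc J + s) (Suc n)) * real (Suc n) powr (e - 1/2)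
        = (\<Sum>j=1..J. d j * a_coeff (j + s) (Suc n)) * real (Suc n) powr (real (J + s) - 1/2)) sequentially"
      using eventually_ge_at_top[of N0] by eventually_elim (simp only: key e_def)
    from Lim_transform_eventually[OF lim this] show ?thesis .
  qed
  hence "(\<lambda>n. (\<Sum>j=1..J. d j * a_coeff (j + s) n) * real n powr (real (J + s) - 1/2)) \<longlonglongrightarrow> 0"
    by (rule LIMSEQ_imp_Suc)
  hence "d k = 0" using J(2) by (rule a_coeff_unique)
  thus ?thesis by (simp add: d_def t_def)
qed

end

context centered_pmf
begin

text \<open>The assumption \<open>large\<close> is the nonvanishing of the first coefficient in
  contrapositive form: a zero first coefficient would produce exactly the bound it refutes.\<close>

theorem expansion_coeffs_asymptotics:
  assumes e: "expansion s u c" and u: "\<And>n i. 0 \<le> u n i" "\<And>n i. u n i \<le> 1"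
    and rec: "\<And>n i. n \<ge> N0 \<Longrightarrow> u (Suc n) i = zconv q (u n) (int i)"
    and large: "\<And>N C D. (\<And>n i. n \<ge> N \<Longrightarrow> u n i \<le> C * (1 + real i) ^ D * real n powr (- real s - 5/4)) \<Longrightarrow> False"
    and k: "k \<ge> 1"
  shows "\<exists>P C r. degree P = 2 * k - 1 \<and> 0 < r \<and> r < 1 \<and> (\<forall>i. \<bar>c k i - poly P (real i)\<bar> \<le> C * r ^ i)"
proof -
  \<comment> \<open>The given family has an arbitrary value at index 0, while the recursion for k =
    1 refers to it; it is reset to 0.\<close>
  define b where "b j = (if j = 0 then (\<lambda>_. 0) else c j)" for j
  define a where "a = a_const (1 + s)"
  have a: "a \<noteq> 0" using a_const_nonzero by (simp add: a_def)
  have upb: "poly_bounded (u n)" for n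
    by (rule poly_bounded_bounded[of _ 1]) (use u[of n] in auto)
  have eb: "expansion s u b"
  proof -
    have "(\<Sum>j=1..J. b j i * a_coeff (j + s) n) = (\<Sum>j=1..J. c j i * a_coeff (j + s) n)" for J i n
      by (intro sum.cong) (auto simp: b_def)
    thus ?thesis using e unfolding expansion_def by presburger
  qed
  have bpb: "poly_bounded (b j)" for j
    using expansion_coeff_poly_bounded[OF eb upb, of j]
    by (cases "j = 0") (auto simp: b_def intro: poly_bounded_bounded[of _ 0])
  have b0: "b 0 = (\<lambda>_. 0)" by (simp add: b_def)
  have nn: "0 \<le> a * b 1 i" for i
  proof -
    have "0 \<le> b 1 i * a_const (1 + s)"
      by (rule LIMSEQ_le_const[OF expansion_first_coeff[OF eb]]) (use u(1) in auto)
    thus ?thesis by (simp add: a_def mult.commute)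
  qed
  have "\<exists>j. b 1 j \<noteq> 0"
  proof (rule ccontr)
    assume "\<not> (\<exists>j. b 1 j \<noteq> 0)"
    hence z: "\<And>i. b 1 i = 0" by blast
    obtain C D N where "\<And>n i. n \<ge> N \<Longrightarrow> \<bar>u n i\<bar> \<le> C * (1 + real i) ^ D * real n powr (- real s - 5/4)"
      by (rule expansion_small[OF eb bpb z]) (rule that; assumption)
    hence "\<And>n i. n \<ge> N \<Longrightarrow> u n i \<le> C * (1 + real i) ^ D * real n powr (- real s - 5/4)"
      using u(1) by (metis abs_of_nonneg)
    thus False by (rule large)
  qed
  then obtain j where j: "b 1 j \<noteq> 0" by blast
  have "\<exists>P C r. degree P = 2 * k - 1 \<and> 0 < r \<and> r < 1 \<and> (\<forall>i. \<bar>a * b k i - poly P (real i)\<bar> \<le> C * r ^ i)"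
  proof (rule recursive_family_asymptotics[of "\<lambda>k i. a * b k i"])
    show "poly_bounded (\<lambda>i. a * b k i)" for k by (rule poly_bounded_cmult[OF bpb])
    show "a * b (Suc j) i = zconv q (\<lambda>i. a * b (Suc j) i) (int i) - zconv q (\<lambda>i. a * b j i) (int i)" for j i
      unfolding zconv_cmult right_diff_distrib[symmetric]
      using expansion_recursion[OF eb upb rec b0, of N0 "Suc j" i] by simp
  qed (use nn j a k in \<open>auto simp: b0\<close>)
  then obtain P C r where P: "degree P = 2 * k - 1" "0 < r" "r < 1"
    "\<And>i. \<bar>a * b k i - poly P (real i)\<bar> \<le> C * r ^ i" by blast
  have "\<bar>c k i - poly (smult (1 / a) P) (real i)\<bar> \<le> C / \<bar>a\<bar> * r ^ i" for i
  proof -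
    have "\<bar>c k i - poly (smult (1 / a) P) (real i)\<bar> = \<bar>a * b k i - poly P (real i)\<bar> / \<bar>a\<bar>"
      using a k by (simp add: b_def abs_divide[symmetric] diff_divide_distrib)
    also have "\<dots> \<le> (C * r ^ i) / \<bar>a\<bar>" by (intro divide_right_mono P) auto
    finally show ?thesis by simp
  qed
  moreover have "degree (smult (1 / a) P) = 2 * k - 1" using a P(1) by simp
  ultimately show ?thesis using P(2,3) by blast
qed

end

section \<open>Finite-dimensional laws of the walk\<close>

lemma pmf_replicate_pmf:
  "pmf (replicate_pmf n q) ms = (if length ms = n then \<Prod>k<n. pmf q (ms ! k) else 0)"
proof (induction n arbitrary: ms)
  case 0
  show ?case by (auto simp: indicator_def)
next
  case (Suc n)
  show ?case
  proof (cases ms)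
    case Nil
    have "ms \<notin> set_pmf (replicate_pmf (Suc n) q)"
      using Nil by (auto simp: set_replicate_pmf)
    thus ?thesis using Nil by (simp add: set_pmf_iff del: replicate_pmf.simps)
  next
    case (Cons a as)
    have "replicate_pmf (Suc n) q = map_pmf (\<lambda>(x, xs). x # xs) (pair_pmf q (replicate_pmf n q))"
      by (simp add: pair_pmf_def map_bind_pmf map_pmf_def bind_assoc_pmf bind_return_pmf)
    moreover have "ms = (\<lambda>(x, xs). x # xs) (a, as)" using Cons by simp
    ultimately have "pmf (replicate_pmf (Suc n) q) ms = pmf (pair_pmf q (replicate_pmf n q)) (a, as)"
      using pmf_map_inj'[of "\<lambda>(x, xs). x # xs" "pair_pmf q (replicate_pmf n q)" "(a, as)"]
      by (auto simp: inj_on_def simp del: replicate_pmf.simps)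
    also have "\<dots> = pmf q a * (if length as = n then \<Prod>k<n. pmf q (as ! k) else 0)"
      by (simp add: pmf_pair Suc)
    finally show ?thesis using Cons
      by (auto simp: prod.lessThan_Suc_shift simp del: replicate_pmf.simps prod.lessThan_Suc)
  qed
qed

lemma prob_replicate_pmf_Suc:
  "measure_pmf.prob (replicate_pmf (Suc n) q) A =
     measure_pmf.expectation q (\<lambda>m. measure_pmf.prob (replicate_pmf n q) {ms. m # ms \<in> A})"
proof -
  have "emeasure (replicate_pmf (Suc n) q) A =
      (\<integral>\<^sup>+m. emeasure (replicate_pmf n q) {ms. m # ms \<in> A} \<partial>q)"
  proof -
    have "emeasure (bind_pmf (replicate_pmf n q) (\<lambda>xs. return_pmf (m # xs))) A =
        emeasure (replicate_pmf n q) {ms. m # ms \<in> A}" for m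
      by (simp add: map_pmf_def[symmetric] vimage_def)
    thus ?thesis by simp
  qed
  also have "\<dots> = ennreal (measure_pmf.expectation q (\<lambda>m. measure_pmf.prob (replicate_pmf n q) {ms. m # ms \<in> A}))"
    by (subst nn_integral_eq_integral[symmetric])
       (auto intro!: measure_pmf.integrable_const_bound[where B = 1] simp: measure_pmf.emeasure_eq_measure)
  finally show ?thesis
    by (simp add: measure_pmf.emeasure_eq_measure Bochner_Integration.integral_nonneg del: replicate_pmf.simps)
qed

lemma pmf_of_int_distr:
  assumes "prob_space D" "sets D = (UNIV :: 'b::countable set set)"
  obtains q where "measure_pmf q = D"
proof -
  interpret prob_space D by fact
  have "AE x in D. measure D {x} \<noteq> 0"
    using AE_support_countable[OF assms(2)] by (auto intro!: exI[of _ UNIV])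
  hence "measure_pmf (Abs_pmf D) = D"
    using assms by (intro Abs_pmf_inverse) auto
  thus ?thesis by (rule that)
qed

text \<open>The list \<open>js\<close> fixes the order in which the steps are read, and the law
  depends on its length only. A reversed list thus yields time reversal for free.\<close>

lemma (in prob_space) iid_prob_list:
  fixes Y :: "nat \<Rightarrow> 'a \<Rightarrow> 'b::countable"
  assumes ind: "indep_vars (\<lambda>_. count_space UNIV) Y I"
    and law: "\<And>i. i \<in> I \<Longrightarrow> distr M (count_space UNIV) (Y i) = measure_pmf q"
    and js: "distinct js" "set js \<subseteq> I"
  shows "{\<omega>\<in>space M. Q (map (\<lambda>i. Y i \<omega>) js)} \<in> events"
    and "prob {\<omega>\<in>space M. Q (map (\<lambda>i. Y i \<omega>) js)} = measure_pmf.prob (replicate_pmf (length js) q) {ms. Q ms}"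
proof -
  have rv: "Y i \<in> measurable M (count_space UNIV)" if "i \<in> I" for i
    using ind that by (auto simp: indep_vars_def)
  have pY: "prob (Y i -` {m} \<inter> space M) = pmf q m" if "i \<in> I" for i m
    using law[OF that] rv[OF that] measure_distr[of "Y i" M "count_space UNIV" "{m}"]
    by (simp add: measure_pmf_single)
  define L where "L \<omega> = map (\<lambda>i. Y i \<omega>) js" for \<omega>
  \<comment> \<open>The factor \<open>space M\<close> matters for \<open>js = []\<close>, where the
    intersection is \<open>UNIV\<close>.\<close>
  have Lsets: "L -` {ms} \<inter> space M = (if length ms = length js then space M \<inter> (\<Inter>k\<in>{..<length js}. Y (js ! k) -` {ms ! k} \<inter> space M) else {})" for ms
    by (auto simp: L_def list_eq_iff_nth_eq)
  have Lm1: "L -` {ms} \<inter> space M \<in> events" for ms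
  proof -
    have ev: "Y (js ! k) -` {ms ! k} \<inter> space M \<in> events" if "k < length js" for k
      using js that by (intro measurable_sets[OF rv]) (auto dest: nth_mem)
    have "space M \<inter> (\<Inter>k\<in>{..<length js}. Y (js ! k) -` {ms ! k} \<inter> space M) \<in> events"
    proof (cases "js = []")
      case False
      thus ?thesis using ev by (intro sets.Int[OF sets.top] sets.finite_INT) auto
    qed auto
    thus ?thesis unfolding Lsets by simp
  qed
  have Lm: "L \<in> measurable M (count_space UNIV)"
    by (rule measurable_count_space_eq_countable[THEN iffD2]) (use Lm1 in auto)
  have inj: "inj_on (\<lambda>k. js ! k) {..<length js}" using js(1) by (simp add: inj_on_nth)
  have "distr M (count_space UNIV) L = measure_pmf (replicate_pmf (length js) q)"
  proof (rule measure_eqI_countable[where A = UNIV])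
    fix ms
    have "prob (L -` {ms} \<inter> space M) = pmf (replicate_pmf (length js) q) ms"
    proof (cases "length ms = length js \<and> js \<noteq> []")
      case True
      \<comment> \<open>The position of an index in \<open>js\<close>; independence is stated over
        index sets, so positions have to be recovered.\<close>
      define pos where "pos i = (THE k. k < length js \<and> js ! k = i)" for i
      have pos: "pos (js ! k) = k" if "k < length js" for k
        unfolding pos_def using js(1) that by (intro the_equality) (auto simp: nth_eq_iff_index_eq)
      have "L -` {ms} \<inter> space M = (\<Inter>i\<in>set js. Y i -` {ms ! pos i} \<inter> space M)"
      proof -
        have "(\<Inter>i\<in>set js. Y i -` {ms ! pos i} \<inter> space M) =
            (\<Inter>i\<in>(\<lambda>k. js ! k) ` {..<length js}. Y i -` {ms ! pos i} \<inter> space M)"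
          by (rule arg_cong[of _ _ Inter], rule image_cong) (auto simp: set_conv_nth)
        also have "\<dots> = (\<Inter>k\<in>{..<length js}. Y (js ! k) -` {ms ! pos (js ! k)} \<inter> space M)"
          by (simp only: image_image)
        also have "\<dots> = (\<Inter>k\<in>{..<length js}. Y (js ! k) -` {ms ! k} \<inter> space M)"
          by (intro INF_cong refl) (simp add: pos)
        also have "\<dots> = space M \<inter> (\<Inter>k\<in>{..<length js}. Y (js ! k) -` {ms ! k} \<inter> space M)"
          using True by auto
        finally show ?thesis using True by (simp only: Lsets if_True refl)
      qed
      also have "prob \<dots> = (\<Prod>i\<in>set js. prob (Y i -` {ms ! pos i} \<inter> space M))"
        using True js by (intro indep_varsD[OF ind]) auto
      also have "\<dots> = (\<Prod>i\<in>set js. pmf q (ms ! pos i))"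
        using js by (intro prod.cong pY) auto
      also have "set js = (\<lambda>k. js ! k) ` {..<length js}" by (auto simp: set_conv_nth)
      also have "(\<Prod>i\<in>(\<lambda>k. js ! k) ` {..<length js}. pmf q (ms ! pos i)) = (\<Prod>k<length js. pmf q (ms ! k))"
        by (subst prod.reindex[OF inj]) (auto simp: pos)
      finally show ?thesis using True by (simp add: pmf_replicate_pmf)
    next
      case False
      thus ?thesis unfolding Lsets pmf_replicate_pmf by (auto simp: prob_space)
    qed
    thus "emeasure (distr M (count_space UNIV) L) {ms} = emeasure (measure_pmf (replicate_pmf (length js) q)) {ms}"
      by (simp add: emeasure_distr[OF Lm] emeasure_eq_measure emeasure_pmf_single)
  qed auto
  hence "measure_pmf.prob (replicate_pmf (length js) q) {ms. Q ms} = measure (distr M (count_space UNIV) L) {ms. Q ms}"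
    by simp
  also have "\<dots> = prob (L -` {ms. Q ms} \<inter> space M)"
    by (rule measure_distr[OF Lm]) auto
  also have eq: "L -` {ms. Q ms} \<inter> space M = {\<omega>\<in>space M. Q (map (\<lambda>i. Y i \<omega>) js)}"
    by (auto simp: L_def)
  finally show "prob {\<omega>\<in>space M. Q (map (\<lambda>i. Y i \<omega>) js)} = measure_pmf.prob (replicate_pmf (length js) q) {ms. Q ms}"
    by simp
  show "{\<omega>\<in>space M. Q (map (\<lambda>i. Y i \<omega>) js)} \<in> events"
    unfolding eq[symmetric] by (rule measurable_sets[OF Lm]) simp
qed

section \<open>Path predicates on step lists and their probabilities\<close>

fun alive :: "int \<Rightarrow> int list \<Rightarrow> bool" where
  "alive x [] = True"
| "alive x (m # ms) = (x + m > 0 \<and> alive (x + m) ms)"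

text \<open>The next two predicates read the steps backwards in time, the head of the list being the last
  step, so that the reflected walk started at the end point appears.\<close>

fun end_positive :: "int \<Rightarrow> int list \<Rightarrow> bool" where
  "end_positive x [] = (x = 0)"
| "end_positive x (m # ms) = (x > 0 \<and> end_positive (x - m) ms)"

fun end_nonneg :: "int \<Rightarrow> int list \<Rightarrow> bool" where
  "end_nonneg x [] = (x = 0)"
| "end_nonneg x (m # ms) = (x \<ge> 0 \<and> end_nonneg (x - m) ms)"

lemma alive_iff: "alive x ms \<longleftrightarrow> (\<forall>k\<in>{1..length ms}. x + sum_list (take k ms) > 0)"
proof (induction ms arbitrary: x)
  case (Cons m ms)
  have S: "{1..length (m # ms)} = insert 1 (Suc ` {1..length ms})"
    by (auto simp: image_Suc_atLeastAtMost)
  have "(\<forall>k\<in>{1..length (m # ms)}. x + sum_list (take k (m # ms)) > 0) \<longleftrightarrow>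
      x + m > 0 \<and> (\<forall>k\<in>{1..length ms}. x + m + sum_list (take k ms) > 0)"
    unfolding S by (simp add: add.assoc del: image_Suc_atLeastAtMost)
  thus ?case by (simp only: alive.simps Cons.IH)
qed auto

lemma end_positive_iff:
  "end_positive x (rev ms) \<longleftrightarrow> sum_list ms = x \<and> (\<forall>k\<in>{1..length ms}. sum_list (take k ms) > 0)"
proof (induction ms arbitrary: x rule: rev_induct)
  case (snoc m ms)
  have "{1..length (ms @ [m])} = insert (Suc (length ms)) {1..length ms}" by auto
  thus ?case using snoc by auto
qed auto

lemma end_nonneg_iff:
  "end_nonneg x (rev ms) \<longleftrightarrow> sum_list ms = x \<and> (\<forall>k\<in>{1..length ms}. sum_list (take k ms) \<ge> 0)"
proof (induction ms arbitrary: x rule: rev_induct)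
  case (snoc m ms)
  have "{1..length (ms @ [m])} = insert (Suc (length ms)) {1..length ms}" by auto
  thus ?case using snoc by auto
qed auto

text \<open>Over the integers, strict positivity of i + 1 + S is nonnegativity of i + S, which
  accounts for the shift.\<close>

lemma prob_alive: "measure_pmf.prob (replicate_pmf n q) {ms. alive (int i + 1) ms} = surv q n i"
proof (induction n arbitrary: i)
  case (Suc n)
  have "measure_pmf.prob (replicate_pmf n q) {ms. alive (int i + 1) (m # ms)} = zext (surv q n) (int i + m)" for m
  proof (cases "int i + m \<ge> 0")
    case True
    hence "int i + 1 + m = int (nat (int i + m)) + 1" by simp
    thus ?thesis using True Suc[of "nat (int i + m)"] by (simp add: zext_def add_ac)
  qed (auto simp: zext_def)
  thus ?case by (simp only: prob_replicate_pmf_Suc mem_Collect_eq surv.simps zconv_def)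
qed auto

lemma zconv_map_uminus: "zconv (map_pmf uminus q) f x = measure_pmf.expectation q (\<lambda>m. zext f (x - m))"
  by (simp add: zconv_def)

lemma prob_end_nonneg:
  "measure_pmf.prob (replicate_pmf n q) {ms. end_nonneg x ms} = zext (stay (map_pmf uminus q) n) x"
proof (induction n arbitrary: x)
  case 0
  show ?case by (auto simp: zext_def indicator_def)
next
  case (Suc n)
  show ?case
  proof (cases "x \<ge> 0")
    case True
    hence "{ms. end_nonneg x (m # ms)} = {ms. end_nonneg (x - m) ms}" for m by simp
    hence "measure_pmf.prob (replicate_pmf (Suc n) q) {ms. end_nonneg x ms} =
        measure_pmf.expectation q (\<lambda>m. zext (stay (map_pmf uminus q) n) (x - m))"
      by (simp only: prob_replicate_pmf_Suc mem_Collect_eq Suc.IH)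
    moreover have "zext (stay (map_pmf uminus q) (Suc n)) x = zconv (map_pmf uminus q) (stay (map_pmf uminus q) n) x"
      using True by (simp add: zext_def)
    ultimately show ?thesis by (simp only: zconv_map_uminus)
  next
    case False
    hence "{ms. end_nonneg x (m # ms)} = {}" for m by simp
    thus ?thesis using False by (simp add: prob_replicate_pmf_Suc zext_def del: replicate_pmf.simps end_nonneg.simps)
  qed
qed

text \<open>Viewed from the end point and lowered by 1, the positive positions become nonnegative
  and the origin becomes -1. The reversed path therefore first leaves the half-line with its last
  step, onto -1; \<open>hit\<close> at \<open>n\<close> exits at time n + 1, hence
  \<open>Suc n\<close> steps.\<close>

lemma prob_end_positive:
  "measure_pmf.prob (replicate_pmf (Suc n) q) {ms. end_positive x ms} = zext (hit (map_pmf uminus q) n) (x - 1)"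
proof (induction n arbitrary: x)
  case 0
  have "pmf (map_pmf uminus q) (- x) = pmf q x"
    by (rule pmf_map_inj') auto
  moreover have "measure_pmf.prob (replicate_pmf 0 q) {ms. end_positive x (m # ms)} = (if x > 0 then indicator {x} m else 0)" for m
    by (auto simp: indicator_def)
  ultimately show ?case
    by (auto simp: prob_replicate_pmf_Suc zext_def measure_pmf_single simp del: replicate_pmf.simps(2) end_positive.simps)
next
  case (Suc n)
  show ?case
  proof (cases "x > 0")
    case True
    hence "{ms. end_positive x (m # ms)} = {ms. end_positive (x - m) ms}" for m by simp
    hence "measure_pmf.prob (replicate_pmf (Suc (Suc n)) q) {ms. end_positive x ms} =
        measure_pmf.expectation q (\<lambda>m. zext (hit (map_pmf uminus q) n) (x - m - 1))"
      by (simp only: prob_replicate_pmf_Suc[of "Suc n"] mem_Collect_eq Suc.IH)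
    moreover have "zext (hit (map_pmf uminus q) (Suc n)) (x - 1) = zconv (map_pmf uminus q) (hit (map_pmf uminus q) n) (x - 1)"
      using True by (simp add: zext_def)
    moreover have "x - 1 - m = x - m - 1" for m by simp
    ultimately show ?thesis by (simp only: zconv_map_uminus)
  next
    case False
    hence "{ms. end_positive x (m # ms)} = {}" for m by simp
    thus ?thesis using False by (simp add: prob_replicate_pmf_Suc[of "Suc n"] zext_def del: replicate_pmf.simps end_positive.simps)
  qed
qed

section \<open>The coefficient functions\<close>

lemma less_Inf_enat_iff: "enat n < Inf (enat ` S) \<longleftrightarrow> (\<forall>k\<in>S. n < k)"
proof
  assume less: "enat n < Inf (enat ` S)"
  show "\<forall>k\<in>S. n < k"
  proof
    fix k assume "k \<in> S"
    hence "Inf (enat ` S) \<le> enat k" by (intro Inf_lower) auto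
    hence "enat n < enat k" using less by (rule order.strict_trans2[rotated])
    thus "n < k" by simp
  qed
next
  assume *: "\<forall>k\<in>S. n < k"
  have "enat (Suc n) \<le> Inf (enat ` S)"
    by (intro Inf_greatest) (use * in auto)
  moreover have "enat n < enat (Suc n)" by simp
  ultimately show "enat n < Inf (enat ` S)" by (rule order.strict_trans2[rotated])
qed

lemma tau_gt_iff: "tau Xs x \<omega> > enat n \<longleftrightarrow> (\<forall>k\<in>{1..n}. real x + walk Xs k \<omega> > 0)"
  unfolding tau_def less_Inf_enat_iff
  by (metis (mono_tags, lifting) atLeastAtMost_iff mem_Collect_eq not_le)

lemma tau_bar0_gt_iff: "tau_bar0 Xs \<omega> > enat n \<longleftrightarrow> (\<forall>k\<in>{1..n}. walk Xs k \<omega> \<ge> 0)"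
  unfolding tau_bar0_def less_Inf_enat_iff
  by (metis (mono_tags, lifting) atLeastAtMost_iff mem_Collect_eq not_le)

text \<open>The shift \<open>d\<close> moves the problem from positive to nonnegative positions and
  costs only the factor (1 + d)^D; the logarithms are absorbed into n^(1/4).\<close>

lemma expansionI:
  assumes "\<And>J. J \<ge> 2 \<Longrightarrow> \<exists>D L. unif_bigo (\<lambda>n x. w n x - (\<Sum>j=1..J. c j x * a_coeff (j + s) n))
      (\<lambda>n x. (1 + real x) ^ D / real n powr real (J + s) * ln (real n) ^ L)"
  shows "expansion s (\<lambda>n i. w n (i + d)) (\<lambda>j i. c j (i + d))"
  unfolding expansion_def
proof (intro allI impI)
  fix J :: nat assume "J \<ge> 2"
  from assms[OF this] obtain D L C N where *: "\<And>n x. n \<ge> N \<Longrightarrow>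
     \<bar>w n x - (\<Sum>j=1..J. c j x * a_coeff (j + s) n)\<bar> \<le> C * \<bar>(1 + real x) ^ D / real n powr real (J + s) * ln (real n) ^ L\<bar>"
    unfolding unif_bigo_def by blast
  obtain N' where N': "\<And>n. n \<ge> N' \<Longrightarrow> (1 * ln (real n) + 1) ^ L \<le> real n powr (1/4)"
    using ln_power_eventually_le[of 1 "1/4" L] by (auto simp: eventually_sequentially)
  show "\<exists>C D N. \<forall>n\<ge>N. \<forall>i. \<bar>w n (i + d) - (\<Sum>j=1..J. c j (i + d) * a_coeff (j + s) n)\<bar>
          \<le> C * (1 + real i) ^ D * real n powr (1/4 - real (J + s))"
  proof (intro exI allI impI)
    fix n i assume n: "n \<ge> Max {N, N', 1}"
    have n': "n \<ge> N" "n \<ge> N'" "n \<ge> 1" using n by auto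
    have ln0: "ln (real n) \<ge> 0" using n' by simp
    have "\<bar>w n (i + d) - (\<Sum>j=1..J. c j (i + d) * a_coeff (j + s) n)\<bar>
        \<le> C * \<bar>(1 + real (i + d)) ^ D / real n powr real (J + s) * ln (real n) ^ L\<bar>"
      by (rule *[OF n'(1)])
    also have "\<dots> \<le> \<bar>C\<bar> * \<bar>(1 + real (i + d)) ^ D / real n powr real (J + s) * ln (real n) ^ L\<bar>"
      by (intro mult_right_mono) auto
    also have "\<bar>(1 + real (i + d)) ^ D / real n powr real (J + s) * ln (real n) ^ L\<bar> =
        (1 + real (i + d)) ^ D * (real n powr (- real (J + s)) * ln (real n) ^ L)"
      unfolding powr_minus using ln0 by (simp add: divide_inverse)
    also have "\<bar>C\<bar> * \<dots> \<le> \<bar>C\<bar> * (((1 + real d) * (1 + real i)) ^ D * (real n powr (- real (J + s)) * real n powr (1/4)))"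
    proof (intro mult_left_mono mult_mono power_mono)
      have "ln (real n) ^ L \<le> (1 * ln (real n) + 1) ^ L" using ln0 by (intro power_mono) auto
      thus "ln (real n) ^ L \<le> real n powr (1/4)" using N'[OF n'(2)] by linarith
      show "1 + real (i + d) \<le> (1 + real d) * (1 + real i)" by (simp add: algebra_simps)
    qed (use ln0 in auto)
    also have "real n powr (- real (J + s)) * real n powr (1/4) = real n powr (1/4 - real (J + s))"
      by (subst powr_add[symmetric]) (simp add: algebra_simps)
    finally show "\<bar>w n (i + d) - (\<Sum>j=1..J. c j (i + d) * a_coeff (j + s) n)\<bar>
        \<le> (\<bar>C\<bar> * (1 + real d) ^ D) * (1 + real i) ^ D * real n powr (1/4 - real (J + s))"
      by (simp only: power_mult_distrib mult.assoc)
  qed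
qed

lemma tail_coeffs_expansion:
  assumes "tail_coeffs M Xs V"
  shows "expansion 0 (\<lambda>n i. measure M {\<omega> \<in> space M. tau Xs (i + d) \<omega> > enat n}) (\<lambda>j i. V j (i + d))"
proof (rule expansionI)
  fix J :: nat assume J: "J \<ge> 2"
  \<comment> \<open>The even order for which the number of terms is \<open>J\<close> and the error
    exponent is exactly \<open>J\<close>.\<close>
  define r where "r = 2 * J - 2"
  have r: "r \<ge> 2" "r div 2 + 1 = J" "(real r + 2) / 2 = real (J + 0)" using J by (auto simp: r_def of_nat_diff)
  show "\<exists>D L. unif_bigo (\<lambda>n x. measure M {\<omega> \<in> space M. tau Xs x \<omega> > enat n} - (\<Sum>j=1..J. V j x * a_coeff (j + 0) n))
      (\<lambda>n x. (1 + real x) ^ D / real n powr real (J + 0) * ln (real n) ^ L)"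
    using assms[unfolded tail_coeffs_def, rule_format, OF r(1)] unfolding r(2,3) add_0_right by blast
qed

lemma local_coeffs_expansion:
  assumes "local_coeffs M Xs T U"
  shows "expansion 1 (\<lambda>n i. measure M {\<omega> \<in> space M. walk Xs n \<omega> = real (i + d) \<and> T \<omega> > enat n}) (\<lambda>j i. U j (i + d))"
proof (rule expansionI)
  fix J :: nat assume J: "J \<ge> 2"
  \<comment> \<open>Here the order is odd: (r + 1)/2 = J terms and error exponent (r + 3)/2 = J +
    1.\<close>
  define r where "r = 2 * J - 1"
  have r: "r \<ge> 2" "(r + 1) div 2 = J" "(real r + 3) / 2 = real (J + 1)" using J by (auto simp: r_def of_nat_diff)
  show "\<exists>D L. unif_bigo (\<lambda>n x. measure M {\<omega> \<in> space M. walk Xs n \<omega> = real x \<and> T \<omega> > enat n} - (\<Sum>j=1..J. U j x * a_coeff (j + 1) n))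
      (\<lambda>n x. (1 + real x) ^ D / real n powr real (J + 1) * ln (real n) ^ L)"
    using assms[unfolded local_coeffs_def, rule_format, OF r(1)] unfolding r(2,3) by blast
qed

lemma centered_pmf_reflect:
  assumes "centered_pmf q R"
  shows "centered_pmf (map_pmf uminus q) R"
proof -
  interpret centered_pmf q R by fact
  show ?thesis
  proof
    show "R > 1" by (rule R_gt_1)
    show "integrable (measure_pmf (map_pmf uminus q)) (\<lambda>m. R ^ nat \<bar>m\<bar>)"
      using exp_int by simp
    show "measure_pmf.expectation (map_pmf uminus q) real_of_int = 0"
      using mean_zero by simp
    show "\<exists>m\<in>set_pmf (map_pmf uminus q). \<not> h dvd m" if "h \<ge> 2" for h :: int
      using aperiodic[OF that] by auto
  qed
qed

lemma lattice_step_pmf: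
  fixes X :: "'a \<Rightarrow> real"
  assumes "prob_space M" and X[measurable]: "X \<in> borel_measurable M"
    and mean: "(\<integral>\<omega>. X \<omega> \<partial>M) = 0"
    and exp: "\<exists>c>0. integrable M (\<lambda>\<omega>. exp (c * \<bar>X \<omega>\<bar>))"
    and lat: "lattice_max_span_1 M X"
  obtains q R where "centered_pmf q R" "distr M (count_space UNIV) (\<lambda>\<omega>. \<lfloor>X \<omega>\<rfloor>) = measure_pmf q"
proof -
  interpret prob_space M by fact
  have [measurable]: "(\<lambda>\<omega>. \<lfloor>X \<omega>\<rfloor>) \<in> measurable M (count_space UNIV)" by measurable
  have ints: "AE \<omega> in M. X \<omega> = of_int \<lfloor>X \<omega>\<rfloor>"
    using lat unfolding lattice_max_span_1_def by (auto elim: eventually_mono)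
  define D where "D = distr M (count_space UNIV) (\<lambda>\<omega>. \<lfloor>X \<omega>\<rfloor>)"
  have "prob_space D" unfolding D_def by (intro prob_space_distr) measurable
  then obtain q where q: "measure_pmf q = D"
    by (rule pmf_of_int_distr) (auto simp: D_def intro: that)
  obtain c where c: "c > 0" "integrable M (\<lambda>\<omega>. exp (c * \<bar>X \<omega>\<bar>))" using exp by blast
  have "centered_pmf q (exp c)"
  proof
    show "1 < exp c" using c by simp
    have "integrable M (\<lambda>\<omega>. exp c ^ nat \<bar>\<lfloor>X \<omega>\<rfloor>\<bar>)"
    proof (rule integrable_cong_AE_imp[OF c(2)])
      show "AE \<omega> in M. exp (c * \<bar>X \<omega>\<bar>) = exp c ^ nat \<bar>\<lfloor>X \<omega>\<rfloor>\<bar>"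
        using ints
      proof eventually_elim
        case (elim \<omega>)
        have "real (nat \<bar>\<lfloor>X \<omega>\<rfloor>\<bar>) = \<bar>X \<omega>\<bar>" using elim by (simp add: of_nat_nat)
        thus ?case by (simp add: exp_of_nat_mult[symmetric] mult.commute)
      qed
    qed measurable
    thus "integrable (measure_pmf q) (\<lambda>m. exp c ^ nat \<bar>m\<bar>)"
      unfolding q D_def by (subst integrable_distr_eq) auto
    have "measure_pmf.expectation q real_of_int = (\<integral>\<omega>. real_of_int \<lfloor>X \<omega>\<rfloor> \<partial>M)"
      unfolding q D_def by (subst integral_distr) auto
    also have "\<dots> = (\<integral>\<omega>. X \<omega> \<partial>M)"
      by (intro integral_cong_AE) (use ints in \<open>auto elim: eventually_mono\<close>)
    finally show "measure_pmf.expectation q real_of_int = 0" using mean by simp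
    show "\<exists>m\<in>set_pmf q. \<not> h dvd m" if h: "h \<ge> 2" for h :: int
    proof (rule ccontr)
      assume "\<not> (\<exists>m\<in>set_pmf q. \<not> h dvd m)"
      hence "AE m in measure_pmf q. h dvd m" by (auto simp: AE_measure_pmf_iff)
      hence "AE \<omega> in M. h dvd \<lfloor>X \<omega>\<rfloor>"
        unfolding q D_def by (subst (asm) AE_distr_iff) auto
      \<comment> \<open>Written as the residue class of a = 0, so as to contradict maximality of the
        span.\<close>
      with ints have "AE \<omega> in M. \<exists>m::int. X \<omega> = of_int (0 + h * m)"
      proof eventually_elim
        case (elim \<omega>)
        then obtain m where "\<lfloor>X \<omega>\<rfloor> = h * m" by (auto elim: dvdE)
        thus ?case using elim(1) by (intro exI[of _ m]) simp
      qed
      moreover have "{\<omega> \<in> space M. \<exists>m::int. X \<omega> = of_int (0 + h * m)} \<in> events" by measurable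
      ultimately have "prob {\<omega> \<in> space M. \<exists>m::int. X \<omega> = of_int (0 + h * m)} = 1"
        by (subst prob_Collect_eq_1) auto
      thus False using lat h unfolding lattice_max_span_1_def by blast
    qed
  qed
  thus ?thesis using that q D_def by auto
qed

section \<open>From the given walk to lists of integer steps\<close>

locale lattice_random_walk = prob_space M for M :: "'a measure" +
  fixes X :: "'a \<Rightarrow> real" and Xs :: "nat \<Rightarrow> 'a \<Rightarrow> real" and q :: "int pmf"
  assumes X_meas [measurable]: "X \<in> borel_measurable M"
    and ind: "indep_vars (\<lambda>_. borel) Xs {1..}"
    and ident: "\<And>i. i \<ge> 1 \<Longrightarrow> distr M borel (Xs i) = distr M borel X"
    and lattice: "AE \<omega> in M. X \<omega> \<in> \<int>"
    and step_law: "distr M (count_space UNIV) (\<lambda>\<omega>. \<lfloor>X \<omega>\<rfloor>) = measure_pmf q"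
begin

definition Y :: "nat \<Rightarrow> 'a \<Rightarrow> int" where "Y i \<omega> = \<lfloor>Xs i \<omega>\<rfloor>"

lemma Xs_meas: "i \<ge> 1 \<Longrightarrow> Xs i \<in> borel_measurable M"
  using ind by (auto simp: indep_vars_def)

lemma Y_indep: "indep_vars (\<lambda>_. count_space UNIV) Y {1..}"
  unfolding Y_def[abs_def] by (rule indep_vars_compose2[OF ind]) simp

lemma Y_law:
  assumes "i \<in> {1..}"
  shows "distr M (count_space UNIV) (Y i) = measure_pmf q"
proof -
  have [measurable]: "Xs i \<in> borel_measurable M" using assms by (intro Xs_meas) auto
  have "distr M (count_space UNIV) (Y i) = distr (distr M borel (Xs i)) (count_space UNIV) floor"
    by (subst distr_distr) (auto simp: Y_def[abs_def] o_def)
  also have "\<dots> = distr (distr M borel X) (count_space UNIV) floor" using ident assms by simp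
  also have "\<dots> = measure_pmf q"
    unfolding step_law[symmetric] by (subst distr_distr) (auto simp: o_def)
  finally show ?thesis .
qed

lemma Xs_eq_Y: "AE \<omega> in M. \<forall>i\<in>{1..}. Xs i \<omega> = of_int (Y i \<omega>)"
proof -
  have "AE \<omega> in M. Xs i \<omega> = of_int (Y i \<omega>)" if i: "i \<ge> 1" for i
  proof -
    have [measurable]: "Xs i \<in> borel_measurable M" using i by (rule Xs_meas)
    have "AE x in distr M borel X. x \<in> \<int>"
      using lattice by (subst AE_distr_iff) auto
    hence "AE \<omega> in M. Xs i \<omega> \<in> \<int>"
      unfolding ident[OF i, symmetric] by (subst (asm) AE_distr_iff) auto
    thus ?thesis by eventually_elim (auto simp: Y_def elim: Ints_cases)
  qed
  hence "AE \<omega> in M. \<forall>i. i \<ge> 1 \<longrightarrow> Xs i \<omega> = of_int (Y i \<omega>)"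
    by (subst AE_all_countable) auto
  thus ?thesis by eventually_elim auto
qed

lemma walk_meas [measurable]: "walk Xs n \<in> borel_measurable M"
  unfolding walk_def[abs_def] by (intro borel_measurable_sum Xs_meas) auto

lemma walk_eq_sum_list:
  assumes "\<forall>i\<in>{1..}. Xs i \<omega> = of_int (Y i \<omega>)" "k \<le> n"
  shows "walk Xs k \<omega> = of_int (sum_list (take k (map (\<lambda>i. Y i \<omega>) [1..<Suc n])))"
proof -
  have "take k (map (\<lambda>i. Y i \<omega>) [1..<Suc n]) = map (\<lambda>i. Y i \<omega>) [1..<Suc k]"
    using assms(2) by (simp add: take_map take_upt del: upt_Suc)
  also have "sum_list \<dots> = (\<Sum>i=1..k. Y i \<omega>)"
    by (simp add: interv_sum_list_conv_sum_set_nat atLeastLessThanSuc_atLeastAtMost del: upt_Suc)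
  also have "real_of_int \<dots> = walk Xs k \<omega>"
    unfolding walk_def of_int_sum by (intro sum.cong) (use assms(1) in auto)
  finally show ?thesis by simp
qed

text \<open>The pathwise equivalence is demanded only where all steps are integers, a set of full
  measure; elsewhere rounding may change the event.\<close>

lemma prob_eq_list:
  assumes "{\<omega>\<in>space M. A \<omega>} \<in> events" "distinct js" "set js \<subseteq> {1..}"
    and "\<And>\<omega>. \<forall>i\<in>{1..}. Xs i \<omega> = of_int (Y i \<omega>) \<Longrightarrow> A \<omega> \<longleftrightarrow> Q (map (\<lambda>i. Y i \<omega>) js)"
  shows "prob {\<omega>\<in>space M. A \<omega>} = measure_pmf.prob (replicate_pmf (length js) q) {ms. Q ms}"
proof -
  note list = iid_prob_list[OF Y_indep Y_law assms(2,3), of Q]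
  have "prob {\<omega>\<in>space M. A \<omega>} = prob {\<omega>\<in>space M. Q (map (\<lambda>i. Y i \<omega>) js)}"
  proof (rule measure_eq_AE)
    show "AE \<omega> in M. \<omega> \<in> {\<omega>\<in>space M. A \<omega>} \<longleftrightarrow> \<omega> \<in> {\<omega>\<in>space M. Q (map (\<lambda>i. Y i \<omega>) js)}"
      using Xs_eq_Y by eventually_elim (use assms(4) in auto)
  qed (use assms(1) list(1) in auto)
  thus ?thesis using list(2) by simp
qed

lemma prob_tau: "prob {\<omega>\<in>space M. tau Xs (Suc i) \<omega> > enat n} = surv q n i"
proof -
  have "prob {\<omega>\<in>space M. tau Xs (Suc i) \<omega> > enat n} =
      measure_pmf.prob (replicate_pmf (length [1..<Suc n]) q) {ms. alive (int i + 1) ms}"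
  proof (rule prob_eq_list)
    show "{\<omega>\<in>space M. tau Xs (Suc i) \<omega> > enat n} \<in> events"
      unfolding tau_gt_iff by measurable
    fix \<omega> assume Y: "\<forall>i\<in>{1..}. Xs i \<omega> = of_int (Y i \<omega>)"
    have "real (Suc i) + walk Xs k \<omega> > 0 \<longleftrightarrow> int i + 1 + sum_list (take k (map (\<lambda>i. Y i \<omega>) [1..<Suc n])) > 0"
      if "k \<le> n" for k
    proof -
      have "real (Suc i) + walk Xs k \<omega> = of_int (int i + 1 + sum_list (take k (map (\<lambda>i. Y i \<omega>) [1..<Suc n])))"
        unfolding walk_eq_sum_list[OF Y that] by simp
      thus ?thesis by (simp only: of_int_0_less_iff)
    qed
    thus "tau Xs (Suc i) \<omega> > enat n \<longleftrightarrow> alive (int i + 1) (map (\<lambda>i. Y i \<omega>) [1..<Suc n])"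
      unfolding tau_gt_iff alive_iff by (auto simp del: upt_Suc)
  qed auto
  thus ?thesis by (simp add: prob_alive del: upt_Suc)
qed

lemma prob_local_tau:
  "prob {\<omega>\<in>space M. walk Xs n \<omega> = real x \<and> tau Xs 0 \<omega> > enat n} =
     measure_pmf.prob (replicate_pmf n q) {ms. end_positive (int x) ms}"
proof -
  have "prob {\<omega>\<in>space M. walk Xs n \<omega> = real x \<and> tau Xs 0 \<omega> > enat n} =
      measure_pmf.prob (replicate_pmf (length (rev [1..<Suc n])) q) {ms. end_positive (int x) ms}"
  proof (rule prob_eq_list)
    show "{\<omega>\<in>space M. walk Xs n \<omega> = real x \<and> tau Xs 0 \<omega> > enat n} \<in> events"
      unfolding tau_gt_iff by measurable
    fix \<omega> assume Y: "\<forall>i\<in>{1..}. Xs i \<omega> = of_int (Y i \<omega>)"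
    have "walk Xs n \<omega> = real x \<longleftrightarrow> sum_list (map (\<lambda>i. Y i \<omega>) [1..<Suc n]) = int x"
      using walk_eq_sum_list[OF Y order.refl, of n] of_int_eq_iff[of _ "int x", where 'a = real]
      by (simp del: upt_Suc)
    moreover have "real 0 + walk Xs k \<omega> > 0 \<longleftrightarrow> sum_list (take k (map (\<lambda>i. Y i \<omega>) [1..<Suc n])) > 0"
      if "k \<le> n" for k
      unfolding walk_eq_sum_list[OF Y that] by (simp del: upt_Suc)
    ultimately show "(walk Xs n \<omega> = real x \<and> tau Xs 0 \<omega> > enat n) \<longleftrightarrow>
        end_positive (int x) (map (\<lambda>i. Y i \<omega>) (rev [1..<Suc n]))"
      unfolding tau_gt_iff rev_map[symmetric] end_positive_iff by (auto simp del: upt_Suc)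
  qed auto
  thus ?thesis by (simp del: upt_Suc)
qed

lemma prob_local_tau_bar0:
  "prob {\<omega>\<in>space M. walk Xs n \<omega> = real x \<and> tau_bar0 Xs \<omega> > enat n} = stay (map_pmf uminus q) n x"
proof -
  have "prob {\<omega>\<in>space M. walk Xs n \<omega> = real x \<and> tau_bar0 Xs \<omega> > enat n} =
      measure_pmf.prob (replicate_pmf (length (rev [1..<Suc n])) q) {ms. end_nonneg (int x) ms}"
  proof (rule prob_eq_list)
    show "{\<omega>\<in>space M. walk Xs n \<omega> = real x \<and> tau_bar0 Xs \<omega> > enat n} \<in> events"
      unfolding tau_bar0_gt_iff by measurable
    fix \<omega> assume Y: "\<forall>i\<in>{1..}. Xs i \<omega> = of_int (Y i \<omega>)"
    have "walk Xs n \<omega> = real x \<longleftrightarrow> sum_list (map (\<lambda>i. Y i \<omega>) [1..<Suc n]) = int x"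
      using walk_eq_sum_list[OF Y order.refl, of n] of_int_eq_iff[of _ "int x", where 'a = real]
      by (simp del: upt_Suc)
    moreover have "walk Xs k \<omega> \<ge> 0 \<longleftrightarrow> sum_list (take k (map (\<lambda>i. Y i \<omega>) [1..<Suc n])) \<ge> 0"
      if "k \<le> n" for k
      unfolding walk_eq_sum_list[OF Y that] by (simp del: upt_Suc)
    ultimately show "(walk Xs n \<omega> = real x \<and> tau_bar0 Xs \<omega> > enat n) \<longleftrightarrow>
        end_nonneg (int x) (map (\<lambda>i. Y i \<omega>) (rev [1..<Suc n]))"
      unfolding tau_bar0_gt_iff rev_map[symmetric] end_nonneg_iff by (auto simp del: upt_Suc)
  qed auto
  thus ?thesis by (simp add: prob_end_nonneg del: upt_Suc)
qed

end

section \<open>Nonvanishing in the local cases and assembly of the three expansions\<close>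

context centered_pmf
begin

lemma hit_Suc_not_small:
  assumes small: "\<And>n i. Suc n \<ge> N \<Longrightarrow> hit q n i \<le> C * (1 + real i) ^ D * real (Suc n) powr (- 9/4)"
  shows False
proof (rule hit_not_small)
  fix n i assume n: "n \<ge> max N 1"
  have "hit q n i \<le> C * (1 + real i) ^ D * real (Suc n) powr (- 9/4)"
    using n by (intro small) auto
  also have "\<dots> \<le> \<bar>C\<bar> * (1 + real i) ^ D * real n powr (- 9/4)"
    using n by (intro mult_mono mult_right_mono powr_mono2') auto
  finally show "hit q n i \<le> \<bar>C\<bar> * (1 + real i) ^ D * real n powr (- 9/4)" .
qed

lemma stay_not_small:
  assumes small: "\<And>n i. n \<ge> N \<Longrightarrow> stay q n i \<le> C * (1 + real i) ^ D * real n powr (- 9/4)"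
  shows False
proof (rule hit_Suc_not_small)
  fix n i assume n: "Suc n \<ge> N"
  have "hit q n i \<le> stay q (Suc n) (Suc i)" by (rule hit_le_stay)
  also have "\<dots> \<le> C * (1 + real (Suc i)) ^ D * real (Suc n) powr (- 9/4)"
    by (rule small[OF n])
  also have "\<dots> \<le> \<bar>C\<bar> * (2 * (1 + real i)) ^ D * real (Suc n) powr (- 9/4)"
    by (intro mult_mono mult_right_mono power_mono) auto
  finally show "hit q n i \<le> (\<bar>C\<bar> * 2 ^ D) * (1 + real i) ^ D * real (Suc n) powr (- 9/4)"
    by (simp only: power_mult_distrib mult.assoc)
qed

end

text \<open>The conclusion covers every rate up to \<delta>, so that rates from separate
  applications can be replaced by their minimum.\<close>

lemma exp_decay_bigo:
  fixes g :: "nat \<Rightarrow> real"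
  assumes "\<exists>P C r. degree P = d \<and> 0 < r \<and> r < 1 \<and> (\<forall>i. \<bar>g (i + s) - poly P (real i)\<bar> \<le> C * r ^ i)"
  shows "\<exists>P \<delta>. degree P = d \<and> \<delta> > 0 \<and> (\<forall>\<epsilon>\<le>\<delta>. (\<lambda>x. g x - poly P (real x)) \<in> O(\<lambda>x. exp (- \<epsilon> * real x)))"
proof -
  from assms obtain P C r where P: "degree P = d" "0 < r" "r < 1" "\<And>i. \<bar>g (i + s) - poly P (real i)\<bar> \<le> C * r ^ i"
    by blast
  \<comment> \<open>Composition with x - s undoes the shift of the space variable and preserves the
    degree.\<close>
  define Q where "Q = pcompose P [:- real s, 1:]"
  have C: "C \<ge> 0" using P(4)[of 0] by simp
  have "degree Q = d" using P(1) by (simp add: Q_def degree_pcompose)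
  moreover have "- ln r > 0" using P by simp
  moreover have "(\<lambda>x. g x - poly Q (real x)) \<in> O(\<lambda>x. exp (- \<epsilon> * real x))" if \<epsilon>: "\<epsilon> \<le> - ln r" for \<epsilon>
  proof (rule bigoI[where c = "C / r ^ s"])
    show "eventually (\<lambda>x. norm (g x - poly Q (real x)) \<le> C / r ^ s * norm (exp (- \<epsilon> * real x))) sequentially"
      using eventually_ge_at_top[of s]
    proof eventually_elim
      case (elim x)
      have "\<bar>g x - poly Q (real x)\<bar> \<le> C * r ^ (x - s)"
        using P(4)[of "x - s"] elim by (simp add: Q_def poly_pcompose of_nat_diff)
      also have "\<dots> = C / r ^ s * r ^ x" using P elim by (simp add: power_diff)
      also have "r ^ x = exp (ln r * real x)" using P by (simp add: exp_of_nat2_mult)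
      also have "C / r ^ s * exp (ln r * real x) \<le> C / r ^ s * exp (- \<epsilon> * real x)"
      proof (intro mult_left_mono)
        have "ln r * real x \<le> - \<epsilon> * real x" using \<epsilon> by (intro mult_right_mono) auto
        thus "exp (ln r * real x) \<le> exp (- \<epsilon> * real x)" by simp
      qed (use C P in auto)
      finally show ?case by simp
    qed
  qed
  ultimately show ?thesis by blast
qed

theorem theorem6:
  fixes M :: "'a measure"
    and X :: "'a \<Rightarrow> real"
    and Xs :: "nat \<Rightarrow> 'a \<Rightarrow> real"
    and V U U_bar :: "nat \<Rightarrow> nat \<Rightarrow> real"
  assumes "prob_space M"
    and "X \<in> borel_measurable M"
    and "prob_space.indep_vars M (\<lambda>_. borel) Xs {1..}"
    and "\<And>i. i \<ge> 1 \<Longrightarrow> distr M borel (Xs i) = distr M borel X"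
    and "integrable M X" and "(\<integral>\<omega>. X \<omega> \<partial>M) = 0"
    and "integrable M (\<lambda>\<omega>. (X \<omega>)\<^sup>2)" and "(\<integral>\<omega>. (X \<omega>)\<^sup>2 \<partial>M) > 0"
    and "\<exists>c>0. integrable M (\<lambda>\<omega>. exp (c * \<bar>X \<omega>\<bar>))"
    and "lattice_max_span_1 M X"
    and "tail_coeffs M Xs V"
    and "local_coeffs M Xs (tau Xs 0) U"
    and "local_coeffs M Xs (tau_bar0 Xs) U_bar"
  shows "\<forall>k\<ge>1. \<exists>P Q Q_bar :: real poly.
           degree P = 2 * k - 1 \<and> degree Q = 2 * k - 1 \<and> degree Q_bar = 2 * k - 1 \<and>
           (\<exists>\<epsilon>>0.
              (\<lambda>x. V k x - poly P (real x)) \<in> O(\<lambda>x. exp (- \<epsilon> * real x)) \<and>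
              (\<lambda>x. U k x - poly Q (real x)) \<in> O(\<lambda>x. exp (- \<epsilon> * real x)) \<and>
              (\<lambda>x. U_bar k x - poly Q_bar (real x)) \<in> O(\<lambda>x. exp (- \<epsilon> * real x)))"
proof (intro allI impI)
  fix k :: nat assume k: "k \<ge> 1"
  obtain q R where q: "centered_pmf q R" "distr M (count_space UNIV) (\<lambda>\<omega>. \<lfloor>X \<omega>\<rfloor>) = measure_pmf q"
    using lattice_step_pmf[OF assms(1,2,6,9,10)] by blast
  interpret centered_pmf q R by fact
  \<comment> \<open>As functions of the end point, the local probabilities evolve under the adjoint
    operator, which is the killed operator of the reflected step.\<close>
  define q' where "q' = map_pmf uminus q"
  interpret refl: centered_pmf q' R unfolding q'_def by (rule centered_pmf_reflect[OF q(1)])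
  have "AE \<omega> in M. X \<omega> \<in> \<int>" using assms(10) by (simp add: lattice_max_span_1_def)
  then interpret lattice_random_walk M X Xs q
    using assms(1-4) q(2) unfolding lattice_random_walk_def lattice_random_walk_axioms_def by blast

  have "\<exists>P C r. degree P = 2 * k - 1 \<and> 0 < r \<and> r < 1 \<and> (\<forall>i. \<bar>V k (i + 1) - poly P (real i)\<bar> \<le> C * r ^ i)"
  proof (rule expansion_coeffs_asymptotics[OF tail_coeffs_expansion[OF assms(11), of 1], where ?N0.0 = 0])
    fix N C D
    assume small: "\<And>n i. n \<ge> N \<Longrightarrow> prob {\<omega> \<in> space M. tau Xs (i + 1) \<omega> > enat n} \<le>
        C * (1 + real i) ^ D * real n powr (- real 0 - 5/4)"
    show False
      by (rule surv_not_small[of N C]) (use small[of _ 0] prob_tau in simp)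
  qed (use k prob_tau surv_bounds in simp_all)
  from exp_decay_bigo[OF this] obtain P \<delta>1 where P: "degree P = 2 * k - 1" "\<delta>1 > 0"
    "\<And>\<epsilon>. \<epsilon> \<le> \<delta>1 \<Longrightarrow> (\<lambda>x. V k x - poly P (real x)) \<in> O(\<lambda>x. exp (- \<epsilon> * real x))" by blast

  have hit: "prob {\<omega> \<in> space M. walk Xs (Suc n) \<omega> = real (i + 1) \<and> tau Xs 0 \<omega> > enat (Suc n)} = hit q' n i" for n i
    using prob_local_tau[of "Suc n" "i + 1"] prob_end_positive[of n q "int (i + 1)"]
    by (simp add: q'_def del: replicate_pmf.simps)
  \<comment> \<open>The recursion starts at time 1: at time 0 the walk sits at the origin, outside
    the positive positions, so the first step is not an application of the operator.\<close>
  have "\<exists>P C r. degree P = 2 * k - 1 \<and> 0 < r \<and> r < 1 \<and> (\<forall>i. \<bar>U k (i + 1) - poly P (real i)\<bar> \<le> C * r ^ i)"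
  proof (rule refl.expansion_coeffs_asymptotics[OF local_coeffs_expansion[OF assms(12), of 1], where ?N0.0 = 1])
    fix N C D
    assume small: "\<And>n i. n \<ge> N \<Longrightarrow> prob {\<omega> \<in> space M. walk Xs n \<omega> = real (i + 1) \<and> tau Xs 0 \<omega> > enat n} \<le>
        C * (1 + real i) ^ D * real n powr (- real 1 - 5/4)"
    have "- real 1 - 5/4 = (- 9/4 :: real)" by simp
    note small = small[unfolded this]
    show False
      by (rule refl.hit_Suc_not_small[of N C D]) (use small[of "Suc _", unfolded hit] in blast)
  next
    fix n i :: nat assume "n \<ge> 1"
    then obtain m where m: "n = Suc m" by (cases n) auto
    show "prob {\<omega> \<in> space M. walk Xs (Suc n) \<omega> = real (i + 1) \<and> tau Xs 0 \<omega> > enat (Suc n)} =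
      zconv q' (\<lambda>i. prob {\<omega> \<in> space M. walk Xs n \<omega> = real (i + 1) \<and> tau Xs 0 \<omega> > enat n}) (int i)"
      unfolding m hit by simp
  qed (use k in simp_all)
  from exp_decay_bigo[OF this] obtain Q \<delta>2 where Q: "degree Q = 2 * k - 1" "\<delta>2 > 0"
    "\<And>\<epsilon>. \<epsilon> \<le> \<delta>2 \<Longrightarrow> (\<lambda>x. U k x - poly Q (real x)) \<in> O(\<lambda>x. exp (- \<epsilon> * real x))" by blast

  \<comment> \<open>The origin is itself an allowed position here, so there is no shift and the
    recursion holds from time 0.\<close>
  have "\<exists>P C r. degree P = 2 * k - 1 \<and> 0 < r \<and> r < 1 \<and> (\<forall>i. \<bar>U_bar k (i + 0) - poly P (real i)\<bar> \<le> C * r ^ i)"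
  proof (rule refl.expansion_coeffs_asymptotics[OF local_coeffs_expansion[OF assms(13), of 0], where ?N0.0 = 0])
    fix N C D
    assume small: "\<And>n i. n \<ge> N \<Longrightarrow> prob {\<omega> \<in> space M. walk Xs n \<omega> = real (i + 0) \<and> tau_bar0 Xs \<omega> > enat n} \<le>
        C * (1 + real i) ^ D * real n powr (- real 1 - 5/4)"
    have "- real 1 - 5/4 = (- 9/4 :: real)" by simp
    note small = small[unfolded this add_0_right prob_local_tau_bar0, folded q'_def]
    show False
      by (rule refl.stay_not_small[of N C D]) (use small in blast)
  next
    fix n i :: nat
    show "prob {\<omega> \<in> space M. walk Xs (Suc n) \<omega> = real (i + 0) \<and> tau_bar0 Xs \<omega> > enat (Suc n)} =
      zconv q' (\<lambda>i. prob {\<omega> \<in> space M. walk Xs n \<omega> = real (i + 0) \<and> tau_bar0 Xs \<omega> > enat n}) (int i)"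
      unfolding add_0_right prob_local_tau_bar0 q'_def[symmetric] by simp
  qed (use k in simp_all)
  from exp_decay_bigo[OF this] obtain Q_bar \<delta>3 where Q_bar: "degree Q_bar = 2 * k - 1" "\<delta>3 > 0"
    "\<And>\<epsilon>. \<epsilon> \<le> \<delta>3 \<Longrightarrow> (\<lambda>x. U_bar k x - poly Q_bar (real x)) \<in> O(\<lambda>x. exp (- \<epsilon> * real x))" by blast

  define \<epsilon> where "\<epsilon> = min \<delta>1 (min \<delta>2 \<delta>3)"
  have \<epsilon>: "\<epsilon> > 0" "\<epsilon> \<le> \<delta>1" "\<epsilon> \<le> \<delta>2" "\<epsilon> \<le> \<delta>3" using P(2) Q(2) Q_bar(2) by (auto simp: \<epsilon>_def)
  show "\<exists>P Q Q_bar :: real poly.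
           degree P = 2 * k - 1 \<and> degree Q = 2 * k - 1 \<and> degree Q_bar = 2 * k - 1 \<and>
           (\<exists>\<epsilon>>0.
              (\<lambda>x. V k x - poly P (real x)) \<in> O(\<lambda>x. exp (- \<epsilon> * real x)) \<and>
              (\<lambda>x. U k x - poly Q (real x)) \<in> O(\<lambda>x. exp (- \<epsilon> * real x)) \<and>
              (\<lambda>x. U_bar k x - poly Q_bar (real x)) \<in> O(\<lambda>x. exp (- \<epsilon> * real x)))"
    by (intro exI[of _ P] exI[of _ Q] exI[of _ Q_bar] exI[of _ \<epsilon>] conjI P Q Q_bar \<epsilon>)
qed

end
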